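(* Let $\mathcal G=(\mathcal P_S,\mathcal P_E,\mathcal T,\mathcal F,\mathit{In},\mathcal W)$ be a sliceable Petri game with reachability objective (winning places $\mathcal W$), let $\{\varsigma\}_{\varsigma\in\mathscr S}$ be a distribution of $\mathcal G$ into slices, and let $\mathcal C_{\mathcal G}$ and $\widehat{\mathcal C_{\mathcal G}}$ be the control games constructed from this distribution as described in the context. Then $\mathcal G$ and $\mathcal C_{\mathcal G}$ are strategy-equivalent. Moreover, $\mathcal G$ and $\widehat{\mathcal C_{\mathcal G}}$ are strategy-equivalent if deterministic Petri game strategies are required, i.e., for every winning deterministic strategy for $\mathcal G$ there is a bisimilar winning controller for $\widehat{\mathcal C_{\mathcal G}}$, and for every winning controller for $\widehat{\mathcal C_{\mathcal G}}$ there is a bisimilar winning deterministic strategy for $\mathcal G$.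
   Context: Control games. Let $\mathscr P$ be a finite set of processes, $\Sigma$ a finite set of actions and $\mathit{dom}:\Sigma\to 2^{\mathscr P}\setminus\{\emptyset\}$; $\Sigma_p=\{a\mid p\in\mathit{dom}(a)\}$. An asynchronous automaton $\mathcal A=(\{S_p\}_{p\in\mathscr P},s_{in},\{\delta_a\}_{a\in\Sigma})$ has finite sets of local states $S_p$, an initial global state $s_{in}\in\prod_p S_p$, and partial functions $\delta_a:\prod_{p\in\mathit{dom}(a)}S_p\rightharpoonup\prod_{p\in\mathit{dom}(a)}S_p$. A global step $s\xrightarrow{a}s'$ holds iff $\delta_a(s_{\mathit{dom}(a)})=s'_{\mathit{dom}(a)}$ and $s,s'$ agree outside $\mathit{dom}(a)$. $\mathit{Plays}(\mathcal A)$ is the set of finite and infinite action sequences executable from $s_{in}$, taken up to trace equivalence (commuting adjacent actions with disjoint domains). $\mathit{state}(u)$ is the global state after a finite play $u$. The $p$-view $\mathit{view}_p(u)$ is the shortest trace $v$ with $u\sim vw$ where $w$ contains no action of $\Sigma_p$; $\mathit{Plays}_p$ is the set of $p$-views. A control game $\mathcal C=(\mathcal A,\Sigma^{sys},\Sigma^{env},\{\mathcal S_p\})$ partitions $\Sigma$ into controllable $\Sigma^{sys}$ and uncontrollable $\Sigma^{env}$ actions and fixes special local states (winning states $\mathcal W_p$ for reachability, losing states $\mathcal B_p$ for safety). A controller $\varrho=\{f_p\}_{p}$ has local controllers $f_p:\mathit{Plays}_p\to 2^{\Sigma^{sys}\cap\Sigma_p}$; $\mathit{Plays}(\mathcal C,\varrho)$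 is the smallest set containing the empty play such that if $u$ is in it and $ua\in\mathit{Plays}(\mathcal A)$ with either $a\in\Sigma^{env}$, or $a\in\Sigma^{sys}$ and $a\in f_p(\mathit{view}_p(u))$ for all $p\in\mathit{dom}(a)$, then $ua$ is in it. Final plays are finite plays of $\mathit{Plays}(\mathcal C,\varrho)$ with no extension in it. $\varrho$ is (reachability-)winning if all its plays are finite and in every final play every process ends in a winning state. The number of players of $\mathcal C$ is $|\mathscr P|$. A parallel composition of local deterministic automata $(Q_p,q_{0,p},\vartheta_p\subseteq Q_p\times\Sigma_p\times Q_p)$ is the asynchronous automaton with $S_p=Q_p$, $s_{in}=(q_{0,p})_p$, and $\delta_a((s_p)_{p\in\mathit{dom}(a)})=(s'_p)_{p}$ iff $(s_p,a,s'_p)\in\vartheta_p$ for all $p\in\mathit{dom}(a)$ (undefined otherwise). Petri games. A Petri net $(\mathcal P,\mathcal T,\mathcal F,\mathit{In})$ has a flow multiset $\mathcal F$ over $(\mathcal P\times\mathcal T)\cup(\mathcal T\times\mathcal P)$ and initial marking $\mathit{In}$ (multiset over $\mathcal P$); ${}^\bullet x$, $x^\bullet$ are pre/postsets; $t$ is enabled in $M$ if ${}^\bullet t\subseteq M$ and then fires to $M-{}^\bullet t+t^\bullet$; a marking is final if nothing is enabled. Branching processes $(\mathcal N^\sigma,\lambda)$ (occurrence net with initial homomorphism $\lambda$ into the net, injective on transitions with equal presets) and pairwise concurrent places are as usual. A Petri game $\mathcal G=(\mathcal P_S,\mathcal P_E,\mathcal T,\mathcal F,\mathit{In},\mathcal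 W)$ is a finite Petri net with places partitioned into system places $\mathcal P_S$ and environment places $\mathcal P_E$ and winning places $\mathcal W$. A strategy is a branching process $\sigma=(\mathcal N^\sigma,\lambda)$ with justified refusal: whenever $C$ is a set of pairwise concurrent places of $\mathcal N^\sigma$ and $t\in\mathcal T$ with $\lambda[C]={}^\bullet t$, either some $t'$ with $\lambda(t')=t$ and ${}^\bullet t'=C$ exists, or some $q\in C$ with $\lambda(q)\in\mathcal P_S$ satisfies $t\notin\lambda[q^\bullet]$. $\sigma$ is (reachability-)winning if $\mathcal N^\sigma$ is finite and in every final reachable marking every token is on a place labelled in $\mathcal W$; deterministic if for every reachable marking $M$ and system place $q\in M$ at most one transition of $q^\bullet$ is enabled in $M$. Slices. A slice of a net $\mathcal N$ is a subnet $\varsigma=(\mathcal P^\varsigma,\mathcal T^\varsigma,\mathcal F^\varsigma,\mathit{In}^\varsigma)$ ($\mathcal P^\varsigma\subseteq\mathcal P$, $\mathcal T^\varsigma\subseteq\mathcal T$, $\mathit{In}^\varsigma\subseteq\mathit{In}$, $\mathcal F^\varsigma$ the restriction of $\mathcal F$) with $|\mathit{In}^\varsigma|=1$, $|{}^\bullet t|=|t^\bullet|=1$ in $\varsigma$ for every $t\in\mathcal T^\varsigma$, and $q^\bullet\subseteq\mathcal T^\varsigma$ (postset in $\mathcal N$) for every $q\in\mathcal P^\varsigma$. $\mathcal N$ is sliceable if there is a family of slices whose place sets partition $\mathcal P$ and whose composition (disjoint union of places, flows and initial markings; union of transitions) equals $\mathcal N$. Construction of $\mathcal C_{\mathcal G}$.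 Processes are the slices $\mathscr S$. Actions: $\Sigma=\mathcal T\cup\{\tau_{(q,A)}\mid q\in\mathcal P_S, A\subseteq q^\bullet\}$, with $\mathit{dom}(t)=\{\varsigma\mid t\in\mathcal T^\varsigma\}$ and $\mathit{dom}(\tau_{(q,A)})=\{\varsigma\}$ for the unique slice with $q\in\mathcal P^\varsigma$. The local automaton of $\varsigma$ has states $\mathcal P^\varsigma\cup\{(q,A)\mid q\in\mathcal P^\varsigma\cap\mathcal P_S, A\subseteq q^\bullet\}$, initial state the initial place of $\varsigma$, and transitions: (1) $q\xrightarrow{\tau_{(q,A)}}(q,A)$ for $q\in\mathcal P_S$; (2) $q\xrightarrow{t}q'$ for $q\in\mathcal P_E$, $t\in\mathcal T$ with $q\in{}^\bullet t$, $q'\in t^\bullet$ in $\varsigma$; (3) $(q,A)\xrightarrow{t}q'$ for $q\in\mathcal P_S$, $t\in A$, $q\in{}^\bullet t$, $q'\in t^\bullet$ in $\varsigma$. $\mathcal C_{\mathcal G}$ has the parallel composition as arena, $\Sigma^{sys}=\{\tau_{(q,A)}\}$, $\Sigma^{env}=\mathcal T$, and winning states $\mathcal W_\varsigma=(\mathcal W\cap\mathcal P^\varsigma)\cup\{(q,A)\mid q\in\mathcal W\cap\mathcal P^\varsigma\}$. $\widehat{\mathcal C_{\mathcal G}}$ additionally has a non-winning state $\bot_\varsigma$ in each process and uncontrollable actions $\text{↯}^{(q,A)}_{[t_1,t_2]}$ for $q\in\mathcal P_S$, $A\subseteq q^\bullet$, $t_1\neq t_2\in A$, with domain $\{\varsigma\mid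 t_1\in\mathcal T^\varsigma\vee t_2\in\mathcal T^\varsigma\}$, and local transitions to $\bot_\varsigma$: (4) $(q,A)\xrightarrow{\text{↯}^{(q,A)}_{[t_1,t_2]}}\bot_\varsigma$; (5) $q\xrightarrow{\text{↯}^{(q',A')}_{[t_1,t_2]}}\bot_\varsigma$ if $q'$ is not a state of $\varsigma$, $q\in\mathcal P_E$, and for $i=1,2$: $t_i\in\mathcal T^\varsigma\Rightarrow t_i\in q^\bullet$; (6) $(q,A)\xrightarrow{\text{↯}^{(q',A')}_{[t_1,t_2]}}\bot_\varsigma$ if $q'$ is not a state of $\varsigma$ and for $i=1,2$: $t_i\in\mathcal T^\varsigma\Rightarrow t_i\in A$. Bisimilarity and strategy-equivalence. Transitions of $\mathcal G$ are identified with the equally named actions (observable); all other actions are internal, written $\tau$ (transitions of $\mathcal N^\sigma$ are identified with their $\lambda$-labels). A strategy $\sigma$ and a controller $\varrho$ are bisimilar if there is a relation $\approx$ between reachable markings of $\mathcal N^\sigma$ and finite plays of $\mathit{Plays}(\mathcal C,\varrho)$ with $\mathit{In}^\sigma\approx\epsilon$ such that: if $M\approx u$ and $M\xrightarrow{a}M'$ (observable $a$) then some $u'=u\tau^*a\tau^*\in\mathit{Plays}(\mathcal C,\varrho)$ has $M'\approx u'$; if $M\approx u$ and $M\xrightarrow{\tau}M'$ then some $u'=u\tau^*$ in $\mathit{Plays}(\mathcal C,\varrho)$ has $M'\approx u'$; if $M\approx u$ and $ua\in\mathit{Plays}(\mathcal C,\varrho)$ (observable $a$) then some $M'$ with $M\xrightarrow{\tau^*a\tau^*}M'$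 has $M'\approx ua$; if $M\approx u$ and $u\tau\in\mathit{Plays}(\mathcal C,\varrho)$ then some $M'$ with $M\xrightarrow{\tau^*}M'$ has $M'\approx u\tau$. $\mathcal G$ and $\mathcal C$ are strategy-equivalent if every winning strategy for $\mathcal G$ has a bisimilar winning controller for $\mathcal C$ and every winning controller for $\mathcal C$ has a bisimilar winning strategy for $\mathcal G$.
   Formalization: Equivalence is restricted to winning controllers that never offer one process two different commitments after the same play (a winning controller offering both {a} and {b} can have no bisimilar strategy); it is also proved that every winning controller can be restricted to such a winning one. *)

theory Defs
  imports
    "HOL-Library.Multiset"
    "HOL-Library.FuncSet"
    "HOL-Library.Disjoint_Sets"
    "HOL-Library.Infinite_Typeclass"
begin

section \<open>Petri nets\<close>

text \<open>
  The flow multiset is given by the presets and postsets of the transitions: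
  \<open>count (pre N t) q\<close> is the multiplicity of \<open>(q, t)\<close>, \<open>count (post N t) q\<close> that of \<open>(t, q)\<close>.
  This also covers infinite nets (strategies need not be finite), where the flow as a whole is not
  a finite multiset. The values of \<open>pre\<close> and \<open>post\<close> outside \<open>transitions\<close> are irrelevant.
\<close>

record ('p, 't) net =
  places :: "'p set"
  transitions :: "'t set"
  pre :: "'t \<Rightarrow> 'p multiset"
  post :: "'t \<Rightarrow> 'p multiset"
  initial :: "'p multiset"

definition petri_net :: "('p, 't, 'z) net_scheme \<Rightarrow> bool" where
  "petri_net N \<longleftrightarrow>
     (\<forall>t \<in> transitions N. set_mset (pre N t) \<subseteq> places N \<and> set_mset (post N t) \<subseteq> places N) \<and>
     set_mset (initial N) \<subseteq> places N"

definition finite_net :: "('p, 't, 'z) net_scheme \<Rightarrow> bool" where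
  "finite_net N \<longleftrightarrow> finite (places N) \<and> finite (transitions N)"

definition place_post :: "('p, 't, 'z) net_scheme \<Rightarrow> 'p \<Rightarrow> 't set" where
  "place_post N q = {t \<in> transitions N. q \<in># pre N t}"

definition place_pre :: "('p, 't, 'z) net_scheme \<Rightarrow> 'p \<Rightarrow> 't set" where
  "place_pre N q = {t \<in> transitions N. q \<in># post N t}"

definition enabled :: "('p, 't, 'z) net_scheme \<Rightarrow> 'p multiset \<Rightarrow> 't \<Rightarrow> bool" where
  "enabled N M t \<longleftrightarrow> t \<in> transitions N \<and> pre N t \<subseteq># M"

definition fire :: "('p, 't, 'z) net_scheme \<Rightarrow> 'p multiset \<Rightarrow> 't \<Rightarrow> 'p multiset" where
  "fire N M t = M - pre N t + post N t"

inductive reachable :: "('p, 't, 'z) net_scheme \<Rightarrow> 'p multiset \<Rightarrow> bool" for N where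
  reachable_initial: "reachable N (initial N)"
| reachable_fire: "reachable N M \<Longrightarrow> enabled N M t \<Longrightarrow> reachable N (fire N M t)"

definition final_marking :: "('p, 't, 'z) net_scheme \<Rightarrow> 'p multiset \<Rightarrow> bool" where
  "final_marking N M \<longleftrightarrow> (\<forall>t. \<not> enabled N M t)"


subsection \<open>Occurrence nets and branching processes\<close>

definition flow_rel :: "('p, 't, 'z) net_scheme \<Rightarrow> (('p + 't) \<times> ('p + 't)) set" where
  "flow_rel N =
     {(Inl q, Inr t) | q t. t \<in> transitions N \<and> q \<in># pre N t} \<union>
     {(Inr t, Inl q) | q t. t \<in> transitions N \<and> q \<in># post N t}"

definition conflict :: "('p, 't, 'z) net_scheme \<Rightarrow> 'p + 't \<Rightarrow> 'p + 't \<Rightarrow> bool" where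
  "conflict N x y \<longleftrightarrow>
     (\<exists>q t1 t2. t1 \<in> place_post N q \<and> t2 \<in> place_post N q \<and> t1 \<noteq> t2 \<and>
        (Inr t1, x) \<in> (flow_rel N)\<^sup>* \<and> (Inr t2, y) \<in> (flow_rel N)\<^sup>*)"

definition concurrent :: "('p, 't, 'z) net_scheme \<Rightarrow> 'p + 't \<Rightarrow> 'p + 't \<Rightarrow> bool" where
  "concurrent N x y \<longleftrightarrow>
     (x, y) \<notin> (flow_rel N)\<^sup>* \<and> (y, x) \<notin> (flow_rel N)\<^sup>* \<and> \<not> conflict N x y"

definition pairwise_concurrent :: "('p, 't, 'z) net_scheme \<Rightarrow> 'p set \<Rightarrow> bool" where
  "pairwise_concurrent N C \<longleftrightarrow>
     C \<subseteq> places N \<and> (\<forall>q \<in> C. \<forall>q' \<in> C. q \<noteq> q' \<longrightarrow> concurrent N (Inl q) (Inl q'))"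

text \<open>\<open>wf (flow_rel N)\<close> says that there is no infinite path against the flow.\<close>

definition occurrence_net :: "('p, 't, 'z) net_scheme \<Rightarrow> bool" where
  "occurrence_net N \<longleftrightarrow>
     petri_net N \<and>
     (\<forall>t \<in> transitions N. \<forall>q. count (pre N t) q \<le> 1 \<and> count (post N t) q \<le> 1) \<and>
     initial N = mset_set {q \<in> places N. place_pre N q = {}} \<and>
     finite {q \<in> places N. place_pre N q = {}} \<and>
     (\<forall>q \<in> places N. \<forall>t1 \<in> place_pre N q. \<forall>t2 \<in> place_pre N q. t1 = t2) \<and>
     wf (flow_rel N) \<and>
     (\<forall>t \<in> transitions N. \<not> conflict N (Inr t) (Inr t))"

record ('q, 'u, 'p, 't) labelled_net = "('q, 'u) net" +
  place_label :: "'q \<Rightarrow> 'p"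
  trans_label :: "'u \<Rightarrow> 't"

definition initial_homomorphism ::
    "('q, 'u, 'p, 't) labelled_net \<Rightarrow> ('p, 't, 'z) net_scheme \<Rightarrow> bool" where
  "initial_homomorphism \<sigma> N \<longleftrightarrow>
     place_label \<sigma> ` places \<sigma> \<subseteq> places N \<and>
     trans_label \<sigma> ` transitions \<sigma> \<subseteq> transitions N \<and>
     (\<forall>t \<in> transitions \<sigma>.
        image_mset (place_label \<sigma>) (pre \<sigma> t) = pre N (trans_label \<sigma> t) \<and>
        image_mset (place_label \<sigma>) (post \<sigma> t) = post N (trans_label \<sigma> t)) \<and>
     image_mset (place_label \<sigma>) (initial \<sigma>) = initial N"

definition branching_process ::
    "('p, 't, 'z) net_scheme \<Rightarrow> ('q, 'u, 'p, 't) labelled_net \<Rightarrow> bool" where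
  "branching_process N \<sigma> \<longleftrightarrow>
     occurrence_net \<sigma> \<and> initial_homomorphism \<sigma> N \<and>
     (\<forall>t \<in> transitions \<sigma>. \<forall>t' \<in> transitions \<sigma>.
        pre \<sigma> t = pre \<sigma> t' \<and> trans_label \<sigma> t = trans_label \<sigma> t' \<longrightarrow> t = t')"


section \<open>Petri games\<close>

record ('p, 't) petri_game = "('p, 't) net" +
  sys_places :: "'p set"
  env_places :: "'p set"
  win_places :: "'p set"

definition petri_game :: "('p, 't) petri_game \<Rightarrow> bool" where
  "petri_game G \<longleftrightarrow>
     petri_net G \<and> finite_net G \<and>
     places G = sys_places G \<union> env_places G \<and> sys_places G \<inter> env_places G = {} \<and>
     win_places G \<subseteq> places G"

definition justified_refusal ::
    "('p, 't) petri_game \<Rightarrow> ('q, 'u, 'p, 't) labelled_net \<Rightarrow> bool" where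
  "justified_refusal G \<sigma> \<longleftrightarrow>
     (\<forall>C. \<forall>t \<in> transitions G.
        finite C \<and> pairwise_concurrent \<sigma> C \<and>
        image_mset (place_label \<sigma>) (mset_set C) = pre G t \<longrightarrow>
          (\<exists>t' \<in> transitions \<sigma>. trans_label \<sigma> t' = t \<and> pre \<sigma> t' = mset_set C) \<or>
          (\<exists>q \<in> C. place_label \<sigma> q \<in> sys_places G \<and> t \<notin> trans_label \<sigma> ` place_post \<sigma> q))"

definition strategy :: "('p, 't) petri_game \<Rightarrow> ('q, 'u, 'p, 't) labelled_net \<Rightarrow> bool" where
  "strategy G \<sigma> \<longleftrightarrow> branching_process G \<sigma> \<and> justified_refusal G \<sigma>"

definition winning_strategy ::
    "('p, 't) petri_game \<Rightarrow> ('q, 'u, 'p, 't) labelled_net \<Rightarrow> bool" where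
  "winning_strategy G \<sigma> \<longleftrightarrow>
     strategy G \<sigma> \<and> finite_net \<sigma> \<and>
     (\<forall>M. reachable \<sigma> M \<and> final_marking \<sigma> M \<longrightarrow>
        (\<forall>q \<in># M. place_label \<sigma> q \<in> win_places G))"

definition deterministic_strategy ::
    "('p, 't) petri_game \<Rightarrow> ('q, 'u, 'p, 't) labelled_net \<Rightarrow> bool" where
  "deterministic_strategy G \<sigma> \<longleftrightarrow>
     (\<forall>M q. reachable \<sigma> M \<and> q \<in># M \<and> place_label \<sigma> q \<in> sys_places G \<longrightarrow>
        (\<forall>t1 \<in> place_post \<sigma> q. \<forall>t2 \<in> place_post \<sigma> q.
           enabled \<sigma> M t1 \<and> enabled \<sigma> M t2 \<longrightarrow> t1 = t2))"


subsection \<open>Slices\<close>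

definition slice :: "('p, 't, 'z) net_scheme \<Rightarrow> ('p, 't) net \<Rightarrow> bool" where
  "slice N sl \<longleftrightarrow>
     petri_net sl \<and>
     places sl \<subseteq> places N \<and> transitions sl \<subseteq> transitions N \<and> initial sl \<subseteq># initial N \<and>
     (\<forall>t \<in> transitions sl.
        pre sl t = filter_mset (\<lambda>q. q \<in> places sl) (pre N t) \<and>
        post sl t = filter_mset (\<lambda>q. q \<in> places sl) (post N t)) \<and>
     size (initial sl) = 1 \<and>
     (\<forall>t \<in> transitions sl. size (pre sl t) = 1 \<and> size (post sl t) = 1) \<and>
     (\<forall>q \<in> places sl. place_post N q \<subseteq> transitions sl)"

text \<open>
  A family of slices is given by the set of its members; as slices have nonempty, pairwise disjoint
  place sets, no two members of a family coincide.
\<close>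

definition slice_distribution ::
    "('p, 't, 'z) net_scheme \<Rightarrow> ('p, 't) net set \<Rightarrow> bool" where
  "slice_distribution N S \<longleftrightarrow>
     finite S \<and> (\<forall>sl \<in> S. slice N sl) \<and>
     disjoint_family_on places S \<and>
     places N = (\<Union>sl \<in> S. places sl) \<and>
     transitions N = (\<Union>sl \<in> S. transitions sl) \<and>
     (\<forall>t \<in> transitions N.
        pre N t = (\<Sum>sl \<in> {sl \<in> S. t \<in> transitions sl}. pre sl t) \<and>
        post N t = (\<Sum>sl \<in> {sl \<in> S. t \<in> transitions sl}. post sl t)) \<and>
     initial N = (\<Sum>sl \<in> S. initial sl)"


section \<open>Asynchronous automata\<close>

text \<open>
  Tuples indexed by a set of processes are functions with value \<open>undefined\<close> outside that set.
\<close>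

record ('r, 'a, 's) async_automaton =
  processes :: "'r set"
  actions :: "'a set"
  action_dom :: "'a \<Rightarrow> 'r set"
  local_states :: "'r \<Rightarrow> 's set"
  start :: "'r \<Rightarrow> 's"
  delta :: "'a \<Rightarrow> ('r \<Rightarrow> 's) \<Rightarrow> ('r \<Rightarrow> 's) option"

definition local_actions :: "('r, 'a, 's) async_automaton \<Rightarrow> 'r \<Rightarrow> 'a set" where
  "local_actions A p = {a \<in> actions A. p \<in> action_dom A a}"

definition global_step ::
    "('r, 'a, 's) async_automaton \<Rightarrow> ('r \<Rightarrow> 's) \<Rightarrow> 'a \<Rightarrow> ('r \<Rightarrow> 's) \<Rightarrow> bool" where
  "global_step A s a s' \<longleftrightarrow>
     a \<in> actions A \<and>
     delta A a (restrict s (action_dom A a)) = Some (restrict s' (action_dom A a)) \<and>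
     (\<forall>p. p \<notin> action_dom A a \<longrightarrow> s' p = s p)"

inductive run ::
    "('r, 'a, 's) async_automaton \<Rightarrow> ('r \<Rightarrow> 's) \<Rightarrow> 'a list \<Rightarrow> ('r \<Rightarrow> 's) \<Rightarrow> bool" for A where
  run_Nil: "run A s [] s"
| run_Cons: "global_step A s a s' \<Longrightarrow> run A s' u s'' \<Longrightarrow> run A s (a # u) s''"

definition state :: "('r, 'a, 's) async_automaton \<Rightarrow> 'a list \<Rightarrow> 'r \<Rightarrow> 's" where
  "state A u = (THE s. run A (start A) u s)"

inductive commute1 :: "('a \<Rightarrow> 'r set) \<Rightarrow> 'a list \<Rightarrow> 'a list \<Rightarrow> bool" for d where
  "d a \<inter> d b = {} \<Longrightarrow> commute1 d (u @ [a, b] @ v) (u @ [b, a] @ v)"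

definition trace_equiv :: "('r, 'a, 's) async_automaton \<Rightarrow> 'a list \<Rightarrow> 'a list \<Rightarrow> bool" where
  "trace_equiv A = (commute1 (action_dom A))\<^sup>*\<^sup>*"

text \<open>Finite plays are traces, i.e. equivalence classes of action sequences.\<close>

definition trace :: "('r, 'a, 's) async_automaton \<Rightarrow> 'a list \<Rightarrow> 'a list set" where
  "trace A u = {v. trace_equiv A u v}"

definition finite_plays :: "('r, 'a, 's) async_automaton \<Rightarrow> 'a list set set" where
  "finite_plays A = {trace A u | u. \<exists>s. run A (start A) u s}"

definition view :: "('r, 'a, 's) async_automaton \<Rightarrow> 'r \<Rightarrow> 'a list \<Rightarrow> 'a list set" where
  "view A p u =
     trace A (ARG_MIN length v. \<exists>w. trace_equiv A u (v @ w) \<and> (\<forall>a \<in> set w. p \<notin> action_dom A a))"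

definition view_plays :: "('r, 'a, 's) async_automaton \<Rightarrow> 'r \<Rightarrow> 'a list set set" where
  "view_plays A p = {view A p u | u. trace A u \<in> finite_plays A}"


subsection \<open>Parallel composition\<close>

record ('a, 's) local_automaton =
  states :: "'s set"
  lstart :: "'s"
  ltrans :: "('s \<times> 'a \<times> 's) set"

definition parallel_composition ::
    "'r set \<Rightarrow> 'a set \<Rightarrow> ('a \<Rightarrow> 'r set) \<Rightarrow> ('r \<Rightarrow> ('a, 's) local_automaton) \<Rightarrow>
     ('r, 'a, 's) async_automaton" where
  "parallel_composition R \<Sigma> d L =
     \<lparr> processes = R,
       actions = \<Sigma>,
       action_dom = d,
       local_states = (\<lambda>p. states (L p)),
       start = restrict (\<lambda>p. lstart (L p)) R,
       delta = (\<lambda>a s.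
         let succ = (\<lambda>s'. s' \<in> extensional (d a) \<and> (\<forall>p \<in> d a. (s p, a, s' p) \<in> ltrans (L p)))
         in if \<exists>s'. succ s' then Some (THE s'. succ s') else None) \<rparr>"


section \<open>Control games\<close>

record ('r, 'a, 's) control_game =
  arena :: "('r, 'a, 's) async_automaton"
  sys_actions :: "'a set"
  env_actions :: "'a set"
  win_states :: "'r \<Rightarrow> 's set"

type_synonym ('r, 'a) controller = "'r \<Rightarrow> 'a list set \<Rightarrow> 'a set"

definition controller :: "('r, 'a, 's) control_game \<Rightarrow> ('r, 'a) controller \<Rightarrow> bool" where
  "controller C f \<longleftrightarrow>
     (\<forall>p \<in> processes (arena C). \<forall>V \<in> view_plays (arena C) p.
        f p V \<subseteq> sys_actions C \<inter> local_actions (arena C) p)"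

inductive_set controlled_plays ::
    "('r, 'a, 's) control_game \<Rightarrow> ('r, 'a) controller \<Rightarrow> 'a list set set" for C f where
  empty_play: "trace (arena C) [] \<in> controlled_plays C f"
| extend_play:
    "trace (arena C) u \<in> controlled_plays C f \<Longrightarrow>
     trace (arena C) (u @ [a]) \<in> finite_plays (arena C) \<Longrightarrow>
     a \<in> env_actions C \<or>
       a \<in> sys_actions C \<and> (\<forall>p \<in> action_dom (arena C) a. a \<in> f p (view (arena C) p u)) \<Longrightarrow>
     trace (arena C) (u @ [a]) \<in> controlled_plays C f"

text \<open>
  An infinite play is represented by a linearization; it is consistent with the controller iff all
  its finite prefixes are.
\<close>

definition infinite_controlled_play ::
    "('r, 'a, 's) control_game \<Rightarrow> ('r, 'a) controller \<Rightarrow> (nat \<Rightarrow> 'a) \<Rightarrow> bool" where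
  "infinite_controlled_play C f w \<longleftrightarrow>
     (\<forall>n. trace (arena C) (map w [0..<n]) \<in> controlled_plays C f)"

definition final_play ::
    "('r, 'a, 's) control_game \<Rightarrow> ('r, 'a) controller \<Rightarrow> 'a list \<Rightarrow> bool" where
  "final_play C f u \<longleftrightarrow>
     trace (arena C) u \<in> controlled_plays C f \<and>
     (\<forall>a. trace (arena C) (u @ [a]) \<notin> controlled_plays C f)"

definition winning_controller ::
    "('r, 'a, 's) control_game \<Rightarrow> ('r, 'a) controller \<Rightarrow> bool" where
  "winning_controller C f \<longleftrightarrow>
     controller C f \<and>
     (\<nexists>w. infinite_controlled_play C f w) \<and>
     (\<forall>u. final_play C f u \<longrightarrow>
        (\<forall>p \<in> processes (arena C). state (arena C) u p \<in> win_states C p))"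

text \<open>
  In a game obtained from a Petri game, the controllable actions of a process are its commitments.
  A controller is single-commitment if no play leaves a process the choice between two of them.
  In general a controller may offer several commitments in the same situation, say to \<open>{a}\<close> and to \<open>{b}\<close>
  in a system place \<open>q\<close>. Commitments are internal, whereas a strategy has no internal
  transitions; bisimilarity would hence relate one marking both to the play committed to \<open>{a}\<close>
  and to the play committed to \<open>{b}\<close>, although these enable different transitions. Such a
  controller therefore has no bisimilar strategy, even if it is winning, which is why
  controllers are compared with strategies only if they are single-commitment.
\<close>

definition single_commitment ::
    "('r, 'a, 's) control_game \<Rightarrow> ('r, 'a) controller \<Rightarrow> bool" where
  "single_commitment C f \<longleftrightarrow>
     (\<forall>u p. \<forall>a \<in> sys_actions C. \<forall>b \<in> sys_actions C.
        p \<in> action_dom (arena C) a \<and> p \<in> action_dom (arena C) b \<and>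
        trace (arena C) u \<in> controlled_plays C f \<and>
        trace (arena C) (u @ [a]) \<in> controlled_plays C f \<and>
        trace (arena C) (u @ [b]) \<in> controlled_plays C f \<longrightarrow> a = b)"

definition restricts ::
    "('r, 'a, 's) control_game \<Rightarrow> ('r, 'a) controller \<Rightarrow> ('r, 'a) controller \<Rightarrow> bool" where
  "restricts C f' f \<longleftrightarrow>
     (\<forall>p \<in> processes (arena C). \<forall>V \<in> view_plays (arena C) p. f' p V \<subseteq> f p V)"


section \<open>From Petri games to control games\<close>

text \<open>
  \<open>Tr t\<close> is the transition \<open>t\<close> as an action, \<open>Commit q A\<close> is $\tau_{(q,A)}$, and
  \<open>Clash q A t1 t2\<close> is the uncontrollable action that punishes the nondeterminism between
  \<open>t1\<close> and \<open>t2\<close> in the commitment \<open>(q, A)\<close>.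
\<close>

datatype ('p, 't) action = Tr 't | Commit 'p "'t set" | Clash 'p "'t set" 't 't

datatype ('p, 't) lstate = Place 'p | Committed 'p "'t set" | Bot

fun slice_dom :: "('p, 't) net set \<Rightarrow> ('p, 't) action \<Rightarrow> ('p, 't) net set" where
  "slice_dom S (Tr t) = {sl \<in> S. t \<in> transitions sl}"
| "slice_dom S (Commit q A) = {sl \<in> S. q \<in> places sl}"
| "slice_dom S (Clash q A t1 t2) = {sl \<in> S. t1 \<in> transitions sl \<or> t2 \<in> transitions sl}"

definition commit_actions :: "('p, 't) petri_game \<Rightarrow> ('p, 't) action set" where
  "commit_actions G = {Commit q A | q A. q \<in> sys_places G \<and> A \<subseteq> place_post G q}"

definition clash_actions :: "('p, 't) petri_game \<Rightarrow> ('p, 't) action set" where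
  "clash_actions G =
     {Clash q A t1 t2 | q A t1 t2.
        q \<in> sys_places G \<and> A \<subseteq> place_post G q \<and> t1 \<in> A \<and> t2 \<in> A \<and> t1 \<noteq> t2}"

definition slice_states :: "('p, 't) petri_game \<Rightarrow> ('p, 't) net \<Rightarrow> ('p, 't) lstate set" where
  "slice_states G sl =
     Place ` places sl \<union>
     {Committed q A | q A. q \<in> places sl \<inter> sys_places G \<and> A \<subseteq> place_post G q}"

definition slice_trans ::
    "('p, 't) petri_game \<Rightarrow> ('p, 't) net \<Rightarrow>
     (('p, 't) lstate \<times> ('p, 't) action \<times> ('p, 't) lstate) set" where
  "slice_trans G sl =
     {(Place q, Commit q A, Committed q A) | q A.
        q \<in> places sl \<inter> sys_places G \<and> A \<subseteq> place_post G q} \<union>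
     {(Place q, Tr t, Place q') | q t q'.
        q \<in> places sl \<inter> env_places G \<and>
        t \<in> transitions sl \<and> q \<in># pre sl t \<and> q' \<in># post sl t} \<union>
     {(Committed q A, Tr t, Place q') | q A t q'.
        q \<in> places sl \<inter> sys_places G \<and> A \<subseteq> place_post G q \<and> t \<in> A \<and>
        t \<in> transitions sl \<and> q \<in># pre sl t \<and> q' \<in># post sl t}"

definition clash_trans ::
    "('p, 't) petri_game \<Rightarrow> ('p, 't) net \<Rightarrow>
     (('p, 't) lstate \<times> ('p, 't) action \<times> ('p, 't) lstate) set" where
  "clash_trans G sl =
     {(Committed q A, Clash q A t1 t2, Bot) | q A t1 t2.
        q \<in> places sl \<and> Clash q A t1 t2 \<in> clash_actions G} \<union>
     {(Place q, Clash q' A' t1 t2, Bot) | q q' A' t1 t2.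
        Clash q' A' t1 t2 \<in> clash_actions G \<and> (t1 \<in> transitions sl \<or> t2 \<in> transitions sl) \<and>
        q' \<notin> places sl \<and> q \<in> places sl \<inter> env_places G \<and>
        (\<forall>t \<in> {t1, t2}. t \<in> transitions sl \<longrightarrow> t \<in> place_post G q)} \<union>
     {(Committed q A, Clash q' A' t1 t2, Bot) | q A q' A' t1 t2.
        Clash q' A' t1 t2 \<in> clash_actions G \<and> (t1 \<in> transitions sl \<or> t2 \<in> transitions sl) \<and>
        q' \<notin> places sl \<and> q \<in> places sl \<inter> sys_places G \<and> A \<subseteq> place_post G q \<and>
        (\<forall>t \<in> {t1, t2}. t \<in> transitions sl \<longrightarrow> t \<in> A)}"

definition initial_place :: "('p, 't) net \<Rightarrow> 'p" where
  "initial_place sl = (THE q. initial sl = {#q#})"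

definition slice_automaton ::
    "('p, 't) petri_game \<Rightarrow> ('p, 't) net \<Rightarrow> (('p, 't) action, ('p, 't) lstate) local_automaton" where
  "slice_automaton G sl =
     \<lparr> states = slice_states G sl,
       lstart = Place (initial_place sl),
       ltrans = slice_trans G sl \<rparr>"

definition slice_automaton_det ::
    "('p, 't) petri_game \<Rightarrow> ('p, 't) net \<Rightarrow> (('p, 't) action, ('p, 't) lstate) local_automaton" where
  "slice_automaton_det G sl =
     \<lparr> states = slice_states G sl \<union> {Bot},
       lstart = Place (initial_place sl),
       ltrans = slice_trans G sl \<union> clash_trans G sl \<rparr>"

definition slice_win :: "('p, 't) petri_game \<Rightarrow> ('p, 't) net \<Rightarrow> ('p, 't) lstate set" where
  "slice_win G sl =
     Place ` (win_places G \<inter> places sl) \<union>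
     {Committed q A | q A.
        q \<in> win_places G \<inter> places sl \<and> q \<in> sys_places G \<and> A \<subseteq> place_post G q}"

definition control_game_of ::
    "('p, 't) petri_game \<Rightarrow> ('p, 't) net set \<Rightarrow>
     (('p, 't) net, ('p, 't) action, ('p, 't) lstate) control_game" where
  "control_game_of G S =
     \<lparr> arena = parallel_composition S (Tr ` transitions G \<union> commit_actions G)
                 (slice_dom S) (slice_automaton G),
       sys_actions = commit_actions G,
       env_actions = Tr ` transitions G,
       win_states = slice_win G \<rparr>"

text \<open>The game written with a hat, in which nondeterministic commitments can be punished.\<close>

definition control_game_det_of ::
    "('p, 't) petri_game \<Rightarrow> ('p, 't) net set \<Rightarrow>
     (('p, 't) net, ('p, 't) action, ('p, 't) lstate) control_game" where
  "control_game_det_of G S =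
     \<lparr> arena = parallel_composition S (Tr ` transitions G \<union> commit_actions G \<union> clash_actions G)
                 (slice_dom S) (slice_automaton_det G),
       sys_actions = commit_actions G,
       env_actions = Tr ` transitions G \<union> clash_actions G,
       win_states = slice_win G \<rparr>"


section \<open>Strategy-equivalence\<close>

definition observable :: "('p, 't) petri_game \<Rightarrow> ('p, 't) action set" where
  "observable G = Tr ` transitions G"

definition strategy_step ::
    "('q, 'u, 'p, 't) labelled_net \<Rightarrow> 'q multiset \<Rightarrow> ('p, 't) action \<Rightarrow> 'q multiset \<Rightarrow> bool" where
  "strategy_step \<sigma> M a M' \<longleftrightarrow>
     (\<exists>t. enabled \<sigma> M t \<and> a = Tr (trans_label \<sigma> t) \<and> M' = fire \<sigma> M t)"

definition internal_step ::
    "('p, 't) petri_game \<Rightarrow> ('q, 'u, 'p, 't) labelled_net \<Rightarrow> 'q multiset \<Rightarrow> 'q multiset \<Rightarrow> bool" where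
  "internal_step G \<sigma> M M' \<longleftrightarrow> (\<exists>a. a \<notin> observable G \<and> strategy_step \<sigma> M a M')"

definition bisimulation ::
    "('p, 't) petri_game \<Rightarrow> ('r, ('p, 't) action, 's) control_game \<Rightarrow>
     ('q, 'u, 'p, 't) labelled_net \<Rightarrow> ('r, ('p, 't) action) controller \<Rightarrow>
     ('q multiset \<Rightarrow> ('p, 't) action list set \<Rightarrow> bool) \<Rightarrow> bool" where
  "bisimulation G C \<sigma> f B \<longleftrightarrow>
     (let tr = trace (arena C); Pl = controlled_plays C f; Obs = observable G;
          internal = (\<lambda>x. set x \<inter> Obs = {}); istep = internal_step G \<sigma>
      in
        (\<forall>M U. B M U \<longrightarrow> reachable \<sigma> M \<and> U \<in> Pl) \<and>
        B (initial \<sigma>) (tr []) \<and>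
        (\<forall>M u a M'. B M (tr u) \<and> a \<in> Obs \<and> strategy_step \<sigma> M a M' \<longrightarrow>
           (\<exists>x y. internal x \<and> internal y \<and>
              tr (u @ x @ [a] @ y) \<in> Pl \<and> B M' (tr (u @ x @ [a] @ y)))) \<and>
        (\<forall>M u M'. B M (tr u) \<and> istep M M' \<longrightarrow>
           (\<exists>x. internal x \<and> tr (u @ x) \<in> Pl \<and> B M' (tr (u @ x)))) \<and>
        (\<forall>M u a. B M (tr u) \<and> a \<in> Obs \<and> tr (u @ [a]) \<in> Pl \<longrightarrow>
           (\<exists>M1 M2 M'. istep\<^sup>*\<^sup>* M M1 \<and> strategy_step \<sigma> M1 a M2 \<and> istep\<^sup>*\<^sup>* M2 M' \<and>
              B M' (tr (u @ [a])))) \<and>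
        (\<forall>M u a. B M (tr u) \<and> a \<notin> Obs \<and> tr (u @ [a]) \<in> Pl \<longrightarrow>
           (\<exists>M'. istep\<^sup>*\<^sup>* M M' \<and> B M' (tr (u @ [a])))))"

definition bisimilar ::
    "('p, 't) petri_game \<Rightarrow> ('r, ('p, 't) action, 's) control_game \<Rightarrow>
     ('q, 'u, 'p, 't) labelled_net \<Rightarrow> ('r, ('p, 't) action) controller \<Rightarrow> bool" where
  "bisimilar G C \<sigma> f \<longleftrightarrow> (\<exists>B. bisimulation G C \<sigma> f B)"

text \<open>
  The classes of winning strategies and winning controllers to be compared are parameters. This
  accommodates the variant for deterministic strategies and fixes the types from which the nodes
  of the strategies are drawn.
\<close>

definition strategy_equivalent ::
    "('p, 't) petri_game \<Rightarrow> ('r, ('p, 't) action, 's) control_game \<Rightarrow>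
     ('q, 'u, 'p, 't) labelled_net set \<Rightarrow> ('r, ('p, 't) action) controller set \<Rightarrow> bool" where
  "strategy_equivalent G C Strs Ctrls \<longleftrightarrow>
     (\<forall>\<sigma> \<in> Strs. \<exists>f \<in> Ctrls. bisimilar G C \<sigma> f) \<and>
     (\<forall>f \<in> Ctrls. \<exists>\<sigma> \<in> Strs. bisimilar G C \<sigma> f)"

end

theory Submission
  imports Defs
begin

text \<open>
  Every slice carries exactly one token, so a reachable marking of a strategy assigns a place to
  every slice, and so does a play; a bisimulation relates a play to the marking that it reaches in
  the strategy.

  Given a strategy, a process replays its view in the strategy and commits to exactly those
  transitions that leave its current place there. Justified refusal says that a transition for which
  all participants are ready is present in the strategy, and a clash would be a violation of
  determinism.

  Given a controller, the places of the strategy are the views of the processes right after a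
  transition, and its transitions are the causal pasts of the transitions in plays. As at most one
  commitment is possible in every situation, the view without the last commitment determines the
  commitment; this makes the set of transitions leaving a place well-defined. The causal past of a
  transition is the join of the views of its participants, hence it is determined by the preset.
  Pairwise concurrent places occur together in a reachable marking, hence in a play, which yields
  justified refusal. A clash leads to the losing state for good, so it occurs in no play of a
  winning controller.

  If a controller offers several commitments, then keeping one of those that are executable
  creates no new final play.
\<close>

section \<open>Traces and causal pasts\<close>

abbreviation commute_equiv :: "('a \<Rightarrow> 'r set) \<Rightarrow> 'a list \<Rightarrow> 'a list \<Rightarrow> bool" where
  "commute_equiv d \<equiv> (commute1 d)\<^sup>*\<^sup>*"

abbreviation proj :: "('a \<Rightarrow> 'r set) \<Rightarrow> 'r \<Rightarrow> 'a list \<Rightarrow> 'a list" where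
  "proj d p \<equiv> filter (\<lambda>a. p \<in> d a)"

lemma commute1_sym: "commute1 d u v \<Longrightarrow> commute1 d v u"
proof (induction rule: commute1.induct)
  case (1 a b u v)
  then show ?case using commute1.intros[of d b a u v] by blast
qed

lemma commute_equiv_sym: "commute_equiv d u v \<Longrightarrow> commute_equiv d v u"
  by (metis commute1_sym sympD sympI symp_rtranclp)

lemma commute1_append: "commute1 d u v \<Longrightarrow> commute1 d (x @ u @ y) (x @ v @ y)"
proof (induction rule: commute1.induct)
  case (1 a b u v)
  then show ?case using commute1.intros[of d a b "x @ u" "v @ y"] by simp
qed

lemma commute_equiv_append:
  "commute_equiv d u v \<Longrightarrow> commute_equiv d (x @ u @ y) (x @ v @ y)"
  by (induction rule: rtranclp_induct) (auto intro: commute1_append rtranclp.rtrancl_into_rtrancl)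

lemma commute_equiv_append_right: "commute_equiv d u v \<Longrightarrow> commute_equiv d (u @ y) (v @ y)"
  using commute_equiv_append[of d u v "[]" y] by simp

lemma commute_equiv_append_left: "commute_equiv d u v \<Longrightarrow> commute_equiv d (x @ u) (x @ v)"
  using commute_equiv_append[of d u v x "[]"] by simp

lemma commute_equiv_preserves:
  assumes "commute_equiv d u v"
    and swap: "\<And>x a b y. d a \<inter> d b = {} \<Longrightarrow> P (x @ [a, b] @ y) \<Longrightarrow> P (x @ [b, a] @ y)"
    and "P u"
  shows "P v"
  using assms(1,3)
proof (induction rule: rtranclp_induct)
  case (step v w)
  from step.hyps(2) step.IH[OF step.prems] show ?case
    by (induction rule: commute1.induct) (rule swap)
qed

lemma commute_equiv_preserves_prefix_closed:
  assumes equiv: "commute_equiv d u v" and "P u"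
    and prefix: "\<And>x a. P (x @ [a]) \<Longrightarrow> P x"
    and swap: "\<And>x a b. d a \<inter> d b = {} \<Longrightarrow> P (x @ [a, b]) \<Longrightarrow> P (x @ [b, a])"
    and extend: "\<And>x y a. commute_equiv d x y \<Longrightarrow> P y \<Longrightarrow> P (x @ [a]) \<Longrightarrow> P (y @ [a])"
  shows "P v"
  using equiv _ \<open>P u\<close>
proof (rule commute_equiv_preserves)
  fix x a b y
  assume indep: "d a \<inter> d b = {}" and "P (x @ [a, b] @ y)"
  then show "P (x @ [b, a] @ y)"
  proof (induction y rule: rev_induct)
    case Nil
    then show ?case using swap by simp
  next
    case (snoc c y)
    have "commute1 d (x @ [a, b] @ y) (x @ [b, a] @ y)" using indep by (rule commute1.intros)
    moreover have "P (x @ [b, a] @ y)"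
      using snoc.IH[OF indep] snoc.prems(2) prefix[of "x @ [a, b] @ y" c] by simp
    ultimately show ?case
      using extend[of "x @ [a, b] @ y" "x @ [b, a] @ y" c] snoc.prems(2) by auto
  qed
qed

lemma commute_equiv_proj: "commute_equiv d u v \<Longrightarrow> proj d p u = proj d p v"
  by (erule commute_equiv_preserves) auto

lemma commute_equiv_length: "commute_equiv d u v \<Longrightarrow> length u = length v"
  by (erule commute_equiv_preserves) auto

lemma commute_equiv_move_front:
  "(\<And>b. b \<in> set x \<Longrightarrow> d b \<inter> d a = {}) \<Longrightarrow> commute_equiv d (x @ [a]) (a # x)"
proof (induction x)
  case (Cons b x)
  have "commute_equiv d (b # x @ [a]) (b # a # x)"
    using commute_equiv_append_left[of d "x @ [a]" "a # x" "[b]"] Cons by simp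
  moreover have "commute1 d (b # a # x) (a # b # x)"
    using commute1.intros[of d b a "[]" x] Cons.prems by simp
  ultimately show ?case by simp
qed simp

lemma commute_equiv_front_if_proj:
  assumes "a \<in> set u" and first: "\<And>p. p \<in> d a \<Longrightarrow> \<exists>z. proj d p u = a # z"
  shows "\<exists>v. commute_equiv d u (a # v) \<and> set v \<subseteq> set u"
proof -
  obtain x y where u: "u = x @ a # y" "a \<notin> set x"
    using assms(1) by (meson split_list_first)
  have "d b \<inter> d a = {}" if "b \<in> set x" for b
  proof (rule ccontr)
    assume "d b \<inter> d a \<noteq> {}"
    then obtain p where p: "p \<in> d b" "p \<in> d a" by auto
    then have "b \<in> set (proj d p x)" using that by simp
    then obtain c z where cz: "proj d p x = c # z" by (cases "proj d p x") auto
    then have "c = a" using first[OF p(2)] u(1) by simp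
    moreover have "c \<in> set x" using cz by (metis filter_is_subset list.set_intros(1) subsetD)
    ultimately show False using u(2) by simp
  qed
  then have "commute_equiv d u (a # x @ y)"
    using commute_equiv_append_right[OF commute_equiv_move_front[of x d a], of y] u(1) by simp
  then show ?thesis using u(1) by (intro exI[of _ "x @ y"]) auto
qed

lemma commute_equiv_if_proj:
  assumes "\<And>a. a \<in> set u \<union> set v \<Longrightarrow> d a \<noteq> {}" and "\<And>p. proj d p u = proj d p v"
  shows "commute_equiv d u v"
  using assms
proof (induction v arbitrary: u)
  case Nil
  have "u = []"
  proof (cases u)
    case (Cons a u')
    then obtain p where "p \<in> d a" using Nil.prems(1) by auto
    then show ?thesis using Nil.prems(2)[of p] Cons by simp
  qed
  then show ?case by simp
next
  case (Cons a v)
  obtain p where "p \<in> d a" using Cons.prems(1) by auto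
  then have "a \<in> set (proj d p u)" using Cons.prems(2)[of p] by simp
  then have "a \<in> set u" by simp
  moreover have "\<exists>z. proj d p u = a # z" if "p \<in> d a" for p
    using Cons.prems(2)[of p] that by simp
  ultimately obtain w where w: "commute_equiv d u (a # w)" "set w \<subseteq> set u"
    using commute_equiv_front_if_proj[of a u d] by blast
  have "commute_equiv d w v"
  proof (rule Cons.IH)
    show "d b \<noteq> {}" if "b \<in> set w \<union> set v" for b
      using Cons.prems(1)[of b] that w(2) by auto
    show "proj d p w = proj d p v" for p
      using commute_equiv_proj[OF w(1), of p] Cons.prems(2)[of p] by (simp split: if_splits)
  qed
  then have "commute_equiv d (a # w) (a # v)"
    using commute_equiv_append_left[of d w v "[a]"] by simp
  with w(1) show ?case by simp
qed

lemma commute_equiv_cancel_last: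
  assumes "\<And>a. a \<in> set (u @ v) \<Longrightarrow> d a \<noteq> {}" and "commute_equiv d (u @ [a]) (v @ [a])"
  shows "commute_equiv d u v"
proof (rule commute_equiv_if_proj)
  show "proj d p u = proj d p v" for p
    using commute_equiv_proj[OF assms(2), of p] by (simp split: if_splits)
qed (use assms(1) in auto)

text \<open>For \<open>P = {p}\<close> the causal past is a linearization of the \<open>p\<close>-view.\<close>

fun causal_past :: "('a \<Rightarrow> 'r set) \<Rightarrow> 'r set \<Rightarrow> 'a list \<Rightarrow> 'a list" where
  "causal_past d P [] = []"
| "causal_past d P (a # u) =
     (if d a \<inter> (P \<union> \<Union>(d ` set (causal_past d P u))) = {} then causal_past d P u
      else a # causal_past d P u)"

lemma causal_past_snoc:
  "causal_past d P (u @ [a]) =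
     (if d a \<inter> P = {} then causal_past d P u else causal_past d (P \<union> d a) u @ [a])"
proof (induction u)
  case (Cons b u)
  show ?case
  proof (cases "d a \<inter> P = {}")
    case False
    have "P \<union> \<Union>(d ` set (causal_past d (P \<union> d a) u @ [a])) =
        (P \<union> d a) \<union> \<Union>(d ` set (causal_past d (P \<union> d a) u))"
      by auto
    then show ?thesis using Cons False by simp
  qed (use Cons in simp)
qed simp

lemma causal_past_snoc_participant:
  "p \<in> d a \<Longrightarrow> causal_past d {p} (u @ [a]) = causal_past d (d a) u @ [a]"
  by (auto simp: causal_past_snoc insert_absorb)

lemma causal_past_snoc_other:
  "p \<notin> d a \<Longrightarrow> causal_past d {p} (u @ [a]) = causal_past d {p} u"
  by (simp add: causal_past_snoc)

lemma causal_past_append_independent: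
  "(\<And>b. b \<in> set w \<Longrightarrow> d b \<inter> P = {}) \<Longrightarrow> causal_past d P (v @ w) = causal_past d P v"
  by (induction w rule: rev_induct) (auto simp: causal_past_snoc simp flip: append_assoc)

lemma set_causal_past_subset: "set (causal_past d P u) \<subseteq> set u"
  by (induction u) auto

lemma length_causal_past_le: "length (causal_past d P u) \<le> length u"
  by (induction u) auto

lemma causal_past_eq_self: "length (causal_past d P u) = length u \<Longrightarrow> causal_past d P u = u"
proof (induction u)
  case (Cons a u)
  then show ?case using length_causal_past_le[of d P u] by (simp split: if_splits)
qed simp

lemma commute_equiv_causal_past_append:
  "\<exists>w. commute_equiv d u (causal_past d P u @ w) \<and> (\<forall>b \<in> set w. d b \<inter> P = {})"
proof (induction u)
  case (Cons a u)
  obtain w where w: "commute_equiv d u (causal_past d P u @ w)" "\<forall>b \<in> set w. d b \<inter> P = {}"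
    using Cons.IH by blast
  have front: "commute_equiv d (a # u) (a # causal_past d P u @ w)"
    using commute_equiv_append_left[OF w(1), of "[a]"] by simp
  show ?case
  proof (cases "d a \<inter> (P \<union> \<Union>(d ` set (causal_past d P u))) = {}")
    case True
    then have "commute_equiv d (causal_past d P u @ [a]) (a # causal_past d P u)"
      by (intro commute_equiv_move_front) blast
    then have "commute_equiv d (a # causal_past d P u @ w) (causal_past d P u @ a # w)"
      using commute_equiv_append_right[OF commute_equiv_sym, of d _ _ w] by fastforce
    with front have "commute_equiv d (a # u) (causal_past d P (a # u) @ a # w)" using True by simp
    then show ?thesis using w(2) True by (intro exI[of _ "a # w"]) auto
  next
    case False
    then show ?thesis using front w(2) by (intro exI[of _ w]) auto
  qed
qed (auto intro: exI[of _ "[]"])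

lemma commute_equiv_causal_past_swap:
  assumes "d a \<inter> d b = {}"
  shows "commute_equiv d (causal_past d P (x @ [a, b] @ y)) (causal_past d P (x @ [b, a] @ y))"
proof (induction y arbitrary: P rule: rev_induct)
  case Nil
  have indep_sym: "d b \<inter> d a = {}" using assms by blast
  have past_snoc2: "causal_past d P (x @ [a', b']) =
      (if d b' \<inter> P = {} then causal_past d P (x @ [a'])
       else causal_past d (P \<union> d b') (x @ [a']) @ [b'])" for a' b'
    using causal_past_snoc[of d P "x @ [a']" b'] by simp
  show ?case
  proof (cases "d a \<inter> P = {} \<or> d b \<inter> P = {}")
    case True
    then show ?thesis
      using assms indep_sym by (auto simp: past_snoc2 causal_past_snoc Int_Un_distrib)
  next
    case False
    then have "causal_past d P (x @ [a, b]) = causal_past d (P \<union> d b \<union> d a) x @ [a, b]"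
      "causal_past d P (x @ [b, a]) = causal_past d (P \<union> d b \<union> d a) x @ [b, a]"
      by (simp_all add: past_snoc2 causal_past_snoc Int_Un_distrib Un_ac)
    then show ?thesis
      using assms commute1.intros[of d a b "causal_past d (P \<union> d b \<union> d a) x" "[]"] by auto
  qed
next
  case (snoc c y)
  have "causal_past d P (x @ [a, b] @ y @ [c]) = causal_past d P ((x @ [a, b] @ y) @ [c])"
    "causal_past d P (x @ [b, a] @ y @ [c]) = causal_past d P ((x @ [b, a] @ y) @ [c])"
    by simp_all
  then show ?case
    using snoc[of P] snoc[of "P \<union> d c"] by (simp only: causal_past_snoc)
      (auto intro: commute_equiv_append_right)
qed

lemma commute_equiv_causal_past:
  "commute_equiv d u v \<Longrightarrow> commute_equiv d (causal_past d P u) (causal_past d P v)"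
proof (erule commute_equiv_preserves)
  fix x a b y
  assume "d a \<inter> d b = {}"
    and "commute_equiv d (causal_past d P u) (causal_past d P (x @ [a, b] @ y))"
  then show "commute_equiv d (causal_past d P u) (causal_past d P (x @ [b, a] @ y))"
    using commute_equiv_causal_past_swap by (metis rtranclp_trans)
qed simp

lemma causal_past_mono:
  "P \<subseteq> Q \<Longrightarrow> set (causal_past d P u) \<subseteq> set (causal_past d Q u)"
  by (induction u) auto

lemma set_causal_past_Un:
  "set (causal_past d (P \<union> Q) u) = set (causal_past d P u) \<union> set (causal_past d Q u)"
  by (induction u) auto

lemma causal_past_causal_past:
  "Q \<subseteq> P \<Longrightarrow> causal_past d Q (causal_past d P u) = causal_past d Q u"
proof (induction u arbitrary: P Q rule: rev_induct)
  case (snoc a u)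
  show ?case
  proof (cases "d a \<inter> Q = {}")
    case True
    have "Q \<subseteq> P \<union> d a" using snoc.prems by blast
    with True snoc.IH[of Q] show ?thesis using snoc.prems by (simp add: causal_past_snoc)
  next
    case False
    then have "d a \<inter> P \<noteq> {}" and "Q \<union> d a \<subseteq> P \<union> d a" using snoc.prems by blast+
    with False snoc.IH show ?thesis by (simp add: causal_past_snoc)
  qed
qed simp

lemma proj_causal_past_prefix: "\<exists>z. proj d r u = proj d r (causal_past d P u) @ z"
proof -
  obtain w where "commute_equiv d u (causal_past d P u @ w)"
    using commute_equiv_causal_past_append[of d u P] by auto
  from commute_equiv_proj[OF this, of r] show ?thesis by auto
qed

lemma length_proj_causal_past_mono:
  assumes "P \<subseteq> Q"
  shows "length (proj d r (causal_past d P u)) \<le> length (proj d r (causal_past d Q u))"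
proof (induction u)
  case (Cons a u)
  have "set (causal_past d P u) \<subseteq> set (causal_past d Q u)" using assms by (rule causal_past_mono)
  then have "d a \<inter> (Q \<union> \<Union>(d ` set (causal_past d Q u))) = {} \<Longrightarrow>
      d a \<inter> (P \<union> \<Union>(d ` set (causal_past d P u))) = {}"
    using assms by blast
  then show ?case using Cons by (auto intro: le_SucI)
qed simp

lemma proj_causal_past_eq_if_length:
  assumes "length (proj d r (causal_past d P u)) = length (proj d r (causal_past d Q u))"
  shows "proj d r (causal_past d P u) = proj d r (causal_past d Q u)"
proof -
  obtain y z where "proj d r u = proj d r (causal_past d P u) @ y"
      "proj d r u = proj d r (causal_past d Q u) @ z"
    using proj_causal_past_prefix[of r d u P] proj_causal_past_prefix[of r d u Q] by blast
  then have "proj d r (causal_past d P u) @ y = proj d r (causal_past d Q u) @ z" by simp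
  then show ?thesis using assms by simp
qed

lemma proj_causal_past_Un:
  "proj d r (causal_past d (P \<union> Q) u) = proj d r (causal_past d P u) \<or>
   proj d r (causal_past d (P \<union> Q) u) = proj d r (causal_past d Q u)"
proof (induction u)
  case (Cons a u)
  define kept where "kept R \<longleftrightarrow> d a \<inter> (R \<union> \<Union>(d ` set (causal_past d R u))) \<noteq> {}" for R
  have past_Cons: "proj d r (causal_past d R (a # u)) =
      (if kept R \<and> r \<in> d a then [a] else []) @ proj d r (causal_past d R u)" for R
    by (simp add: kept_def)
  have kept_Un: "kept (P \<union> Q) \<longleftrightarrow> kept P \<or> kept Q"
    unfolding kept_def set_causal_past_Un by blast
  have no_action: "proj d r (causal_past d R u) = []" if "r \<in> d a" "\<not> kept R" for R
    using that by (auto simp: kept_def filter_empty_conv)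
  have length_le:
    "length (proj d r (causal_past d R u)) \<le> length (proj d r (causal_past d (P \<union> Q) u))"
    if "R = P \<or> R = Q" for R
    using that by (intro length_proj_causal_past_mono) blast
  show ?case
  proof (cases "r \<in> d a \<and> (kept P \<longleftrightarrow> \<not> kept Q)")
    case True
    then show ?thesis
      unfolding past_Cons kept_Un
        using Cons no_action[of P] no_action[of Q] length_le[of P] length_le[of Q]
      by (cases "kept P") force+
  next
    case False
    then show ?thesis unfolding past_Cons kept_Un using Cons by force
  qed
qed simp

lemma proj_causal_past_attained:
  assumes "finite P" "P \<noteq> {}"
  shows "\<exists>p \<in> P. proj d r (causal_past d P u) = proj d r (causal_past d {p} u)"
  using assms
proof (induction P rule: finite_ne_induct)
  case (insert p P)
  then show ?case using proj_causal_past_Un[of r d "{p}" P u] by (metis insertCI insert_is_Un)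
qed simp

text \<open>The causal past of \<open>P\<close> is the join of the views of the members of \<open>P\<close>: on every process it is
  the longest of their projections, so the views determine it even across different traces.\<close>

lemma commute_equiv_causal_past_join:
  assumes P: "finite P" "P \<noteq> {}" and "\<And>a. a \<in> set u \<union> set v \<Longrightarrow> d a \<noteq> {}"
    and views: "\<And>p. p \<in> P \<Longrightarrow> commute_equiv d (causal_past d {p} u) (causal_past d {p} v)"
  shows "commute_equiv d (causal_past d P u) (causal_past d P v)"
proof (rule commute_equiv_if_proj)
  fix a assume "a \<in> set (causal_past d P u) \<union> set (causal_past d P v)"
  then show "d a \<noteq> {}" using assms(3) set_causal_past_subset by (metis Un_iff subsetD)
next
  fix r
  let ?proj = "\<lambda>P u. proj d r (causal_past d P u)"
  have proj_view: "?proj {p} u = ?proj {p} v" if "p \<in> P" for p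
    using commute_equiv_proj[OF views[OF that]] .
  have view_le: "length (?proj {p} x) \<le> length (?proj P x)" if "p \<in> P" for p x
    using that by (intro length_proj_causal_past_mono) simp
  obtain p where p: "p \<in> P" "?proj P u = ?proj {p} u"
    using proj_causal_past_attained[OF P] by blast
  obtain p' where p': "p' \<in> P" "?proj P v = ?proj {p'} v"
    using proj_causal_past_attained[OF P] by blast
  have "length (?proj {p} v) = length (?proj P v)"
    using proj_view[OF p(1)] proj_view[OF p'(1)] view_le[OF p(1), of v] view_le[OF p'(1), of u]
      p(2) p'(2) by simp
  then have "?proj {p} v = ?proj P v" by (rule proj_causal_past_eq_if_length)
  then show "?proj P u = ?proj P v" using p proj_view by simp
qed

lemma trace_eq_iff: "trace A u = trace A v \<longleftrightarrow> commute_equiv (action_dom A) u v"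
  unfolding trace_def trace_equiv_def
  by (auto intro: rtranclp_trans dest: commute_equiv_sym)

lemma view_eq_trace_causal_past: "view A p u = trace A (causal_past (action_dom A) {p} u)"
proof -
  let ?d = "action_dom A"
  let ?rest = "\<lambda>v. \<exists>w. trace_equiv A u (v @ w) \<and> (\<forall>a \<in> set w. p \<notin> ?d a)"
  define v where "v = (ARG_MIN length v. ?rest v)"
  have past: "?rest (causal_past ?d {p} u)"
    using commute_equiv_causal_past_append[of ?d u "{p}"] by (auto simp: trace_equiv_def)
  have v: "?rest v" and minimal: "length v \<le> length (causal_past ?d {p} u)"
    using arg_min_nat_lemma[of ?rest, OF past, of length] past by (auto simp: v_def)
  obtain w where w: "commute_equiv ?d u (v @ w)" "\<forall>a \<in> set w. p \<notin> ?d a"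
    using v by (auto simp: trace_equiv_def)
  have past_v: "commute_equiv ?d (causal_past ?d {p} u) (causal_past ?d {p} v)"
    using commute_equiv_causal_past[OF w(1), of "{p}"]
      causal_past_append_independent[of w ?d "{p}" v] w(2) by simp
  then have "causal_past ?d {p} v = v"
    using minimal commute_equiv_length[OF past_v] length_causal_past_le[of ?d "{p}" v]
    by (intro causal_past_eq_self) simp
  with past_v have "trace A (causal_past ?d {p} u) = trace A v" by (simp add: trace_eq_iff)
  then show ?thesis by (simp add: view_def v_def)
qed

lemma view_cong: "commute_equiv (action_dom A) u v \<Longrightarrow> view A p u = view A p v"
  by (simp add: view_eq_trace_causal_past trace_eq_iff commute_equiv_causal_past)

lemma view_snoc_other: "p \<notin> action_dom A a \<Longrightarrow> view A p (u @ [a]) = view A p u"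
  by (simp add: view_eq_trace_causal_past causal_past_snoc_other)

locale local_valuation =
  fixes d :: "'a \<Rightarrow> 'r set" and val :: "'a list \<Rightarrow> 'r \<Rightarrow> 'x"
  assumes val_snoc_other: "p \<notin> d a \<Longrightarrow> val (u @ [a]) p = val u p"
    and val_snoc_participant: "p \<in> d a \<Longrightarrow> (\<And>r. r \<in> d a \<Longrightarrow> val u r = val v r) \<Longrightarrow>
      commute_equiv d (causal_past d (d a) u) (causal_past d (d a) v) \<Longrightarrow>
      val (u @ [a]) p = val (v @ [a]) p"
begin

lemma val_snoc_swap:
  assumes "d a \<inter> d b = {}"
  shows "val (x @ [a, b]) p = val (x @ [b, a]) p"
proof -
  have last: "val (x @ [a', b']) p = val (x @ [b', a']) p"
    if "d a' \<inter> d b' = {}" "p \<in> d b'" for a' b'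
  proof -
    have "val ((x @ [a']) @ [b']) p = val (x @ [b']) p"
      using that by (intro val_snoc_participant)
        (auto simp: causal_past_snoc intro!: val_snoc_other)
    also have "\<dots> = val ((x @ [b']) @ [a']) p" using that by (intro val_snoc_other[symmetric]) blast
    finally show ?thesis by simp
  qed
  consider "p \<in> d a" | "p \<in> d b" | (neither) "p \<notin> d a" "p \<notin> d b" by blast
  then show ?thesis
  proof cases
    case neither
    then show ?thesis
      using val_snoc_other[of p b "x @ [a]"] val_snoc_other[of p a x]
        val_snoc_other[of p a "x @ [b]"] val_snoc_other[of p b x] by simp
  qed (use last[of a b] last[of b a] assms in \<open>auto simp: Int_commute\<close>)
qed

lemma val_swap:
  assumes "d a \<inter> d b = {}"
  shows "val (x @ [a, b] @ y) p = val (x @ [b, a] @ y) p"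
proof (induction y arbitrary: p rule: rev_induct)
  case Nil
  then show ?case using val_snoc_swap[OF assms] by simp
next
  case (snoc c y)
  have "val ((x @ [a, b] @ y) @ [c]) p = val ((x @ [b, a] @ y) @ [c]) p"
  proof (cases "p \<in> d c")
    case True
    then show ?thesis by (intro val_snoc_participant snoc commute_equiv_causal_past_swap assms)
  next
    case False
    then show ?thesis using snoc by (simp only: val_snoc_other[OF False])
  qed
  then show ?case by simp
qed

lemma val_cong: "commute_equiv d u v \<Longrightarrow> val u = val v"
proof (erule commute_equiv_preserves)
  fix x a b y
  assume "d a \<inter> d b = {}" "val u = val (x @ [a, b] @ y)"
  then show "val u = val (x @ [b, a] @ y)" using val_swap by (metis ext)
qed simp

lemma val_causal_past: "p \<in> P \<Longrightarrow> val (causal_past d P u) p = val u p"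
proof (induction u arbitrary: P p rule: rev_induct)
  case (snoc a u)
  show ?case
  proof (cases "p \<in> d a")
    case True
    then have "d a \<inter> P \<noteq> {}" using snoc.prems by blast
    moreover have "val (causal_past d (P \<union> d a) u @ [a]) p = val (u @ [a]) p"
      using True by (intro val_snoc_participant snoc.IH) (auto simp: causal_past_causal_past)
    ultimately show ?thesis by (simp add: causal_past_snoc)
  next
    case False
    then show ?thesis using snoc by (auto simp: causal_past_snoc val_snoc_other)
  qed
qed simp

end

section \<open>Asynchronous automata\<close>

definition successor ::
    "('r, 'a, 's) async_automaton \<Rightarrow> ('r \<Rightarrow> 's) \<Rightarrow> 'a \<Rightarrow> 'r \<Rightarrow> 's" where
  "successor A s a =
     (case delta A a (restrict s (action_dom A a)) of
        None \<Rightarrow> s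
      | Some g \<Rightarrow> (\<lambda>p. if p \<in> action_dom A a then g p else s p))"

definition executable :: "('r, 'a, 's) async_automaton \<Rightarrow> ('r \<Rightarrow> 's) \<Rightarrow> 'a \<Rightarrow> bool" where
  "executable A s a \<longleftrightarrow> (\<exists>s'. global_step A s a s')"

definition runnable :: "('r, 'a, 's) async_automaton \<Rightarrow> 'a list \<Rightarrow> bool" where
  "runnable A u \<longleftrightarrow> (\<exists>s. run A (start A) u s)"

lemma global_step_successor:
  assumes "global_step A s a s'"
  shows "s' = successor A s a"
proof
  fix p show "s' p = successor A s a p"
    using assms by (cases "p \<in> action_dom A a") (simp_all add: global_step_def successor_def)
qed

lemma executable_cong:
  assumes "\<And>p. p \<in> action_dom A a \<Longrightarrow> s p = s' p"
  shows "executable A s a \<longleftrightarrow> executable A s' a"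
proof -
  have step: "executable A y a"
    if eq: "\<And>p. p \<in> action_dom A a \<Longrightarrow> x p = y p" and x: "global_step A x a x'" for x y x'
  proof -
    have "restrict x (action_dom A a) = restrict y (action_dom A a)"
      using eq by (rule restrict_ext)
    then have "global_step A y a (\<lambda>p. if p \<in> action_dom A a then x' p else y p)"
      using x by (simp add: global_step_def cong: restrict_cong)
    then show ?thesis by (auto simp: executable_def)
  qed
  show ?thesis
  proof
    show "executable A s' a" if "executable A s a"
      using that step[of s s'] assms by (auto simp: executable_def)
    show "executable A s a" if "executable A s' a"
      using that step[of s' s] assms by (auto simp: executable_def)
  qed
qed

lemma run_snoc: "run A s (u @ [a]) s'' \<longleftrightarrow> (\<exists>s'. run A s u s' \<and> global_step A s' a s'')"
proof (induction u arbitrary: s)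
  case Nil
  show ?case by (auto intro: run.intros elim: run.cases)
next
  case (Cons b u)
  have run_Cons_iff: "run A s (b # x) z \<longleftrightarrow> (\<exists>y. global_step A s b y \<and> run A y x z)" for x z
    by (auto intro: run_Cons elim: run.cases)
  show ?case by (auto simp: run_Cons_iff Cons.IH)
qed

lemma run_foldl_successor: "run A s u s' \<Longrightarrow> s' = foldl (successor A) s u"
  by (induction rule: run.induct) (auto dest: global_step_successor)

lemma state_run: "run A (start A) u s \<Longrightarrow> state A u = s"
  unfolding state_def using run_foldl_successor by blast

lemma run_state: "runnable A u \<Longrightarrow> run A (start A) u (state A u)"
  by (auto simp: runnable_def dest: state_run)

lemma state_eq_foldl_successor:
  "runnable A u \<Longrightarrow> state A u = foldl (successor A) (start A) u"
  using run_state run_foldl_successor by blast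

lemma state_Nil [simp]: "state A [] = start A"
  by (rule state_run) (rule run_Nil)

lemma runnable_Nil [simp]: "runnable A []"
  unfolding runnable_def by (blast intro: run_Nil)

lemma runnable_snoc: "runnable A (u @ [a]) \<longleftrightarrow> runnable A u \<and> executable A (state A u) a"
  using state_run by (fastforce simp: runnable_def executable_def run_snoc)

lemma global_step_state:
  assumes "runnable A (u @ [a])"
  shows "global_step A (state A u) a (state A (u @ [a]))"
  using run_state[OF assms] state_run by (auto simp: run_snoc)

lemma state_snoc_other:
  "runnable A (u @ [a]) \<Longrightarrow> p \<notin> action_dom A a \<Longrightarrow> state A (u @ [a]) p = state A u p"
  using global_step_state by (fastforce simp: global_step_def)

lemma set_runnable: "runnable A u \<Longrightarrow> set u \<subseteq> actions A"
  by (induction u rule: rev_induct) (auto simp: runnable_snoc executable_def global_step_def)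

lemma local_valuation_successor:
  "local_valuation (action_dom A) (foldl (successor A) (start A))"
proof
  show "foldl (successor A) (start A) (u @ [a]) p = foldl (successor A) (start A) u p"
    if "p \<notin> action_dom A a" for p a u
    using that by (simp add: successor_def split: option.split)
next
  fix p a u v
  let ?s = "foldl (successor A) (start A)"
  assume p: "p \<in> action_dom A a" and eq: "\<And>r. r \<in> action_dom A a \<Longrightarrow> ?s u r = ?s v r"
  then have "restrict (?s u) (action_dom A a) = restrict (?s v) (action_dom A a)"
    by (intro restrict_ext)
  then show "?s (u @ [a]) p = ?s (v @ [a]) p"
    using p eq[OF p] by (simp add: successor_def split: option.split)
qed

lemma state_cong:
  assumes "runnable A u" "runnable A v" "commute_equiv (action_dom A) u v"
  shows "state A u = state A v"
  using local_valuation.val_cong[OF local_valuation_successor assms(3)]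
  by (simp add: assms(1,2) state_eq_foldl_successor)

lemma state_eq_if_view_eq:
  assumes "runnable A u" "runnable A v" "view A p u = view A p v"
  shows "state A u p = state A v p"
proof -
  let ?d = "action_dom A"
  interpret local_valuation ?d "foldl (successor A) (start A)"
    by (rule local_valuation_successor)
  have "commute_equiv ?d (causal_past ?d {p} u) (causal_past ?d {p} v)"
    using assms(3) by (simp add: view_eq_trace_causal_past trace_eq_iff)
  from val_cong[OF this] show ?thesis
    using val_causal_past[of p "{p}" u] val_causal_past[of p "{p}" v] assms(1,2)
    by (simp add: state_eq_foldl_successor)
qed

lemma runnable_snoc_swap:
  assumes indep: "action_dom A a \<inter> action_dom A b = {}" and "runnable A (u @ [a, b])"
  shows "runnable A (u @ [b, a])"
proof -
  have "runnable A ((u @ [a]) @ [b])" using assms(2) by simp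
  then have run_a: "runnable A (u @ [a])" and exec_b: "executable A (state A (u @ [a])) b"
    by (simp_all only: runnable_snoc)
  have "executable A (state A u) b \<longleftrightarrow> executable A (state A (u @ [a])) b"
    using indep by (intro executable_cong state_snoc_other[OF run_a, symmetric]) blast
  then have run_b: "runnable A (u @ [b])" using run_a exec_b by (simp add: runnable_snoc)
  have "executable A (state A (u @ [b])) a \<longleftrightarrow> executable A (state A u) a"
    using indep by (intro executable_cong state_snoc_other[OF run_b]) blast
  then have "runnable A ((u @ [b]) @ [a])" using run_a run_b by (simp only: runnable_snoc)
  then show ?thesis by simp
qed

lemma runnable_commute_equiv:
  assumes "commute_equiv (action_dom A) u v" "runnable A u"
  shows "runnable A v"
  using assms
proof (rule commute_equiv_preserves_prefix_closed)
  show "runnable A x" if "runnable A (x @ [a])" for x a using that by (simp add: runnable_snoc)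
  show "runnable A (y @ [a])"
    if "commute_equiv (action_dom A) x y" "runnable A y" "runnable A (x @ [a])" for x y a
    using that state_cong[of A x y] by (simp add: runnable_snoc)
qed (rule runnable_snoc_swap)

lemma trace_in_finite_plays_iff: "trace A u \<in> finite_plays A \<longleftrightarrow> runnable A u"
proof -
  have "finite_plays A = {trace A u | u. runnable A u}"
    by (simp add: finite_plays_def runnable_def)
  then show ?thesis
    using runnable_commute_equiv[OF commute_equiv_sym] by (auto simp: trace_eq_iff)
qed

lemma parallel_composition_sel [simp]:
  "processes (parallel_composition R \<Sigma> d L) = R"
  "actions (parallel_composition R \<Sigma> d L) = \<Sigma>"
  "action_dom (parallel_composition R \<Sigma> d L) = d"
  "start (parallel_composition R \<Sigma> d L) = restrict (\<lambda>p. lstart (L p)) R"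
  by (simp_all add: parallel_composition_def)

lemma global_step_parallel_composition:
  assumes det: "\<And>p x y y'. p \<in> d a \<Longrightarrow> (x, a, y) \<in> ltrans (L p) \<Longrightarrow> (x, a, y') \<in> ltrans (L p) \<Longrightarrow> y = y'"
  shows "global_step (parallel_composition R \<Sigma> d L) s a s' \<longleftrightarrow>
    a \<in> \<Sigma> \<and> (\<forall>p \<in> d a. (s p, a, s' p) \<in> ltrans (L p)) \<and> (\<forall>p. p \<notin> d a \<longrightarrow> s' p = s p)"
proof -
  define succ where "succ x \<longleftrightarrow> x \<in> extensional (d a) \<and>
      (\<forall>p \<in> d a. (restrict s (d a) p, a, x p) \<in> ltrans (L p))" for x
  have unique: "x = y" if "succ x" "succ y" for x y
    using that det by (intro extensionalityI[of x "d a"]) (auto simp: succ_def)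
  have delta: "delta (parallel_composition R \<Sigma> d L) a (restrict s (d a)) =
      (if \<exists>x. succ x then Some (THE x. succ x) else None)"
    by (simp add: parallel_composition_def succ_def Let_def)
  have "delta (parallel_composition R \<Sigma> d L) a (restrict s (d a)) = Some x \<longleftrightarrow> succ x" for x
  proof (cases "\<exists>y. succ y")
    case True
    then obtain y where y: "succ y" by blast
    then have "(THE x. succ x) = y" using unique by blast
    then show ?thesis using True y unique[of x y] by (auto simp: delta)
  qed (simp add: delta)
  moreover have "succ (restrict s' (d a)) \<longleftrightarrow> (\<forall>p \<in> d a. (s p, a, s' p) \<in> ltrans (L p))"
    by (auto simp: succ_def)
  ultimately show ?thesis by (simp add: global_step_def)
qed

section \<open>Control games\<close>

definition permits ::
    "('r, 'a, 's) control_game \<Rightarrow> ('r, 'a) controller \<Rightarrow> 'a list \<Rightarrow> 'a \<Rightarrow> bool" where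
  "permits C f u a \<longleftrightarrow>
     a \<in> env_actions C \<or>
     a \<in> sys_actions C \<and> (\<forall>p \<in> action_dom (arena C) a. a \<in> f p (view (arena C) p u))"

inductive consistent ::
    "('r, 'a, 's) control_game \<Rightarrow> ('r, 'a) controller \<Rightarrow> 'a list \<Rightarrow> bool" for C f where
  consistent_Nil: "consistent C f []"
| consistent_step:
    "consistent C f u \<Longrightarrow> runnable (arena C) (u @ [a]) \<Longrightarrow> permits C f u a \<Longrightarrow>
     consistent C f (u @ [a])"

lemma consistent_snoc:
  "consistent C f (u @ [a]) \<longleftrightarrow> consistent C f u \<and> runnable (arena C) (u @ [a]) \<and> permits C f u a"
  by (auto intro: consistent_step elim: consistent.cases)

lemma consistent_snocD: "consistent C f (u @ [a]) \<Longrightarrow> consistent C f u"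
  by (simp add: consistent_snoc)

lemma consistent_runnable: "consistent C f u \<Longrightarrow> runnable (arena C) u"
  by (induction rule: consistent.induct) auto

lemma consistent_snoc_action: "consistent C f (u @ [a]) \<Longrightarrow> a \<in> actions (arena C)"
  using set_runnable[OF consistent_runnable] by fastforce

lemma consistent_appendD: "consistent C f (u @ v) \<Longrightarrow> consistent C f u"
proof (induction v rule: rev_induct)
  case (snoc a v)
  then show ?case using consistent_snocD[of C f "u @ v" a] by simp
qed simp

lemma permits_cong:
  "commute_equiv (action_dom (arena C)) u v \<Longrightarrow> permits C f u a \<longleftrightarrow> permits C f v a"
  by (simp add: permits_def view_cong[of "arena C" u v])

lemma permits_snoc_independent:
  assumes "action_dom (arena C) a \<inter> action_dom (arena C) b = {}"
  shows "permits C f (u @ [b]) a \<longleftrightarrow> permits C f u a"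
proof -
  have "view (arena C) p (u @ [b]) = view (arena C) p u" if "p \<in> action_dom (arena C) a" for p
    using assms that by (intro view_snoc_other) blast
  then show ?thesis by (simp add: permits_def)
qed

lemma consistent_snoc_swap:
  assumes indep: "action_dom (arena C) a \<inter> action_dom (arena C) b = {}"
    and "consistent C f (u @ [a, b])"
  shows "consistent C f (u @ [b, a])"
proof -
  have consistent_ab: "consistent C f ((u @ [a]) @ [b])" using assms(2) by simp
  have "runnable (arena C) ((u @ [b]) @ [a])"
    using runnable_snoc_swap[OF indep, of u] consistent_runnable[OF consistent_ab] by simp
  moreover have "consistent C f u" "permits C f u a" "permits C f (u @ [a]) b"
    using consistent_ab by (simp_all only: consistent_snoc)
  ultimately have "consistent C f ((u @ [b]) @ [a])"
    using indep permits_snoc_independent[of C a b f u] permits_snoc_independent[of C b a f u]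
    by (auto simp only: consistent_snoc runnable_snoc Int_commute)
  then show ?thesis by simp
qed

lemma consistent_commute_equiv:
  assumes "commute_equiv (action_dom (arena C)) u v" "consistent C f u"
  shows "consistent C f v"
  using assms
proof (rule commute_equiv_preserves_prefix_closed)
  show "consistent C f x" if "consistent C f (x @ [a])" for x a
    using that by (rule consistent_snocD)
  show "consistent C f (y @ [a])"
    if equiv: "commute_equiv (action_dom (arena C)) x y"
      and "consistent C f y" "consistent C f (x @ [a])" for x y a
    using that(2,3) permits_cong[OF equiv, of f a]
      runnable_commute_equiv[OF commute_equiv_append_right[OF equiv]]
    by (simp add: consistent_snoc)
qed (rule consistent_snoc_swap)

lemma trace_in_controlled_plays_iff:
  "trace (arena C) u \<in> controlled_plays C f \<longleftrightarrow> consistent C f u"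
proof
  have "\<exists>v. U = trace (arena C) v \<and> consistent C f v" if "U \<in> controlled_plays C f" for U
    using that
  proof induction
    case empty_play
    then show ?case using consistent_Nil by blast
  next
    case (extend_play u a)
    then have "consistent C f u"
      using consistent_commute_equiv[OF commute_equiv_sym] by (auto simp: trace_eq_iff)
    then have "consistent C f (u @ [a])"
      using extend_play.hyps
      by (auto simp: consistent_snoc trace_in_finite_plays_iff permits_def)
    then show ?case by blast
  qed
  then show "consistent C f u" if "trace (arena C) u \<in> controlled_plays C f"
    using that consistent_commute_equiv[OF commute_equiv_sym] by (metis trace_eq_iff)
  show "trace (arena C) u \<in> controlled_plays C f" if "consistent C f u"
    using that
  proof (induction rule: consistent.induct)
    case consistent_Nil
    show ?case by (rule empty_play)
  next
    case (consistent_step u a)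
    then show ?case
      by (intro extend_play) (auto simp: trace_in_finite_plays_iff permits_def)
  qed
qed

lemma infinite_controlled_play_iff:
  "infinite_controlled_play C f w \<longleftrightarrow> (\<forall>n. consistent C f (map w [0..<n]))"
  by (simp add: infinite_controlled_play_def trace_in_controlled_plays_iff)

lemma final_play_iff:
  "final_play C f u \<longleftrightarrow> consistent C f u \<and> (\<forall>a. \<not> consistent C f (u @ [a]))"
  by (simp add: final_play_def trace_in_controlled_plays_iff)

lemma single_commitment_iff:
  "single_commitment C f \<longleftrightarrow>
     (\<forall>u p. \<forall>a \<in> sys_actions C. \<forall>b \<in> sys_actions C.
        p \<in> action_dom (arena C) a \<and> p \<in> action_dom (arena C) b \<and>
        consistent C f (u @ [a]) \<and> consistent C f (u @ [b]) \<longrightarrow> a = b)"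
  by (auto simp: single_commitment_def trace_in_controlled_plays_iff consistent_snoc)

subsection \<open>Controllers without infinite plays\<close>

definition terminating :: "('r, 'a, 's) control_game \<Rightarrow> ('r, 'a) controller \<Rightarrow> bool" where
  "terminating C f \<longleftrightarrow> (\<nexists>w. infinite_controlled_play C f w)"

lemma winning_controller_iff:
  "winning_controller C f \<longleftrightarrow> controller C f \<and> terminating C f \<and>
     (\<forall>u. final_play C f u \<longrightarrow>
        (\<forall>p \<in> processes (arena C). state (arena C) u p \<in> win_states C p))"
  by (simp add: winning_controller_def terminating_def)

lemma terminating_if_bounded:
  assumes "\<And>u. consistent C f u \<Longrightarrow> length u \<le> k"
  shows "terminating C f"
  unfolding terminating_def infinite_controlled_play_iff
proof
  assume "\<exists>w. \<forall>n. consistent C f (map w [0..<n])"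
  then obtain w where "consistent C f (map w [0..<Suc k])" by blast
  from assms[OF this] show False by simp
qed

definition play_extension ::
    "('r, 'a, 's) control_game \<Rightarrow> ('r, 'a) controller \<Rightarrow> ('a list \<times> 'a list) set" where
  "play_extension C f = {(u @ [a], u) | u a. consistent C f (u @ [a])}"

lemma wf_play_extension:
  assumes "terminating C f"
  shows "wf (play_extension C f)"
  unfolding wf_iff_no_infinite_down_chain
proof
  assume "\<exists>g. \<forall>i. (g (Suc i), g i) \<in> play_extension C f"
  then obtain g where g: "\<And>i. (g (Suc i), g i) \<in> play_extension C f" by blast
  have g_Suc: "\<exists>a. g (Suc n) = g n @ [a]" and consistent: "consistent C f (g n)" for n
    using g[of n] by (auto simp: play_extension_def dest: consistent_snocD)
  have long: "n \<le> length (g n)" for n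
  proof (induction n)
    case (Suc n)
    then show ?case using g_Suc[of n] by auto
  qed simp
  define w where "w n = g (Suc n) ! n" for n
  have "map w [0..<n] = take n (g n)" for n
  proof (induction n)
    case (Suc n)
    have "take n (g (Suc n)) = take n (g n)" using g_Suc[of n] long[of n] by auto
    then show ?case using Suc long[of "Suc n"] by (simp add: take_Suc_conv_app_nth w_def)
  qed simp
  moreover have "consistent C f (take n (g n))" for n
    using consistent_appendD[of C f "take n (g n)" "drop n (g n)"] consistent by simp
  ultimately have "infinite_controlled_play C f w" by (simp add: infinite_controlled_play_iff)
  then show False using assms by (auto simp: terminating_def)
qed

lemma maximal_extension:
  assumes "terminating C f" "consistent C f u"
  shows "\<exists>x. set x \<subseteq> X \<and> consistent C f (u @ x) \<and> (\<forall>a \<in> X. \<not> consistent C f (u @ x @ [a]))"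
  using wf_play_extension[OF assms(1)] assms(2)
proof (induction u rule: wf_induct_rule)
  case (less u)
  show ?case
  proof (cases "\<forall>a \<in> X. \<not> consistent C f (u @ [a])")
    case True
    then show ?thesis using less.prems by (intro exI[of _ "[]"]) simp
  next
    case False
    then obtain a where a: "a \<in> X" "consistent C f (u @ [a])" by blast
    then have "(u @ [a], u) \<in> play_extension C f" by (auto simp: play_extension_def)
    from less.IH[OF this a(2)] obtain x where "set x \<subseteq> X" "consistent C f (u @ a # x)"
        "\<forall>b \<in> X. \<not> consistent C f (u @ a # x @ [b])"
      by auto
    then show ?thesis using a(1) by (intro exI[of _ "a # x"]) simp
  qed
qed

lemma final_extension:
  assumes "terminating C f" "consistent C f u"
  shows "\<exists>x. final_play C f (u @ x)"
  using maximal_extension[OF assms, of UNIV] by (auto simp: final_play_iff)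

definition saturated :: "('r, 'a, 's) control_game \<Rightarrow> ('r, 'a) controller \<Rightarrow> 'a list \<Rightarrow> bool" where
  "saturated C f u \<longleftrightarrow>
     consistent C f u \<and> (\<forall>a \<in> sys_actions C. \<not> consistent C f (u @ [a]))"

lemma saturated_consistent: "saturated C f u \<Longrightarrow> consistent C f u"
  by (simp add: saturated_def)

lemma saturated_extension:
  assumes "terminating C f" "consistent C f u"
  shows "\<exists>x. set x \<subseteq> sys_actions C \<and> saturated C f (u @ x)"
  using maximal_extension[OF assms, of "sys_actions C"] by (auto simp: saturated_def)

lemma finite_consistent:
  assumes "terminating C f" and fin: "finite (actions (arena C))"
  shows "finite {u. consistent C f u}"
proof -
  have "finite {v. consistent C f (u @ v)}" for u
    using wf_play_extension[OF assms(1)]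
  proof (induction u rule: wf_induct_rule)
    case (less u)
    let ?next = "{a \<in> actions (arena C). consistent C f (u @ [a])}"
    have "{v. consistent C f (u @ v)} \<subseteq>
        insert [] (\<Union>a \<in> ?next. (#) a ` {v. consistent C f ((u @ [a]) @ v)})"
    proof
      fix v assume v: "v \<in> {v. consistent C f (u @ v)}"
      show "v \<in> insert [] (\<Union>a \<in> ?next. (#) a ` {v. consistent C f ((u @ [a]) @ v)})"
      proof (cases v)
        case (Cons a w)
        then have w: "consistent C f ((u @ [a]) @ w)" using v by simp
        then have "consistent C f (u @ [a])" by (rule consistent_appendD)
        then have "a \<in> ?next" by (simp add: consistent_snoc_action)
        then show ?thesis using w Cons by blast
      qed simp
    qed
    moreover have "finite {v. consistent C f ((u @ [a]) @ v)}" if "consistent C f (u @ [a])" for a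
      using that by (intro less.IH) (auto simp: play_extension_def)
    ultimately show ?case using fin by (auto intro: finite_subset)
  qed
  from this[of "[]"] show ?thesis by simp
qed

subsection \<open>Restriction to single commitments\<close>

lemma consistent_mono:
  assumes "\<And>p V. f' p V \<subseteq> f p V" "consistent C f' u"
  shows "consistent C f u"
  using assms(2)
proof (induction rule: consistent.induct)
  case (consistent_step u a)
  then have "permits C f u a" using assms(1) unfolding permits_def by blast
  then show ?case using consistent_step by (simp add: consistent_snoc)
qed (rule consistent_Nil)

definition offers ::
    "('r, 'a, 's) control_game \<Rightarrow> ('r, 'a) controller \<Rightarrow> 'r \<Rightarrow> 'a list set \<Rightarrow> 'a set" where
  "offers C f p V = {a \<in> f p V \<inter> sys_actions C. p \<in> action_dom (arena C) a \<and>
     (\<exists>u. runnable (arena C) (u @ [a]) \<and> V = view (arena C) p u)}"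

definition pick_offer ::
    "('r, 'a, 's) control_game \<Rightarrow> ('r, 'a) controller \<Rightarrow> ('r, 'a) controller" where
  "pick_offer C f p V = (if offers C f p V = {} then {} else {SOME a. a \<in> offers C f p V})"

lemma pick_offer_subset_offers: "pick_offer C f p V \<subseteq> offers C f p V"
  by (auto simp: pick_offer_def some_in_eq)

lemma pick_offer_subset: "pick_offer C f p V \<subseteq> f p V"
  using pick_offer_subset_offers[of C f p V] by (auto simp: offers_def)

lemma single_commitment_pick_offer:
  assumes "sys_actions C \<inter> env_actions C = {}"
  shows "single_commitment C (pick_offer C f)"
  unfolding single_commitment_iff
proof (intro allI ballI impI)
  fix u p a b
  assume "a \<in> sys_actions C" "b \<in> sys_actions C"
    and "p \<in> action_dom (arena C) a \<and> p \<in> action_dom (arena C) b \<and>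
      consistent C (pick_offer C f) (u @ [a]) \<and> consistent C (pick_offer C f) (u @ [b])"
  then have "a \<in> pick_offer C f p (view (arena C) p u)" "b \<in> pick_offer C f p (view (arena C) p u)"
    using assms by (auto simp: consistent_snoc permits_def)
  then show "a = b" by (auto simp: pick_offer_def split: if_splits)
qed

lemma runnable_snoc_local:
  assumes "action_dom A a = {p}" and "runnable A u" "runnable A (v @ [a])"
    and "view A p u = view A p v"
  shows "runnable A (u @ [a])"
proof -
  have v: "runnable A v" "executable A (state A v) a"
    using assms(3) by (simp_all add: runnable_snoc)
  have "state A u p = state A v p" using assms(2) v(1) assms(4) by (rule state_eq_if_view_eq)
  then have "executable A (state A u) a"
    using v(2) assms(1) executable_cong[of A a "state A u" "state A v"] by simp
  then show ?thesis using assms(2) by (simp add: runnable_snoc)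
qed

text \<open>Dropping all executable offers but one leaves at least one of them executable, hence creates
  no new final play.\<close>

lemma final_play_pick_offer:
  assumes local_sys: "\<And>a. a \<in> sys_actions C \<Longrightarrow> \<exists>p. action_dom (arena C) a = {p}"
    and final: "final_play C (pick_offer C f) u"
  shows "final_play C f u"
  unfolding final_play_iff
proof (intro conjI allI notI)
  have u: "consistent C (pick_offer C f) u"
    and stuck: "\<And>a. \<not> consistent C (pick_offer C f) (u @ [a])"
    using final by (simp_all add: final_play_iff)
  show "consistent C f u" using pick_offer_subset u by (rule consistent_mono)
  fix a assume "consistent C f (u @ [a])"
  then have a: "runnable (arena C) (u @ [a])" "permits C f u a" by (simp_all add: consistent_snoc)
  have "a \<notin> env_actions C" using stuck[of a] a u by (auto simp: consistent_snoc permits_def)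
  then have a_sys: "a \<in> sys_actions C" using a(2) by (simp add: permits_def)
  then obtain p where p: "action_dom (arena C) a = {p}" using local_sys by blast
  let ?V = "view (arena C) p u"
  have "a \<in> offers C f p ?V"
    using a p a_sys \<open>a \<notin> env_actions C\<close> by (auto simp: offers_def permits_def)
  then have "offers C f p ?V \<noteq> {}" by blast
  then obtain b where b: "b \<in> pick_offer C f p ?V" by (auto simp: pick_offer_def)
  then obtain v where v: "b \<in> sys_actions C" "p \<in> action_dom (arena C) b"
      "runnable (arena C) (v @ [b])" "?V = view (arena C) p v"
    using pick_offer_subset_offers[of C f p ?V] by (auto simp: offers_def)
  have dom_b: "action_dom (arena C) b = {p}" using local_sys[OF v(1)] v(2) by auto
  have "runnable (arena C) (u @ [b])"
    using runnable_snoc_local[OF dom_b consistent_runnable[OF u] v(3,4)] .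
  then have "consistent C (pick_offer C f) (u @ [b])"
    using u b dom_b v(1) by (simp add: consistent_snoc permits_def)
  then show False using stuck by blast
qed

theorem single_commitment_restriction:
  assumes local_sys: "\<And>a. a \<in> sys_actions C \<Longrightarrow> \<exists>p. action_dom (arena C) a = {p}"
    and "sys_actions C \<inter> env_actions C = {}"
    and win: "winning_controller C f"
  shows "\<exists>f'. restricts C f' f \<and> winning_controller C f' \<and> single_commitment C f'"
proof (intro exI conjI)
  show "restricts C (pick_offer C f) f" by (simp add: restricts_def pick_offer_subset)
  show "single_commitment C (pick_offer C f)" using assms(2) by (rule single_commitment_pick_offer)
  have "controller C (pick_offer C f)"
    using win pick_offer_subset unfolding winning_controller_def controller_def
    by (meson order_trans)
  moreover have "terminating C (pick_offer C f)"
    using win consistent_mono[of "pick_offer C f" f C, OF pick_offer_subset]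
    unfolding winning_controller_iff terminating_def infinite_controlled_play_iff by blast
  ultimately show "winning_controller C (pick_offer C f)"
    using win final_play_pick_offer[OF local_sys] unfolding winning_controller_iff by blast
qed

section \<open>Configurations of occurrence nets\<close>

lemma mset_set_set_mset_if_count_le_1:
  assumes "\<And>q. count X q \<le> 1"
  shows "mset_set (set_mset X) = X"
proof (rule multiset_eqI)
  fix q show "count (mset_set (set_mset X)) q = count X q"
    using assms[of q] by (cases "q \<in># X") (auto simp: not_in_iff order.antisym Suc_leI)
qed

definition configuration :: "('p, 't, 'z) net_scheme \<Rightarrow> 't set \<Rightarrow> bool" where
  "configuration N F \<longleftrightarrow> F \<subseteq> transitions N \<and> finite F \<and>
     (\<forall>t \<in> F. \<forall>q. q \<in># pre N t \<longrightarrow> place_pre N q \<subseteq> F) \<and>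
     (\<forall>q. \<forall>t1 \<in> F. \<forall>t2 \<in> F. q \<in># pre N t1 \<longrightarrow> q \<in># pre N t2 \<longrightarrow> t1 = t2)"

definition frontier :: "('p, 't, 'z) net_scheme \<Rightarrow> 't set \<Rightarrow> 'p set" where
  "frontier N F = {q \<in> places N. place_pre N q \<subseteq> F \<and> place_post N q \<inter> F = {}}"

lemma configuration_empty: "configuration N {}"
  by (simp add: configuration_def)

lemma configuration_subset: "configuration N F \<Longrightarrow> F \<subseteq> transitions N"
  by (simp add: configuration_def)

lemma configuration_finite: "configuration N F \<Longrightarrow> finite F"
  by (simp add: configuration_def)

lemma configuration_closed:
  "configuration N F \<Longrightarrow> t \<in> F \<Longrightarrow> q \<in># pre N t \<Longrightarrow> place_pre N q \<subseteq> F"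
  by (simp add: configuration_def)

lemma configuration_conflict_free:
  "configuration N F \<Longrightarrow> t1 \<in> F \<Longrightarrow> t2 \<in> F \<Longrightarrow> q \<in># pre N t1 \<Longrightarrow> q \<in># pre N t2 \<Longrightarrow> t1 = t2"
  by (auto simp: configuration_def)

lemma configuration_flow_closed:
  assumes "configuration N F" "(x, y) \<in> (flow_rel N)\<^sup>*"
    and "case y of Inl q \<Rightarrow> place_pre N q \<subseteq> F | Inr t \<Rightarrow> t \<in> F"
  shows "case x of Inl q \<Rightarrow> place_pre N q \<subseteq> F | Inr t \<Rightarrow> t \<in> F"
  using assms(2,3)
proof (induction rule: converse_rtrancl_induct)
  case (step x z)
  from step.hyps(1) consider q t where "x = Inl q" "z = Inr t" "q \<in># pre N t"
    | q t where "x = Inr t" "z = Inl q" "t \<in> place_pre N q"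
    by (auto simp: flow_rel_def place_pre_def)
  then show ?case using step configuration_closed[OF assms(1)] by cases auto
qed simp

lemma frontier_no_conflict:
  assumes F: "configuration N F" and "q1 \<in> frontier N F" "q2 \<in> frontier N F"
  shows "\<not> conflict N (Inl q1) (Inl q2)"
proof
  assume "conflict N (Inl q1) (Inl q2)"
  then obtain q t1 t2 where post: "t1 \<in> place_post N q" "t2 \<in> place_post N q" "t1 \<noteq> t2"
      and flow: "(Inr t1, Inl q1) \<in> (flow_rel N)\<^sup>*" "(Inr t2, Inl q2) \<in> (flow_rel N)\<^sup>*"
    by (auto simp: conflict_def)
  have "t1 \<in> F" "t2 \<in> F"
    using configuration_flow_closed[OF F flow(1)] configuration_flow_closed[OF F flow(2)] assms(2,3)
    by (auto simp: frontier_def)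
  then show False using post configuration_conflict_free[OF F] by (auto simp: place_post_def)
qed

lemma frontier_no_flow:
  assumes F: "configuration N F" and "q1 \<in> frontier N F" "q2 \<in> frontier N F" "q1 \<noteq> q2"
  shows "(Inl q1, Inl q2) \<notin> (flow_rel N)\<^sup>*"
proof
  assume "(Inl q1, Inl q2) \<in> (flow_rel N)\<^sup>*"
  then obtain z where z: "(Inl q1, z) \<in> flow_rel N" "(z, Inl q2) \<in> (flow_rel N)\<^sup>*"
    using \<open>q1 \<noteq> q2\<close> by (metis converse_rtranclE sum.inject(1))
  then obtain t where t: "z = Inr t" "t \<in> place_post N q1"
    by (auto simp: flow_rel_def place_post_def)
  have "t \<in> F" using configuration_flow_closed[OF F z(2)] assms(3) t by (auto simp: frontier_def)
  then show False using t assms(2) by (auto simp: frontier_def)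
qed

lemma frontier_pairwise_concurrent:
  "configuration N F \<Longrightarrow> C \<subseteq> frontier N F \<Longrightarrow> pairwise_concurrent N C"
  using frontier_no_conflict[of N F] frontier_no_flow[of N F]
  by (auto simp: pairwise_concurrent_def concurrent_def frontier_def subset_iff)

text \<open>The axioms of an occurrence net without the absence of self-conflicts. Presets are required to
  be nonempty because a transition with empty preset could fire repeatedly.\<close>

locale causal_net =
  fixes N :: "('p, 't, 'z) net_scheme"
  assumes petri_net: "petri_net N"
    and count_pre: "t \<in> transitions N \<Longrightarrow> count (pre N t) q \<le> 1"
    and count_post: "t \<in> transitions N \<Longrightarrow> count (post N t) q \<le> 1"
    and initial: "initial N = mset_set {q \<in> places N. place_pre N q = {}}"
    and finite_initial: "finite {q \<in> places N. place_pre N q = {}}"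
    and producer_unique: "q \<in> places N \<Longrightarrow> t1 \<in> place_pre N q \<Longrightarrow> t2 \<in> place_pre N q \<Longrightarrow> t1 = t2"
    and wf_flow: "wf (flow_rel N)"
    and pre_nonempty: "t \<in> transitions N \<Longrightarrow> pre N t \<noteq> {#}"

lemma causal_net_if_occurrence_net:
  "occurrence_net N \<Longrightarrow> (\<And>t. t \<in> transitions N \<Longrightarrow> pre N t \<noteq> {#}) \<Longrightarrow> causal_net N"
  by (auto simp: occurrence_net_def causal_net_def)

context causal_net
begin

lemma mset_set_pre: "t \<in> transitions N \<Longrightarrow> mset_set (set_mset (pre N t)) = pre N t"
  using count_pre by (rule mset_set_set_mset_if_count_le_1)

lemma mset_set_post: "t \<in> transitions N \<Longrightarrow> mset_set (set_mset (post N t)) = post N t"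
  using count_post by (rule mset_set_set_mset_if_count_le_1)

lemma pre_places: "t \<in> transitions N \<Longrightarrow> set_mset (pre N t) \<subseteq> places N"
  and post_places: "t \<in> transitions N \<Longrightarrow> set_mset (post N t) \<subseteq> places N"
  using petri_net by (auto simp: petri_net_def)

lemma place_pre_of_post: "t \<in> transitions N \<Longrightarrow> q \<in># post N t \<Longrightarrow> place_pre N q = {t}"
  using producer_unique[of q t] post_places[of t] by (fastforce simp: place_pre_def)

lemma finite_frontier:
  assumes F: "configuration N F"
  shows "finite (frontier N F)"
proof -
  have "frontier N F \<subseteq> {q \<in> places N. place_pre N q = {}} \<union> (\<Union>t \<in> F. set_mset (post N t))"
    by (auto simp: frontier_def place_pre_def)
  moreover have "finite \<dots>" using finite_initial configuration_finite[OF F] by simp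
  ultimately show ?thesis by (rule finite_subset)
qed

lemma initial_frontier: "initial N = mset_set (frontier N {})"
  by (simp add: initial frontier_def)

lemma enabled_frontier_iff:
  assumes F: "configuration N F"
  shows "enabled N (mset_set (frontier N F)) t \<longleftrightarrow>
    t \<in> transitions N \<and> set_mset (pre N t) \<subseteq> frontier N F"
proof -
  have "pre N t \<subseteq># mset_set (frontier N F) \<longleftrightarrow> set_mset (pre N t) \<subseteq> frontier N F"
    if "t \<in> transitions N"
  proof
    show "set_mset (pre N t) \<subseteq> frontier N F" if "pre N t \<subseteq># mset_set (frontier N F)"
      using set_mset_mono[OF that] finite_frontier[OF F] by simp
    show "pre N t \<subseteq># mset_set (frontier N F)" if "set_mset (pre N t) \<subseteq> frontier N F"
      using subset_imp_msubset_mset_set[OF that finite_frontier[OF F]]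
        mset_set_pre[OF \<open>t \<in> transitions N\<close>] by simp
  qed
  then show ?thesis by (auto simp: enabled_def)
qed

lemma configuration_insert:
  assumes F: "configuration N F" and t: "t \<in> transitions N" "set_mset (pre N t) \<subseteq> frontier N F"
  shows "t \<notin> F" and "configuration N (insert t F)"
proof -
  obtain q where "q \<in># pre N t" using pre_nonempty[OF t(1)] by blast
  then show "t \<notin> F" using t by (auto simp: frontier_def place_post_def)
  show "configuration N (insert t F)"
    using F t unfolding configuration_def by (auto simp: frontier_def place_post_def) blast+
qed

lemma frontier_insert:
  assumes F: "configuration N F" and t: "t \<in> transitions N" "set_mset (pre N t) \<subseteq> frontier N F"
  shows "frontier N (insert t F) = (frontier N F - set_mset (pre N t)) \<union> set_mset (post N t)"
proof (rule set_eqI)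
  fix q
  show "q \<in> frontier N (insert t F) \<longleftrightarrow> q \<in> (frontier N F - set_mset (pre N t)) \<union> set_mset (post N t)"
  proof (cases "q \<in># post N t")
    case True
    note produced = place_pre_of_post[OF t(1) True]
    have "place_post N q \<inter> insert t F = {}"
      using configuration_closed[OF F] configuration_insert(1)[OF F t] t(2) produced
      by (fastforce simp: place_post_def frontier_def)
    then show ?thesis using True produced post_places[OF t(1)] by (auto simp: frontier_def)
  next
    case False
    then have "place_pre N q \<subseteq> insert t F \<longleftrightarrow> place_pre N q \<subseteq> F" by (auto simp: place_pre_def)
    then show ?thesis using False t(1) by (auto simp: frontier_def place_post_def)
  qed
qed

lemma fire_frontier:
  assumes F: "configuration N F" and t: "t \<in> transitions N" "set_mset (pre N t) \<subseteq> frontier N F"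
  shows "fire N (mset_set (frontier N F)) t = mset_set (frontier N (insert t F))"
proof -
  have "(frontier N F - set_mset (pre N t)) \<inter> set_mset (post N t) = {}"
    using place_pre_of_post[OF t(1)] configuration_insert(1)[OF F t] by (auto simp: frontier_def)
  then show ?thesis
    unfolding frontier_insert[OF assms] fire_def using finite_frontier[OF F] t
    by (simp add: mset_set_Union mset_set_Diff mset_set_pre mset_set_post)
qed

lemma reachable_configuration:
  "reachable N M \<Longrightarrow> \<exists>F. configuration N F \<and> M = mset_set (frontier N F)"
proof (induction rule: reachable.induct)
  case reachable_initial
  then show ?case using configuration_empty initial_frontier by blast
next
  case (reachable_fire M t)
  then obtain F where F: "configuration N F" "M = mset_set (frontier N F)" by blast
  then have t: "t \<in> transitions N" "set_mset (pre N t) \<subseteq> frontier N F"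
    using reachable_fire.hyps(2) enabled_frontier_iff by auto
  then show ?case using configuration_insert(2)[OF F(1) t] fire_frontier[OF F(1) t] F(2) by blast
qed

lemma configuration_next_transition:
  assumes F: "configuration N F" and F0: "configuration N F0" and "F0 \<subset> F"
  shows "\<exists>t \<in> F - F0. set_mset (pre N t) \<subseteq> frontier N F0"
proof -
  obtain t0 where "t0 \<in> F - F0" using \<open>F0 \<subset> F\<close> by blast
  then have "Inr t0 \<in> Inr ` (F - F0)" by (rule imageI)
  moreover have "wf ((flow_rel N)\<^sup>+)" using wf_flow by (rule wf_trancl)
  ultimately obtain z where z: "z \<in> Inr ` (F - F0)"
      "\<And>y. (y, z) \<in> (flow_rel N)\<^sup>+ \<Longrightarrow> y \<notin> Inr ` (F - F0)"
    by (meson wfE_min)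
  then obtain t where t: "t \<in> F" "t \<notin> F0" and z_eq: "z = Inr t" by blast
  have t_in_N: "t \<in> transitions N" using t(1) configuration_subset[OF F] by blast
  have "q \<in> frontier N F0" if q: "q \<in># pre N t" for q
  proof -
    have "t' \<in> F0" if t': "t' \<in> place_pre N q" for t'
    proof -
      have "(Inr t', Inl q) \<in> flow_rel N" "(Inl q, Inr t) \<in> flow_rel N"
        using t' q t_in_N by (auto simp: flow_rel_def place_pre_def)
      then have "(Inr t', Inr t) \<in> (flow_rel N)\<^sup>+" by (meson trancl.simps)
      then have "t' \<notin> F - F0" using z(2) z_eq by blast
      then show ?thesis using configuration_closed[OF F t(1) q] t' by blast
    qed
    moreover have "s \<notin> F0" if s: "s \<in> place_post N q" for s
    proof
      assume "s \<in> F0"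
      moreover from this have "s = t"
        using configuration_conflict_free[OF F _ t(1) _ q] s \<open>F0 \<subset> F\<close>
        by (auto simp: place_post_def)
      ultimately show False using t(2) by simp
    qed
    moreover have "q \<in> places N" using pre_places[OF t_in_N] q by blast
    ultimately show ?thesis by (auto simp: frontier_def)
  qed
  then show ?thesis using t by blast
qed

lemma configuration_reachable:
  assumes F: "configuration N F"
  shows "reachable N (mset_set (frontier N F))"
proof -
  have "reachable N (mset_set (frontier N F))"
    if "configuration N F0" "F0 \<subseteq> F" "reachable N (mset_set (frontier N F0))" for F0
    using that
  proof (induction "card (F - F0)" arbitrary: F0 rule: less_induct)
    case less
    show ?case
    proof (cases "F0 = F")
      case False
      then obtain t where t: "t \<in> F - F0" "set_mset (pre N t) \<subseteq> frontier N F0"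
        using configuration_next_transition[OF F less.prems(1)] less.prems(2) by blast
      then have t_in_N: "t \<in> transitions N" using configuration_subset[OF F] by blast
      show ?thesis
      proof (rule less.hyps)
        show "card (F - insert t F0) < card (F - F0)"
          using t(1) configuration_finite[OF F] by (intro psubset_card_mono) auto
        show "configuration N (insert t F0)"
          using configuration_insert(2)[OF less.prems(1) t_in_N t(2)] .
        show "insert t F0 \<subseteq> F" using t(1) less.prems(2) by blast
        show "reachable N (mset_set (frontier N (insert t F0)))"
          using reachable_fire[OF less.prems(3)] enabled_frontier_iff[OF less.prems(1)] t_in_N t(2)
            fire_frontier[OF less.prems(1) t_in_N t(2)] by metis
      qed
    qed (use less.prems in simp)
  qed
  from this[of "{}"] show ?thesis
    using configuration_empty[of N] reachable_initial[of N] by (simp add: initial_frontier)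
qed

lemma reachable_pairwise_concurrent:
  assumes "reachable N M" "C \<subseteq> set_mset M"
  shows "pairwise_concurrent N C"
proof -
  obtain F where F: "configuration N F" "M = mset_set (frontier N F)"
    using reachable_configuration[OF assms(1)] by blast
  then show ?thesis
    using frontier_pairwise_concurrent[OF F(1)] assms(2) finite_frontier[OF F(1)] by simp
qed

lemma occurrence_net_if_live:
  assumes live: "\<And>t. t \<in> transitions N \<Longrightarrow> \<exists>M. reachable N M \<and> enabled N M t"
  shows "occurrence_net N"
proof -
  have "\<not> conflict N (Inr t) (Inr t)" if t: "t \<in> transitions N" for t
  proof
    assume "conflict N (Inr t) (Inr t)"
    then obtain q t1 t2 where post: "t1 \<in> place_post N q" "t2 \<in> place_post N q" "t1 \<noteq> t2"
        and flow: "(Inr t1, Inr t) \<in> (flow_rel N)\<^sup>*" "(Inr t2, Inr t) \<in> (flow_rel N)\<^sup>*"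
      by (auto simp: conflict_def)
    obtain F where F: "configuration N F" "enabled N (mset_set (frontier N F)) t"
      using live[OF t] reachable_configuration by blast
    then have F': "configuration N (insert t F)"
      using configuration_insert(2) by (simp add: enabled_frontier_iff)
    have "t1 \<in> insert t F" "t2 \<in> insert t F"
      using configuration_flow_closed[OF F' flow(1)] configuration_flow_closed[OF F' flow(2)]
      by auto
    then show False
      using post configuration_conflict_free[OF F', of t1 t2 q] by (simp add: place_post_def)
  qed
  then show ?thesis
    using petri_net count_pre count_post initial finite_initial producer_unique wf_flow
    by (simp add: occurrence_net_def)
qed

definition past_transitions :: "'p set \<Rightarrow> 't set" where
  "past_transitions C = {t \<in> transitions N. \<exists>x \<in> C. (Inr t, Inl x) \<in> (flow_rel N)\<^sup>*}"

lemma place_no_self_conflict: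
  assumes "occurrence_net N" "x \<in> places N"
  shows "\<not> conflict N (Inl x) (Inl x)"
proof
  assume "conflict N (Inl x) (Inl x)"
  then obtain q t1 t2 where post: "t1 \<in> place_post N q" "t2 \<in> place_post N q" "t1 \<noteq> t2"
      and flow: "(Inr t1, Inl x) \<in> (flow_rel N)\<^sup>*" "(Inr t2, Inl x) \<in> (flow_rel N)\<^sup>*"
    by (auto simp: conflict_def)
  have producer: "\<exists>s. s \<in> place_pre N x \<and> (Inr t, Inr s) \<in> (flow_rel N)\<^sup>*"
    if "(Inr t, Inl x) \<in> (flow_rel N)\<^sup>*" for t
    using that by (cases rule: rtranclE) (auto simp: flow_rel_def place_pre_def)
  obtain s where "s \<in> place_pre N x" "(Inr t1, Inr s) \<in> (flow_rel N)\<^sup>*"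
      "(Inr t2, Inr s) \<in> (flow_rel N)\<^sup>*"
    using producer[OF flow(1)] producer[OF flow(2)] producer_unique[OF assms(2)] by metis
  then have "conflict N (Inr s) (Inr s)" "s \<in> transitions N"
    using post by (auto simp: conflict_def place_pre_def)
  then show False using assms(1) by (auto simp: occurrence_net_def)
qed

lemma pairwise_concurrent_no_conflict:
  assumes "occurrence_net N" "pairwise_concurrent N C" "x \<in> C" "y \<in> C"
  shows "\<not> conflict N (Inl x) (Inl y)"
  using assms place_no_self_conflict[OF assms(1), of x]
  by (cases "x = y") (auto simp: pairwise_concurrent_def concurrent_def)

lemma configuration_past_transitions:
  assumes occ: "occurrence_net N" and C: "pairwise_concurrent N C" and "finite (transitions N)"
  shows "configuration N (past_transitions C)"
  unfolding configuration_def
proof (intro conjI ballI allI impI)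
  show "finite (past_transitions C)" using assms(3) by (simp add: past_transitions_def)
next
  fix t q assume t: "t \<in> past_transitions C" and q: "q \<in># pre N t"
  then obtain x where x: "x \<in> C" "(Inr t, Inl x) \<in> (flow_rel N)\<^sup>*"
    by (auto simp: past_transitions_def)
  show "place_pre N q \<subseteq> past_transitions C"
  proof
    fix s assume s: "s \<in> place_pre N q"
    have "(Inr s, Inl q) \<in> flow_rel N" "(Inl q, Inr t) \<in> flow_rel N"
      using s t q by (auto simp: flow_rel_def place_pre_def past_transitions_def)
    then have "(Inr s, Inl x) \<in> (flow_rel N)\<^sup>*" using x(2) by (meson converse_rtrancl_into_rtrancl)
    then show "s \<in> past_transitions C" using s x by (auto simp: past_transitions_def place_pre_def)
  qed
next
  fix q t1 t2
  assume "t1 \<in> past_transitions C" "t2 \<in> past_transitions C" "q \<in># pre N t1" "q \<in># pre N t2"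
  then obtain x y where "x \<in> C" "(Inr t1, Inl x) \<in> (flow_rel N)\<^sup>*"
      "y \<in> C" "(Inr t2, Inl y) \<in> (flow_rel N)\<^sup>*"
      and "t1 \<in> place_post N q" "t2 \<in> place_post N q"
    by (auto simp: past_transitions_def place_post_def)
  then show "t1 = t2"
    using pairwise_concurrent_no_conflict[OF occ C, of x y] unfolding conflict_def by blast
qed (auto simp: past_transitions_def)

lemma subset_frontier_past_transitions:
  assumes C: "pairwise_concurrent N C"
  shows "C \<subseteq> frontier N (past_transitions C)"
proof
  fix x assume x: "x \<in> C"
  have "place_pre N x \<subseteq> past_transitions C"
    using x by (auto simp: past_transitions_def place_pre_def flow_rel_def
        intro!: bexI[of _ x] r_into_rtrancl)
  moreover have "t \<notin> past_transitions C" if t: "t \<in> place_post N x" for t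
  proof
    assume "t \<in> past_transitions C"
    then obtain y where y: "y \<in> C" "(Inr t, Inl y) \<in> (flow_rel N)\<^sup>*"
      by (auto simp: past_transitions_def)
    have "(Inl x, Inr t) \<in> flow_rel N" using t by (auto simp: flow_rel_def place_post_def)
    then have path: "(Inl x, Inl y) \<in> (flow_rel N)\<^sup>+" using y(2) by (meson rtrancl_into_trancl2)
    have "wf ((flow_rel N)\<^sup>+)" using wf_flow by (rule wf_trancl)
    then have "x \<noteq> y" using path by (meson wf_not_refl)
    then show False
      using C x y(1) trancl_into_rtrancl[OF path]
      by (auto simp: pairwise_concurrent_def concurrent_def)
  qed
  moreover have "x \<in> places N" using C x by (auto simp: pairwise_concurrent_def)
  ultimately show "x \<in> frontier N (past_transitions C)" by (auto simp: frontier_def)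
qed

lemma pairwise_concurrent_reachable:
  assumes "occurrence_net N" "pairwise_concurrent N C" "finite (transitions N)"
  shows "\<exists>M. reachable N M \<and> C \<subseteq> set_mset M"
proof -
  note past = configuration_past_transitions[OF assms]
  have "C \<subseteq> set_mset (mset_set (frontier N (past_transitions C)))"
    using subset_frontier_past_transitions[OF assms(2)] finite_frontier[OF past] by simp
  then show ?thesis using configuration_reachable[OF past] by blast
qed

end

section \<open>Bisimulations induced by a marking of plays\<close>

locale play_marking =
  fixes G :: "('p, 't) petri_game"
    and C :: "('r, ('p, 't) action, 's) control_game"
    and \<sigma> :: "('q, 'u, 'p, 't) labelled_net"
    and f :: "('r, ('p, 't) action) controller"
    and mark :: "('p, 't) action list \<Rightarrow> 'q multiset"
  assumes mark_cong: "commute_equiv (action_dom (arena C)) u v \<Longrightarrow> mark u = mark v"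
    and trans_label: "t \<in> transitions \<sigma> \<Longrightarrow> trans_label \<sigma> t \<in> transitions G"
    and mark_Nil: "mark [] = initial \<sigma>"
    and mark_enabled: "consistent C f u \<Longrightarrow> enabled \<sigma> (mark u) t \<Longrightarrow>
      \<exists>x. set x \<inter> observable G = {} \<and> consistent C f (u @ x @ [Tr (trans_label \<sigma> t)]) \<and>
        mark (u @ x @ [Tr (trans_label \<sigma> t)]) = fire \<sigma> (mark u) t"
    and mark_observable: "consistent C f (u @ [a]) \<Longrightarrow> a \<in> observable G \<Longrightarrow>
      \<exists>t. enabled \<sigma> (mark u) t \<and> a = Tr (trans_label \<sigma> t) \<and> mark (u @ [a]) = fire \<sigma> (mark u) t"
    and mark_internal: "consistent C f (u @ [a]) \<Longrightarrow> a \<notin> observable G \<Longrightarrow> mark (u @ [a]) = mark u"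
begin

lemma mark_reachable: "consistent C f u \<Longrightarrow> reachable \<sigma> (mark u)"
proof (induction u rule: rev_induct)
  case Nil
  then show ?case by (simp add: mark_Nil reachable_initial)
next
  case (snoc a u)
  have u: "reachable \<sigma> (mark u)" using snoc.IH[OF consistent_snocD[OF snoc.prems]] .
  show ?case
  proof (cases "a \<in> observable G")
    case True
    then obtain t where "enabled \<sigma> (mark u) t" "mark (u @ [a]) = fire \<sigma> (mark u) t"
      using mark_observable[OF snoc.prems] by blast
    then show ?thesis using u by (simp add: reachable_fire)
  next
    case False
    then show ?thesis using mark_internal[OF snoc.prems] u by simp
  qed
qed

lemma reachable_marked: "reachable \<sigma> M \<Longrightarrow> \<exists>u. consistent C f u \<and> M = mark u"
proof (induction rule: reachable.induct)
  case reachable_initial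
  then show ?case using consistent_Nil mark_Nil by metis
next
  case (reachable_fire M t)
  then show ?case using mark_enabled by metis
qed

definition marks :: "'q multiset \<Rightarrow> ('p, 't) action list set \<Rightarrow> bool" where
  "marks M U \<longleftrightarrow> (\<exists>u. consistent C f u \<and> U = trace (arena C) u \<and> M = mark u)"

lemma marks_trace_iff: "marks M (trace (arena C) u) \<longleftrightarrow> consistent C f u \<and> M = mark u"
  using consistent_commute_equiv[OF commute_equiv_sym] mark_cong
  by (fastforce simp: marks_def trace_eq_iff)

lemma no_internal_step: "\<not> internal_step G \<sigma> M M'"
  using trans_label by (auto simp: internal_step_def strategy_step_def observable_def enabled_def)

lemma marks_strategy_step:
  assumes "marks M (trace (arena C) u)" "strategy_step \<sigma> M a M'"
  shows "\<exists>x. set x \<inter> observable G = {} \<and> marks M' (trace (arena C) (u @ x @ [a]))"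
proof -
  obtain t where t: "enabled \<sigma> (mark u) t" "a = Tr (trans_label \<sigma> t)" "M' = fire \<sigma> (mark u) t"
    using assms by (auto simp: marks_trace_iff strategy_step_def)
  then show ?thesis
    using mark_enabled[OF _ t(1)] assms(1) by (fastforce simp: marks_trace_iff)
qed

lemma marks_observable:
  assumes "marks M (trace (arena C) u)" "consistent C f (u @ [a])" "a \<in> observable G"
  shows "\<exists>M'. strategy_step \<sigma> M a M' \<and> marks M' (trace (arena C) (u @ [a]))"
proof -
  obtain t where "enabled \<sigma> M t" "a = Tr (trans_label \<sigma> t)" "mark (u @ [a]) = fire \<sigma> M t"
    using mark_observable[OF assms(2,3)] assms(1) by (auto simp: marks_trace_iff)
  then have "strategy_step \<sigma> M a (mark (u @ [a]))" by (auto simp: strategy_step_def)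
  then show ?thesis using assms(2) by (auto simp: marks_trace_iff)
qed

lemma marks_internal:
  "marks M (trace (arena C) u) \<Longrightarrow> consistent C f (u @ [a]) \<Longrightarrow> a \<notin> observable G \<Longrightarrow>
     marks M (trace (arena C) (u @ [a]))"
  using mark_internal by (simp add: marks_trace_iff)

theorem bisimilar: "bisimilar G C \<sigma> f"
proof -
  have "bisimulation G C \<sigma> f marks"
    unfolding bisimulation_def Let_def trace_in_controlled_plays_iff
  proof (intro conjI allI impI)
    fix M U assume "marks M U"
    then show "reachable \<sigma> M" "U \<in> controlled_plays C f"
      using mark_reachable by (auto simp: marks_def trace_in_controlled_plays_iff)
  next
    show "marks (initial \<sigma>) (trace (arena C) [])"
      by (simp add: marks_trace_iff consistent_Nil mark_Nil)
  next
    fix M u a M'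
    assume "marks M (trace (arena C) u) \<and> a \<in> observable G \<and> strategy_step \<sigma> M a M'"
    then obtain x where "set x \<inter> observable G = {}" "marks M' (trace (arena C) (u @ x @ [a]))"
      using marks_strategy_step by blast
    then show "\<exists>x y. set x \<inter> observable G = {} \<and> set y \<inter> observable G = {} \<and>
        consistent C f (u @ x @ [a] @ y) \<and> marks M' (trace (arena C) (u @ x @ [a] @ y))"
      by (intro exI[of _ x] exI[of _ "[]"]) (simp add: marks_trace_iff)
  next
    fix M u a assume "marks M (trace (arena C) u) \<and> a \<in> observable G \<and> consistent C f (u @ [a])"
    then show "\<exists>M1 M2 M'. (internal_step G \<sigma>)\<^sup>*\<^sup>* M M1 \<and> strategy_step \<sigma> M1 a M2 \<and>
        (internal_step G \<sigma>)\<^sup>*\<^sup>* M2 M' \<and> marks M' (trace (arena C) (u @ [a]))"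
      using marks_observable by blast
  next
    fix M u a assume "marks M (trace (arena C) u) \<and> a \<notin> observable G \<and> consistent C f (u @ [a])"
    then show "\<exists>M'. (internal_step G \<sigma>)\<^sup>*\<^sup>* M M' \<and> marks M' (trace (arena C) (u @ [a]))"
      using marks_internal by blast
  qed (use no_internal_step in blast)
  then show ?thesis by (auto simp: bisimilar_def)
qed

end

section \<open>Sliced nets\<close>

declare slice_dom.simps [simp del]

lemma sum_singletons_eq_image_mset:
  "finite X \<Longrightarrow> (\<And>x. x \<in> X \<Longrightarrow> g x = {#h x#}) \<Longrightarrow> sum g X = image_mset h (mset_set X)"
  by (induction rule: finite_induct) auto

definition pre_place :: "('p, 't, 'z) net_scheme \<Rightarrow> 't \<Rightarrow> 'p" where
  "pre_place p t = (THE q. pre p t = {#q#})"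

definition post_place :: "('p, 't, 'z) net_scheme \<Rightarrow> 't \<Rightarrow> 'p" where
  "post_place p t = (THE q. post p t = {#q#})"

lemma slice_initial_place: "slice N p \<Longrightarrow> initial p = {#initial_place p#}"
  using size_1_singleton_mset[of "initial p"] by (auto simp: slice_def initial_place_def)

lemma slice_pre_place: "slice N p \<Longrightarrow> t \<in> transitions p \<Longrightarrow> pre p t = {#pre_place p t#}"
  using size_1_singleton_mset[of "pre p t"] by (auto simp: slice_def pre_place_def)

lemma slice_post_place: "slice N p \<Longrightarrow> t \<in> transitions p \<Longrightarrow> post p t = {#post_place p t#}"
  using size_1_singleton_mset[of "post p t"] by (auto simp: slice_def post_place_def)

lemma slice_petri_net: "slice N p \<Longrightarrow> petri_net p"
  by (simp add: slice_def)

locale sliced_net =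
  fixes N :: "('p, 't, 'z) net_scheme" and S :: "('p, 't) net set"
  assumes distribution: "slice_distribution N S"
begin

abbreviation participants :: "('p, 't) action \<Rightarrow> ('p, 't) net set" where
  "participants \<equiv> slice_dom S"

abbreviation past :: "('p, 't) net set \<Rightarrow> ('p, 't) action list \<Rightarrow> ('p, 't) action list" where
  "past \<equiv> causal_past participants"

lemma finite_slices: "finite S"
  using distribution by (simp add: slice_distribution_def)

lemma slice_in_distribution: "p \<in> S \<Longrightarrow> slice N p"
  using distribution by (simp add: slice_distribution_def)

lemma slice_of_place_unique: "q \<in> places p \<Longrightarrow> q \<in> places p' \<Longrightarrow> p \<in> S \<Longrightarrow> p' \<in> S \<Longrightarrow> p = p'"
  using distribution by (auto simp: slice_distribution_def disjoint_family_on_def)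

lemma slice_of_place: "q \<in> places N \<Longrightarrow> \<exists>p \<in> S. q \<in> places p"
  using distribution by (auto simp: slice_distribution_def)

lemma slice_places_subset: "p \<in> S \<Longrightarrow> places p \<subseteq> places N"
  using slice_in_distribution by (simp add: slice_def)

lemma slice_transitions_subset: "p \<in> S \<Longrightarrow> transitions p \<subseteq> transitions N"
  using slice_in_distribution by (simp add: slice_def)

lemma participants_Tr_iff: "p \<in> participants (Tr t) \<longleftrightarrow> p \<in> S \<and> t \<in> transitions p"
  by (simp add: slice_dom.simps)

lemma participants_Commit: "q \<in> places p \<Longrightarrow> p \<in> S \<Longrightarrow> participants (Commit q A) = {p}"
  using slice_of_place_unique by (auto simp: slice_dom.simps)

lemma participants_Clash:
  "participants (Clash q A t1 t2) = participants (Tr t1) \<union> participants (Tr t2)"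
  by (auto simp: slice_dom.simps)

lemma participants_subset: "participants a \<subseteq> S"
  by (cases a) (auto simp: slice_dom.simps)

lemma participants_slice: "p \<in> participants a \<Longrightarrow> p \<in> S"
  using participants_subset by blast

lemma finite_participants [simp]: "finite (participants a)"
  using finite_subset[OF participants_subset finite_slices] .

lemma participants_Tr_nonempty: "t \<in> transitions N \<Longrightarrow> participants (Tr t) \<noteq> {}"
  using distribution by (auto simp: slice_distribution_def slice_dom.simps)

lemma initial_place_in_slice: "p \<in> S \<Longrightarrow> initial_place p \<in> places p"
  using slice_petri_net[OF slice_in_distribution] slice_initial_place[OF slice_in_distribution]
  by (fastforce simp: petri_net_def)

lemma pre_place_in_slice: "p \<in> participants (Tr t) \<Longrightarrow> pre_place p t \<in> places p"
  using slice_petri_net[OF slice_in_distribution] slice_pre_place[OF slice_in_distribution]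
  by (fastforce simp: petri_net_def participants_Tr_iff)

lemma post_place_in_slice: "p \<in> participants (Tr t) \<Longrightarrow> post_place p t \<in> places p"
  using slice_petri_net[OF slice_in_distribution] slice_post_place[OF slice_in_distribution]
  by (fastforce simp: petri_net_def participants_Tr_iff)

lemma pre_eq_pre_places:
  assumes "t \<in> transitions N"
  shows "pre N t = image_mset (\<lambda>p. pre_place p t) (mset_set (participants (Tr t)))"
proof -
  have "pre N t = (\<Sum>p \<in> participants (Tr t). pre p t)"
    using distribution assms by (simp add: slice_distribution_def slice_dom.simps)
  then show ?thesis
    using slice_pre_place[OF slice_in_distribution]
    by (simp add: sum_singletons_eq_image_mset participants_Tr_iff)
qed

lemma post_eq_post_places:
  assumes "t \<in> transitions N"
  shows "post N t = image_mset (\<lambda>p. post_place p t) (mset_set (participants (Tr t)))"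
proof -
  have "post N t = (\<Sum>p \<in> participants (Tr t). post p t)"
    using distribution assms by (simp add: slice_distribution_def slice_dom.simps)
  then show ?thesis
    using slice_post_place[OF slice_in_distribution]
    by (simp add: sum_singletons_eq_image_mset participants_Tr_iff)
qed

lemma initial_eq_initial_places: "initial N = image_mset initial_place (mset_set S)"
  using distribution finite_slices slice_initial_place[OF slice_in_distribution]
  by (simp add: slice_distribution_def sum_singletons_eq_image_mset)

lemma in_pre_iff:
  "t \<in> transitions N \<Longrightarrow> q \<in># pre N t \<longleftrightarrow> (\<exists>p \<in> participants (Tr t). q = pre_place p t)"
  by (auto simp: pre_eq_pre_places)

lemma place_post_pre_place:
  assumes "p \<in> participants (Tr t)"
  shows "t \<in> place_post N (pre_place p t)"
proof -
  have "t \<in> transitions N"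
    using assms slice_transitions_subset by (auto simp: participants_Tr_iff)
  then show ?thesis using in_pre_iff assms by (auto simp: place_post_def)
qed

lemma place_post_participant:
  assumes "p \<in> S" "q \<in> places p" "t \<in> place_post N q"
  shows "p \<in> participants (Tr t)" and "pre_place p t = q"
proof -
  obtain p' where p': "p' \<in> participants (Tr t)" "q = pre_place p' t"
    using assms(3) in_pre_iff by (auto simp: place_post_def)
  then have "p' = p"
    using pre_place_in_slice[OF p'(1)] participants_slice[OF p'(1)] assms(1,2)
    by (intro slice_of_place_unique[of q]) simp_all
  with p' show "p \<in> participants (Tr t)" "pre_place p t = q" by simp_all
qed

definition marking :: "(('p, 't) net \<Rightarrow> 'q) \<Rightarrow> 'q multiset" where
  "marking m = image_mset m (mset_set S)"

lemma in_marking_iff: "x \<in># marking m \<longleftrightarrow> (\<exists>p \<in> S. x = m p)"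
  using finite_slices by (auto simp: marking_def)

lemma in_markingI: "p \<in> S \<Longrightarrow> m p \<in># marking m"
  using finite_slices by (simp add: marking_def)

lemma marking_fire:
  assumes "t \<in> transitions \<sigma>"
    and pre: "pre \<sigma> t = image_mset m (mset_set (participants a))"
    and post: "post \<sigma> t = image_mset m' (mset_set (participants a))"
    and other: "\<And>p. p \<in> S - participants a \<Longrightarrow> m' p = m p"
  shows "enabled \<sigma> (marking m) t" and "fire \<sigma> (marking m) t = marking m'"
proof -
  have S: "mset_set S = mset_set (participants a) + mset_set (S - participants a)"
    using participants_subset[of a] finite_slices
    by (subst mset_set_Union[symmetric]) (auto simp: Un_absorb1)
  show "enabled \<sigma> (marking m) t"
    unfolding enabled_def marking_def pre S using assms(1) by simp
  have "image_mset m' (mset_set (S - participants a)) =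
      image_mset m (mset_set (S - participants a))"
    using other finite_slices by (intro image_mset_cong) simp
  then show "fire \<sigma> (marking m) t = marking m'"
    unfolding marking_def S fire_def pre post by simp
qed

end

section \<open>The control games of a sliced Petri game\<close>

text \<open>The flag \<open>det\<close> selects the game written with a hat.\<close>

locale sliced_game = sliced_net G S
  for G :: "('p, 't) petri_game" and S :: "('p, 't) net set" +
  fixes det :: bool
  assumes petri_game: "petri_game G"
begin

definition slice_game :: "(('p, 't) net, ('p, 't) action, ('p, 't) lstate) control_game" where
  "slice_game = (if det then control_game_det_of G S else control_game_of G S)"

definition clashes :: "('p, 't) action set" where
  "clashes = (if det then clash_actions G else {})"

definition alphabet :: "('p, 't) action set" where
  "alphabet = Tr ` transitions G \<union> commit_actions G \<union> clashes"

definition local_trans ::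
    "('p, 't) net \<Rightarrow> (('p, 't) lstate \<times> ('p, 't) action \<times> ('p, 't) lstate) set" where
  "local_trans p = slice_trans G p \<union> (if det then clash_trans G p else {})"

abbreviation local_state :: "('p, 't) action list \<Rightarrow> ('p, 't) net \<Rightarrow> ('p, 't) lstate" where
  "local_state \<equiv> state (arena slice_game)"

abbreviation play ::
    "(('p, 't) net, ('p, 't) action) controller \<Rightarrow> ('p, 't) action list \<Rightarrow> bool" where
  "play \<equiv> consistent slice_game"

abbreviation play_trace :: "('p, 't) action list \<Rightarrow> ('p, 't) action list set" where
  "play_trace \<equiv> trace (arena slice_game)"

abbreviation slice_view :: "('p, 't) net \<Rightarrow> ('p, 't) action list \<Rightarrow> ('p, 't) action list set" where
  "slice_view \<equiv> view (arena slice_game)"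

lemma arena_slice_game:
  "arena slice_game = parallel_composition S alphabet participants
     (if det then slice_automaton_det G else slice_automaton G)"
  by (simp add: slice_game_def control_game_det_of_def control_game_of_def alphabet_def clashes_def)

lemma slice_game_sel [simp]:
  "processes (arena slice_game) = S" "actions (arena slice_game) = alphabet"
  "action_dom (arena slice_game) = participants"
  "sys_actions slice_game = commit_actions G"
  "env_actions slice_game = Tr ` transitions G \<union> clashes"
  "win_states slice_game = slice_win G"
  by (simp_all add: arena_slice_game)
    (simp_all add: slice_game_def control_game_det_of_def control_game_of_def clashes_def)

lemma start_slice_game: "p \<in> S \<Longrightarrow> start (arena slice_game) p = Place (initial_place p)"
  by (simp add: arena_slice_game slice_automaton_def slice_automaton_det_def)

lemma ltrans_slice_automaton:
  "ltrans ((if det then slice_automaton_det G else slice_automaton G) p) = local_trans p"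
  by (simp add: slice_automaton_def slice_automaton_det_def local_trans_def)

lemma slice_view_eq_past: "slice_view p u = play_trace (past {p} u)"
  by (simp add: view_eq_trace_causal_past)

lemma slice_view_snoc:
  "p \<in> participants a \<Longrightarrow> slice_view p (u @ [a]) = play_trace (past (participants a) u @ [a])"
  by (simp add: slice_view_eq_past causal_past_snoc_participant)

lemma slice_view_snoc_other: "p \<notin> participants a \<Longrightarrow> slice_view p (u @ [a]) = slice_view p u"
  using view_snoc_other[of p "arena slice_game" a u] by simp

subsection \<open>Actions\<close>

lemma finite_game: "finite (places G)" "finite (transitions G)"
  using petri_game unfolding petri_game_def finite_net_def by blast+

lemma sys_places_subset: "sys_places G \<subseteq> places G"
  using petri_game by (auto simp: petri_game_def)

lemma sys_places_disjoint: "sys_places G \<inter> env_places G = {}"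
  using petri_game by (simp add: petri_game_def)

lemma env_place_iff: "q \<in> places G \<Longrightarrow> q \<in> env_places G \<longleftrightarrow> q \<notin> sys_places G"
  using petri_game by (auto simp: petri_game_def)

lemma alphabet_cases:
  assumes "a \<in> alphabet"
  obtains (Tr) t where "a = Tr t" "t \<in> transitions G"
  | (Commit) p q A where "a = Commit q A" "p \<in> S" "q \<in> places p" "q \<in> sys_places G"
      "A \<subseteq> place_post G q" "participants a = {p}" "a \<in> commit_actions G"
  | (Clash) "a \<in> clashes"
proof (cases "a \<in> commit_actions G")
  case True
  then obtain q A where a: "a = Commit q A" "q \<in> sys_places G" "A \<subseteq> place_post G q"
    by (auto simp: commit_actions_def)
  then obtain p where p: "p \<in> S" "q \<in> places p" using slice_of_place sys_places_subset by blast
  show ?thesis using Commit[OF a(1) p a(2,3)] True participants_Commit[OF p(2,1)] a(1) by blast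
next
  case False
  then show ?thesis using assms Tr Clash by (auto simp: alphabet_def)
qed

lemma clashE:
  assumes "a \<in> clashes"
  obtains q A t1 t2 where "det" "a = Clash q A t1 t2" "a \<in> clash_actions G"
    "q \<in> sys_places G" "A \<subseteq> place_post G q" "t1 \<in> A" "t2 \<in> A" "t1 \<noteq> t2"
  using assms by (auto simp: clashes_def clash_actions_def split: if_splits)

lemma participants_nonempty:
  assumes "a \<in> alphabet"
  shows "participants a \<noteq> {}"
  using assms
proof (cases rule: alphabet_cases)
  case Clash
  then obtain q A t1 t2 where "a = Clash q A t1 t2" "t1 \<in> place_post G q" by (elim clashE) blast
  then show ?thesis
    using participants_Tr_nonempty[of t1] by (simp add: participants_Clash place_post_def)
qed (use participants_Tr_nonempty in auto)

lemma participants_commit_action: "a \<in> commit_actions G \<Longrightarrow> \<exists>p. participants a = {p}"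
  using slice_of_place sys_places_subset participants_Commit by (fastforce simp: commit_actions_def)

lemma commit_actions_env_disjoint: "commit_actions G \<inter> (Tr ` transitions G \<union> clashes) = {}"
  by (auto simp: commit_actions_def elim: clashE)

lemma finite_alphabet: "finite alphabet"
proof -
  have fin: "finite (sys_places G)" "finite (transitions G)"
    using finite_game finite_subset[OF sys_places_subset] by auto
  have "commit_actions G \<subseteq> (\<Union>q \<in> sys_places G. Commit q ` Pow (transitions G))"
    by (auto simp: commit_actions_def place_post_def)
  then have "finite (commit_actions G)" by (rule finite_subset) (use fin in simp)
  moreover have "clash_actions G \<subseteq> (\<Union>q \<in> sys_places G. \<Union>A \<in> Pow (transitions G).
      \<Union>t1 \<in> transitions G. Clash q A t1 ` transitions G)"
    unfolding clash_actions_def place_post_def by blast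
  then have "finite (clash_actions G)" by (rule finite_subset) (use fin in simp)
  ultimately show ?thesis using fin by (simp add: alphabet_def clashes_def)
qed

subsection \<open>Local and global steps\<close>

definition ready :: "('p, 't) net \<Rightarrow> 't \<Rightarrow> ('p, 't) lstate \<Rightarrow> bool" where
  "ready p t x \<longleftrightarrow>
     x = Place (pre_place p t) \<and> pre_place p t \<in> env_places G \<or>
     (\<exists>A. x = Committed (pre_place p t) A \<and> pre_place p t \<in> sys_places G \<and>
        A \<subseteq> place_post G (pre_place p t) \<and> t \<in> A)"

lemma local_trans_Tr_iff:
  assumes "p \<in> participants (Tr t)"
  shows "(x, Tr t, y) \<in> local_trans p \<longleftrightarrow> ready p t x \<and> y = Place (post_place p t)"
  using assms slice_pre_place[of G p t] slice_post_place[of G p t] slice_in_distribution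
    pre_place_in_slice[OF assms]
  by (auto simp: local_trans_def slice_trans_def clash_trans_def ready_def participants_Tr_iff)

lemma local_trans_Commit_iff:
  "(x, Commit q A, y) \<in> local_trans p \<longleftrightarrow>
     x = Place q \<and> y = Committed q A \<and> q \<in> places p \<inter> sys_places G \<and> A \<subseteq> place_post G q"
  by (auto simp: local_trans_def slice_trans_def clash_trans_def)

lemma ready_at_place:
  assumes "p \<in> S" "q \<in> places p" "t \<in> place_post G q"
  shows "ready p t x \<longleftrightarrow> x = Place q \<and> q \<in> env_places G \<or>
    (\<exists>A. x = Committed q A \<and> q \<in> sys_places G \<and> A \<subseteq> place_post G q \<and> t \<in> A)"
  using place_post_participant(2)[OF assms] by (simp add: ready_def)

lemma local_trans_ClashD:
  assumes p: "p \<in> participants (Clash q A t1 t2)"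
    and step: "(x, Clash q A t1 t2, y) \<in> local_trans p"
  shows "y = Bot" and "Clash q A t1 t2 \<in> clashes" and "q \<in> places p \<Longrightarrow> x = Committed q A"
    and "t \<in> {t1, t2} \<Longrightarrow> t \<in> transitions p \<Longrightarrow> ready p t x"
proof -
  have p_in_S: "p \<in> S" using p by (rule participants_slice)
  show "y = Bot" and clash: "Clash q A t1 t2 \<in> clashes"
    using step by (auto simp: local_trans_def slice_trans_def clash_trans_def clashes_def
        split: if_splits)
  have cases: "x = Committed q A \<and> q \<in> places p \<or>
      q \<notin> places p \<and> (\<exists>q'. x = Place q' \<and> q' \<in> places p \<inter> env_places G \<and>
        (\<forall>t \<in> {t1, t2}. t \<in> transitions p \<longrightarrow> t \<in> place_post G q')) \<or>
      q \<notin> places p \<and> (\<exists>q' A'. x = Committed q' A' \<and> q' \<in> places p \<inter> sys_places G \<and>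
        A' \<subseteq> place_post G q' \<and> (\<forall>t \<in> {t1, t2}. t \<in> transitions p \<longrightarrow> t \<in> A'))"
    using step by (auto simp: local_trans_def slice_trans_def clash_trans_def split: if_splits)
  then show "x = Committed q A" if "q \<in> places p" using that by blast
  have "q \<in> sys_places G" "A \<subseteq> place_post G q" "t1 \<in> A" "t2 \<in> A" using clash by (auto elim: clashE)
  then show "ready p t x" if "t \<in> {t1, t2}" "t \<in> transitions p"
    using cases that ready_at_place[OF p_in_S] by blast
qed

lemma local_trans_ClashI:
  assumes p: "p \<in> participants (Clash q A t1 t2)" and "Clash q A t1 t2 \<in> clashes"
    and committed: "q \<in> places p \<Longrightarrow> x = Committed q A"
    and ready: "\<And>t. t \<in> {t1, t2} \<Longrightarrow> t \<in> transitions p \<Longrightarrow> ready p t x"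
  shows "(x, Clash q A t1 t2, Bot) \<in> local_trans p"
proof -
  have det and clash: "Clash q A t1 t2 \<in> clash_actions G"
    using assms(2) by (auto elim: clashE)
  have "(x, Clash q A t1 t2, Bot) \<in> clash_trans G p"
  proof (cases "q \<in> places p")
    case True
    then show ?thesis using committed clash by (auto simp: clash_trans_def)
  next
    case False
    obtain t0 where t0: "t0 \<in> {t1, t2}" "p \<in> participants (Tr t0)" "t0 \<in> transitions p"
      using p by (auto simp: participants_Clash participants_Tr_iff)
    define q0 where "q0 = pre_place p t0"
    have q0: "q0 \<in> places p" using pre_place_in_slice[OF t0(2)] by (simp add: q0_def)
    have post: "t \<in> place_post G (pre_place p t)" if "t \<in> transitions p" for t
      using that participants_slice[OF p]
      by (intro place_post_pre_place) (simp add: participants_Tr_iff)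
    have "ready p t0 x" using ready t0 by blast
    then consider (env) "x = Place q0" "q0 \<in> env_places G"
      | (sys) A0 where "x = Committed q0 A0" "q0 \<in> sys_places G" "A0 \<subseteq> place_post G q0"
      by (auto simp: ready_def q0_def)
    then show ?thesis
    proof cases
      case env
      then have "\<forall>t \<in> {t1, t2}. t \<in> transitions p \<longrightarrow> t \<in> place_post G q0"
        using ready post by (auto simp: ready_def)
      then show ?thesis using env q0 False t0 clash unfolding clash_trans_def by blast
    next
      case sys
      then have "\<forall>t \<in> {t1, t2}. t \<in> transitions p \<longrightarrow> t \<in> A0" using ready by (auto simp: ready_def)
      then show ?thesis using sys q0 False t0 clash unfolding clash_trans_def by blast
    qed
  qed
  then show ?thesis unfolding local_trans_def using \<open>det\<close> by simp
qed

lemma local_trans_Clash_iff: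
  assumes p: "p \<in> participants (Clash q A t1 t2)"
  shows "(x, Clash q A t1 t2, y) \<in> local_trans p \<longleftrightarrow>
    y = Bot \<and> Clash q A t1 t2 \<in> clashes \<and> (q \<in> places p \<longrightarrow> x = Committed q A) \<and>
    (\<forall>t \<in> {t1, t2}. t \<in> transitions p \<longrightarrow> ready p t x)" (is "?step \<longleftrightarrow> ?clash")
proof
  assume ?step
  then show ?clash using local_trans_ClashD[OF p] by blast
next
  assume ?clash
  then show ?step using local_trans_ClashI[OF p, of x] by auto
qed

lemma local_trans_Bot: "(Bot, a, y) \<notin> local_trans p"
  by (auto simp: local_trans_def slice_trans_def clash_trans_def)

lemma local_trans_deterministic:
  "p \<in> participants a \<Longrightarrow> (x, a, y) \<in> local_trans p \<Longrightarrow> (x, a, y') \<in> local_trans p \<Longrightarrow> y = y'"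
  by (cases a) (simp_all add: local_trans_Tr_iff local_trans_Commit_iff local_trans_Clash_iff)

lemma global_step_iff:
  "global_step (arena slice_game) s a s' \<longleftrightarrow> a \<in> alphabet \<and>
     (\<forall>p \<in> participants a. (s p, a, s' p) \<in> local_trans p) \<and> (\<forall>p. p \<notin> participants a \<longrightarrow> s' p = s p)"
  unfolding arena_slice_game ltrans_slice_automaton[symmetric]
  by (rule global_step_parallel_composition)
    (unfold ltrans_slice_automaton, rule local_trans_deterministic)

lemma executable_iff:
  "executable (arena slice_game) s a \<longleftrightarrow>
     a \<in> alphabet \<and> (\<forall>p \<in> participants a. \<exists>y. (s p, a, y) \<in> local_trans p)"
proof
  assume a: "a \<in> alphabet \<and> (\<forall>p \<in> participants a. \<exists>y. (s p, a, y) \<in> local_trans p)"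
  then obtain g where "\<forall>p \<in> participants a. (s p, a, g p) \<in> local_trans p" by metis
  then have "global_step (arena slice_game) s a (\<lambda>p. if p \<in> participants a then g p else s p)"
    using a by (simp add: global_step_iff)
  then show "executable (arena slice_game) s a" by (auto simp: executable_def)
qed (auto simp: executable_def global_step_iff)

lemma executable_Tr_iff:
  "executable (arena slice_game) s (Tr t) \<longleftrightarrow>
     t \<in> transitions G \<and> (\<forall>p \<in> participants (Tr t). ready p t (s p))"
  by (auto simp: executable_iff local_trans_Tr_iff alphabet_def commit_actions_def elim: clashE)

lemma executable_Commit_iff:
  assumes "p \<in> S" "q \<in> places p"
  shows "executable (arena slice_game) s (Commit q A) \<longleftrightarrow>
    s p = Place q \<and> q \<in> sys_places G \<and> A \<subseteq> place_post G q"
  using assms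
  by (auto simp: executable_iff local_trans_Commit_iff alphabet_def commit_actions_def
      participants_Commit[OF assms(2,1)] elim: clashE)

lemma executable_Clash_iff:
  assumes p: "p \<in> S" "q \<in> places p"
  shows "executable (arena slice_game) s (Clash q A t1 t2) \<longleftrightarrow>
    Clash q A t1 t2 \<in> clashes \<and> s p = Committed q A \<and>
    (\<forall>t \<in> {t1, t2}. \<forall>r \<in> participants (Tr t). ready r t (s r))"
proof (cases "Clash q A t1 t2 \<in> clashes")
  case True
  let ?parts = "participants (Clash q A t1 t2)"
  have "t1 \<in> place_post G q" using True by (auto elim: clashE)
  then have "p \<in> ?parts" using place_post_participant(1)[OF p] by (simp add: participants_Clash)
  moreover have "q \<in> places r \<longleftrightarrow> r = p" if "r \<in> ?parts" for r
    using slice_of_place_unique[of q r p] participants_slice[OF that] p by blast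
  ultimately have committed: "(\<forall>r \<in> ?parts. q \<in> places r \<longrightarrow> s r = Committed q A) \<longleftrightarrow>
      s p = Committed q A"
    by blast
  have readies: "(\<forall>r \<in> ?parts. \<forall>t \<in> {t1, t2}. t \<in> transitions r \<longrightarrow> ready r t (s r)) \<longleftrightarrow>
      (\<forall>t \<in> {t1, t2}. \<forall>r \<in> participants (Tr t). ready r t (s r))"
    unfolding participants_Clash using participants_Tr_iff by blast
  have "executable (arena slice_game) s (Clash q A t1 t2) \<longleftrightarrow>
      (\<forall>r \<in> ?parts. (q \<in> places r \<longrightarrow> s r = Committed q A) \<and>
        (\<forall>t \<in> {t1, t2}. t \<in> transitions r \<longrightarrow> ready r t (s r)))"
    using True by (simp add: executable_iff local_trans_Clash_iff alphabet_def)
  then show ?thesis using True committed readies by blast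
next
  case False
  then show ?thesis by (auto simp: executable_iff alphabet_def commit_actions_def)
qed

lemma local_state_snoc:
  assumes "runnable (arena slice_game) (u @ [a])" "p \<in> participants a"
  shows "(local_state u p, a, local_state (u @ [a]) p) \<in> local_trans p"
  using global_step_state[OF assms(1)] assms(2) unfolding global_step_iff by blast

lemma local_state_snoc_other:
  "runnable (arena slice_game) (u @ [a]) \<Longrightarrow> p \<notin> participants a \<Longrightarrow>
     local_state (u @ [a]) p = local_state u p"
  using state_snoc_other[of "arena slice_game"] by simp

subsection \<open>Plays consistent with a controller\<close>

lemma play_actions: "play f u \<Longrightarrow> set u \<subseteq> alphabet"
  using set_runnable[OF consistent_runnable, of slice_game f u] by simp

lemma play_Tr_iff:
  assumes "play f u"
  shows "play f (u @ [Tr t]) \<longleftrightarrow>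
    t \<in> transitions G \<and> (\<forall>p \<in> participants (Tr t). ready p t (local_state u p))"
  using assms consistent_runnable[OF assms]
  by (auto simp: consistent_snoc runnable_snoc executable_Tr_iff permits_def)

lemma play_Commit_iff:
  assumes "play f u" "p \<in> S" "q \<in> places p"
  shows "play f (u @ [Commit q A]) \<longleftrightarrow>
    local_state u p = Place q \<and> q \<in> sys_places G \<and> A \<subseteq> place_post G q \<and>
    Commit q A \<in> f p (slice_view p u)"
proof -
  have "Commit q A \<notin> Tr ` transitions G \<union> clashes" by (auto elim: clashE)
  then show ?thesis
    using assms consistent_runnable[OF assms(1)]
    by (auto simp: consistent_snoc runnable_snoc executable_Commit_iff[OF assms(2,3)] permits_def
        commit_actions_def participants_Commit[OF assms(3,2)])
qed

lemma play_Clash_iff: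
  assumes "play f u" "p \<in> S" "q \<in> places p"
  shows "play f (u @ [Clash q A t1 t2]) \<longleftrightarrow>
    Clash q A t1 t2 \<in> clashes \<and> local_state u p = Committed q A \<and>
    (\<forall>t \<in> {t1, t2}. \<forall>r \<in> participants (Tr t). ready r t (local_state u r))"
  using assms consistent_runnable[OF assms(1)]
  by (auto simp: consistent_snoc runnable_snoc executable_Clash_iff[OF assms(2,3)] permits_def)

lemma play_snoc_cases:
  assumes "play f (u @ [a])"
  obtains (Tr) t where "a = Tr t" "t \<in> transitions G"
  | (Commit) p q A where "a = Commit q A" "p \<in> S" "q \<in> places p" "q \<in> sys_places G"
      "A \<subseteq> place_post G q" "participants a = {p}" "a \<in> commit_actions G"
  | (Clash) "a \<in> clashes"
proof -
  have "a \<in> alphabet" using consistent_snoc_action[OF assms] by simp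
  then show thesis using that by (cases rule: alphabet_cases) blast+
qed

lemma local_state_Bot_persists:
  "play f (u @ v) \<Longrightarrow> local_state u p = Bot \<Longrightarrow> local_state (u @ v) p = Bot"
proof (induction v rule: rev_induct)
  case (snoc a v)
  then have run: "runnable (arena slice_game) ((u @ v) @ [a])"
    using consistent_runnable by fastforce
  have "local_state (u @ v) p = Bot"
    using snoc.IH snoc.prems consistent_snocD[of slice_game f "u @ v" a] by simp
  then show ?case
    using local_state_snoc[OF run, of p] local_state_snoc_other[OF run, of p] local_trans_Bot
    by (cases "p \<in> participants a") auto
qed simp

lemma winning_controller_no_clash:
  assumes win: "winning_controller slice_game f" and "a \<in> clashes"
  shows "\<not> play f (u @ [a])"
proof
  assume clash: "play f (u @ [a])"
  obtain p where p: "p \<in> participants a"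
    using participants_nonempty assms(2) by (auto simp: alphabet_def)
  obtain q A t1 t2 where a: "a = Clash q A t1 t2" using assms(2) by (elim clashE)
  have bot: "local_state (u @ [a]) p = Bot"
    using local_state_snoc[OF consistent_runnable[OF clash] p] p unfolding a
    by (simp add: local_trans_Clash_iff)
  obtain v where v: "final_play slice_game f ((u @ [a]) @ v)"
    using final_extension[OF _ clash] win by (auto simp: winning_controller_iff)
  then have "local_state ((u @ [a]) @ v) p = Bot"
    using local_state_Bot_persists[OF _ bot] unfolding final_play_iff by blast
  moreover have "local_state ((u @ [a]) @ v) p \<in> slice_win G p"
    using win v participants_slice[OF p] by (simp add: winning_controller_iff)
  ultimately show False by (auto simp: slice_win_def)
qed

lemma slice_game_single_commitment_restriction:
  "winning_controller slice_game f \<Longrightarrow>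
     \<exists>f'. restricts slice_game f' f \<and> winning_controller slice_game f' \<and>
       single_commitment slice_game f'"
  using participants_commit_action commit_actions_env_disjoint
  by (intro single_commitment_restriction) simp_all

end

section \<open>From strategies to controllers\<close>

lemma image_mset_lift:
  assumes "finite X" "image_mset l Y = image_mset g (mset_set X)"
  shows "\<exists>m. Y = image_mset m (mset_set X) \<and> (\<forall>p \<in> X. l (m p) = g p)"
  using assms
proof (induction X arbitrary: Y rule: finite_induct)
  case (insert x X)
  then have "image_mset l Y = add_mset (g x) (image_mset g (mset_set X))" by simp
  then obtain y Z where Y: "Y = add_mset y Z" "l y = g x"
      "image_mset l Z = image_mset g (mset_set X)"
    using msed_map_invR by metis
  obtain m where m: "Z = image_mset m (mset_set X)" "\<forall>p \<in> X. l (m p) = g p"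
    using insert.IH[OF Y(3)] by blast
  have "image_mset (m(x := y)) (mset_set X) = image_mset m (mset_set X)"
    using insert.hyps by (intro image_mset_cong) auto
  then have "Y = image_mset (m(x := y)) (mset_set (insert x X))"
    using insert.hyps Y(1) m(1) by simp
  moreover have "\<forall>p \<in> insert x X. l ((m(x := y)) p) = g p"
    using insert.hyps Y(2) m(2) by auto
  ultimately show ?case by blast
qed simp

lemma append_invariant:
  assumes "\<And>x a. a \<in> X \<Longrightarrow> g (x @ [a]) = g x" and "set v \<subseteq> X"
  shows "g (u @ v) = g u"
  using assms(2)
proof (induction v rule: rev_induct)
  case (snoc a v)
  then show ?case using assms(1)[of a "u @ v"] by simp
qed simp

locale strategy_controller = sliced_game G S det
  for G :: "('p, 't) petri_game" and S :: "('p, 't) net set" and det :: bool +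
  fixes \<sigma> :: "('q, 'u, 'p, 't) labelled_net"
  assumes winning_strategy: "winning_strategy G \<sigma>"
    and deterministic_strategy: "det \<Longrightarrow> deterministic_strategy G \<sigma>"
begin

abbreviation label :: "'q \<Rightarrow> 'p" where "label \<equiv> place_label \<sigma>"
abbreviation tlabel :: "'u \<Rightarrow> 't" where "tlabel \<equiv> trans_label \<sigma>"

lemma branching_process: "branching_process G \<sigma>"
  using winning_strategy by (simp add: winning_strategy_def strategy_def)

lemma tlabel_transition: "t' \<in> transitions \<sigma> \<Longrightarrow> tlabel t' \<in> transitions G"
  and label_pre: "t' \<in> transitions \<sigma> \<Longrightarrow> image_mset label (pre \<sigma> t') = pre G (tlabel t')"
  and label_post: "t' \<in> transitions \<sigma> \<Longrightarrow> image_mset label (post \<sigma> t') = post G (tlabel t')"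
  and label_initial: "image_mset label (initial \<sigma>) = initial G"
  using branching_process by (auto simp: branching_process_def initial_homomorphism_def)

lemma transition_eqI:
  "t1 \<in> transitions \<sigma> \<Longrightarrow> t2 \<in> transitions \<sigma> \<Longrightarrow> pre \<sigma> t1 = pre \<sigma> t2 \<Longrightarrow>
     tlabel t1 = tlabel t2 \<Longrightarrow> t1 = t2"
  using branching_process unfolding branching_process_def by blast

lemma label_in_pre: "t' \<in> transitions \<sigma> \<Longrightarrow> x \<in># pre \<sigma> t' \<Longrightarrow> label x \<in># pre G (tlabel t')"
  using label_pre[of t'] by (metis imageI set_image_mset)

lemma label_place_post: "t' \<in> place_post \<sigma> x \<Longrightarrow> tlabel t' \<in> place_post G (label x)"
  using label_in_pre[of t' x] tlabel_transition[of t'] by (auto simp: place_post_def)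

sublocale causal_net \<sigma>
proof (rule causal_net_if_occurrence_net)
  show "occurrence_net \<sigma>" using branching_process by (simp add: branching_process_def)
  fix t' assume t': "t' \<in> transitions \<sigma>"
  have "pre G (tlabel t') \<noteq> {#}"
    using participants_Tr_nonempty[OF tlabel_transition[OF t']]
    by (simp add: pre_eq_pre_places[OF tlabel_transition[OF t']] mset_set_empty_iff)
  then show "pre \<sigma> t' \<noteq> {#}" using label_pre[OF t'] by auto
qed

subsection \<open>Tokens\<close>

definition initial_token :: "('p, 't) net \<Rightarrow> 'q" where
  "initial_token = (SOME m. initial \<sigma> = image_mset m (mset_set S) \<and>
     (\<forall>p \<in> S. label (m p) = initial_place p))"

definition transition_from :: "(('p, 't) net \<Rightarrow> 'q) \<Rightarrow> 't \<Rightarrow> 'u" where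
  "transition_from m t = (SOME t'. t' \<in> transitions \<sigma> \<and> tlabel t' = t \<and>
     pre \<sigma> t' = image_mset m (mset_set (participants (Tr t))))"

definition produced_token :: "'u \<Rightarrow> ('p, 't) net \<Rightarrow> 'q" where
  "produced_token t' =
     (SOME m. post \<sigma> t' = image_mset m (mset_set (participants (Tr (tlabel t')))) \<and>
        (\<forall>p \<in> participants (Tr (tlabel t')). label (m p) = post_place p (tlabel t')))"

fun move_token :: "(('p, 't) net \<Rightarrow> 'q) \<Rightarrow> ('p, 't) action \<Rightarrow> ('p, 't) net \<Rightarrow> 'q" where
  "move_token m (Tr t) =
     (\<lambda>p. if p \<in> participants (Tr t) then produced_token (transition_from m t) p else m p)"
| "move_token m (Commit q A) = m"
| "move_token m (Clash q A t1 t2) = m"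

text \<open>\<open>token u p\<close> is the place of \<open>\<sigma>\<close> on which the token of the slice \<open>p\<close> lies after the play \<open>u\<close>.\<close>

definition token :: "('p, 't) action list \<Rightarrow> ('p, 't) net \<Rightarrow> 'q" where
  "token u = foldl move_token initial_token u"

lemma token_snoc: "token (u @ [a]) = move_token (token u) a"
  by (simp add: token_def)

lemma token_snoc_internal: "a \<in> commit_actions G \<union> clashes \<Longrightarrow> token (u @ [a]) = token u"
  by (auto simp: token_snoc commit_actions_def elim: clashE)

lemma token_append_commits: "set x \<subseteq> commit_actions G \<Longrightarrow> token (u @ x) = token u"
  by (rule append_invariant[of "commit_actions G" token]) (simp_all add: token_snoc_internal)

lemma
  shows initial_eq_initial_token: "initial \<sigma> = image_mset initial_token (mset_set S)"
    and label_initial_token: "p \<in> S \<Longrightarrow> label (initial_token p) = initial_place p"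
proof -
  have "\<exists>m. initial \<sigma> = image_mset m (mset_set S) \<and> (\<forall>p \<in> S. label (m p) = initial_place p)"
    using label_initial initial_eq_initial_places finite_slices by (intro image_mset_lift) auto
  from someI_ex[OF this] show "initial \<sigma> = image_mset initial_token (mset_set S)"
    "p \<in> S \<Longrightarrow> label (initial_token p) = initial_place p"
    by (auto simp: initial_token_def)
qed

lemma
  assumes "t' \<in> transitions \<sigma>"
  shows post_eq_produced_token:
      "post \<sigma> t' = image_mset (produced_token t') (mset_set (participants (Tr (tlabel t'))))"
    and label_produced_token:
      "p \<in> participants (Tr (tlabel t')) \<Longrightarrow> label (produced_token t' p) = post_place p (tlabel t')"
proof -
  have "\<exists>m. post \<sigma> t' = image_mset m (mset_set (participants (Tr (tlabel t')))) \<and>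
      (\<forall>p \<in> participants (Tr (tlabel t')). label (m p) = post_place p (tlabel t'))"
    using label_post[OF assms] post_eq_post_places[OF tlabel_transition[OF assms]]
    by (intro image_mset_lift) simp_all
  from someI_ex[OF this]
  show "post \<sigma> t' = image_mset (produced_token t') (mset_set (participants (Tr (tlabel t'))))"
    "p \<in> participants (Tr (tlabel t')) \<Longrightarrow> label (produced_token t' p) = post_place p (tlabel t')"
    unfolding produced_token_def by blast+
qed

lemma transition_from_eq:
  assumes "t' \<in> transitions \<sigma>" "pre \<sigma> t' = image_mset m (mset_set (participants (Tr (tlabel t'))))"
  shows "transition_from m (tlabel t') = t'"
  unfolding transition_from_def
  by (rule some_equality) (use assms transition_eqI in auto)

sublocale token: local_valuation participants token
proof
  fix p a u assume "p \<notin> participants a"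
  then show "token (u @ [a]) p = token u p" unfolding token_snoc by (cases a) auto
next
  fix p a u v
  assume p: "p \<in> participants a" and eq: "\<And>r. r \<in> participants a \<Longrightarrow> token u r = token v r"
  show "token (u @ [a]) p = token (v @ [a]) p"
  proof (cases a)
    case (Tr t)
    have "image_mset (token u) (mset_set (participants (Tr t))) =
        image_mset (token v) (mset_set (participants (Tr t)))"
      using eq Tr by (intro image_mset_cong) simp
    then have "transition_from (token u) t = transition_from (token v) t"
      by (simp only: transition_from_def)
    then show ?thesis using p Tr by (simp add: token_snoc)
  qed (use p eq in \<open>auto simp: token_snoc\<close>)
qed

definition commitment :: "('p, 't) action list \<Rightarrow> ('p, 't) net \<Rightarrow> 't set" where
  "commitment u p = tlabel ` place_post \<sigma> (token u p)"

lemma commitment_subset: "commitment u p \<subseteq> place_post G (label (token u p))"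
  using label_place_post by (auto simp: commitment_def)

definition replay_controller :: "(('p, 't) net, ('p, 't) action) controller" where
  "replay_controller p V =
     {Commit (label (token u p)) (commitment u p) | u. V = play_trace u}
       \<inter> (commit_actions G \<inter> local_actions (arena slice_game) p)"

lemma replay_controller_view_iff:
  assumes "p \<in> S" "q \<in> places p"
  shows "Commit q A \<in> replay_controller p (slice_view p u) \<longleftrightarrow>
    q = label (token u p) \<and> A = commitment u p \<and> q \<in> sys_places G"
proof -
  have token: "token v p = token u p" if "commute_equiv participants (past {p} u) v" for v
    using token.val_cong[OF that] token.val_causal_past[of p "{p}" u] by simp
  have "Commit q A \<in> replay_controller p (slice_view p u) \<longleftrightarrow>
      (\<exists>v. commute_equiv participants (past {p} u) v \<and> q = label (token v p) \<and>
        A = commitment v p) \<and> Commit q A \<in> commit_actions G"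
    using assms participants_Commit[OF assms(2,1)]
    by (auto simp: replay_controller_def slice_view_eq_past trace_eq_iff local_actions_def
        alphabet_def)
  also have "\<dots> \<longleftrightarrow> q = label (token u p) \<and> A = commitment u p \<and> Commit q A \<in> commit_actions G"
    using token by (auto simp: commitment_def)
  also have "\<dots> \<longleftrightarrow> q = label (token u p) \<and> A = commitment u p \<and> q \<in> sys_places G"
    using commitment_subset by (auto simp: commit_actions_def)
  finally show ?thesis .
qed

subsection \<open>Plays that follow the strategy\<close>

definition transition_count :: "('p, 't) action list \<Rightarrow> nat" where
  "transition_count u = length (filter (\<lambda>a. a \<in> range Tr) u)"

lemma transition_count_snoc:
  "transition_count (u @ [Tr t]) = Suc (transition_count u)"
  "a \<in> commit_actions G \<Longrightarrow> transition_count (u @ [a]) = transition_count u"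
  by (auto simp: transition_count_def commit_actions_def)

definition located :: "('p, 't) action list \<Rightarrow> ('p, 't) net \<Rightarrow> bool" where
  "located u p \<longleftrightarrow> label (token u p) \<in> places p \<and>
     (local_state u p = Place (label (token u p)) \<or>
      local_state u p = Committed (label (token u p)) (commitment u p) \<and>
        label (token u p) \<in> sys_places G)"

definition faithful :: "('p, 't) action list \<Rightarrow> bool" where
  "faithful u \<longleftrightarrow>
     (\<exists>F. configuration \<sigma> F \<and> marking (token u) = mset_set (frontier \<sigma> F) \<and>
        card F = transition_count u) \<and>
     (\<forall>p \<in> S. located u p)"

lemma faithful_reachable: "faithful u \<Longrightarrow> reachable \<sigma> (marking (token u))"
  using configuration_reachable by (auto simp: faithful_def)

lemma faithful_label: "faithful u \<Longrightarrow> p \<in> S \<Longrightarrow> label (token u p) \<in> places p"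
  by (simp add: faithful_def located_def)

lemma faithful_local_state:
  "faithful u \<Longrightarrow> p \<in> S \<Longrightarrow> local_state u p = Place (label (token u p)) \<or>
     local_state u p = Committed (label (token u p)) (commitment u p) \<and>
       label (token u p) \<in> sys_places G"
  by (simp add: faithful_def located_def)

lemma located_cong:
  "located u p \<Longrightarrow> token v p = token u p \<Longrightarrow> local_state v p = local_state u p \<Longrightarrow> located v p"
  by (simp add: located_def commitment_def)

lemma inj_on_token:
  assumes "faithful u"
  shows "inj_on (token u) S"
  using faithful_label[OF assms] slice_of_place_unique by (metis inj_onI)

text \<open>No system place refuses \<open>t\<close> if all its participants are ready, so justified refusal applies.\<close>

lemma enabled_if_ready:
  assumes faithful: "faithful u" and t: "t \<in> transitions G"
    and ready: "\<And>p. p \<in> participants (Tr t) \<Longrightarrow> ready p t (local_state u p)"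
  shows "\<exists>t'. enabled \<sigma> (marking (token u)) t' \<and> tlabel t' = t"
proof -
  let ?P = "participants (Tr t)"
  define C where "C = token u ` ?P"
  have C: "mset_set C = image_mset (token u) (mset_set ?P)"
    unfolding C_def using inj_on_subset[OF inj_on_token[OF faithful] participants_subset]
    by (rule image_mset_mset_set[symmetric])
  have at_pre: "label (token u p) = pre_place p t"
    and offered: "pre_place p t \<in> sys_places G \<Longrightarrow> t \<in> commitment u p" if "p \<in> ?P" for p
    using ready[OF that] faithful_local_state[OF faithful participants_slice[OF that]]
      sys_places_disjoint by (auto simp: ready_def)
  have "image_mset label (mset_set C) = image_mset (\<lambda>p. pre_place p t) (mset_set ?P)"
    unfolding C multiset.map_comp using at_pre by (intro image_mset_cong) simp
  then have "image_mset label (mset_set C) = pre G t" by (simp only: pre_eq_pre_places[OF t])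
  moreover have "C \<subseteq> set_mset (marking (token u))"
    using in_markingI participants_slice by (auto simp: C_def)
  then have "pairwise_concurrent \<sigma> C"
    using reachable_pairwise_concurrent[OF faithful_reachable[OF faithful]] by blast
  moreover have "finite C" by (simp add: C_def)
  moreover have "\<not> (\<exists>q \<in> C. label q \<in> sys_places G \<and> t \<notin> tlabel ` place_post \<sigma> q)"
    using at_pre offered by (auto simp: C_def commitment_def)
  moreover have "justified_refusal G \<sigma>"
    using winning_strategy by (simp add: winning_strategy_def strategy_def)
  ultimately obtain t' where t': "t' \<in> transitions \<sigma>" "tlabel t' = t" "pre \<sigma> t' = mset_set C"
    using t unfolding justified_refusal_def by blast
  have "pre \<sigma> t' \<subseteq># marking (token u)"
    unfolding t'(3) C marking_def using participants_subset finite_slices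
    by (intro image_mset_subseteq_mono subset_imp_msubset_mset_set)
  then show ?thesis using t' by (auto simp: enabled_def)
qed

lemma enabled_participant:
  assumes faithful: "faithful u" and en: "enabled \<sigma> (marking (token u)) t'"
    and p: "p \<in> participants (Tr (tlabel t'))"
  shows "label (token u p) = pre_place p (tlabel t')" and "t' \<in> place_post \<sigma> (token u p)"
proof -
  have t': "t' \<in> transitions \<sigma>" and sub: "pre \<sigma> t' \<subseteq># marking (token u)"
    using en by (simp_all add: enabled_def)
  have "pre_place p (tlabel t') \<in># image_mset label (pre \<sigma> t')"
    using label_pre[OF t'] in_pre_iff[OF tlabel_transition[OF t']] p by auto
  then obtain x where x: "x \<in># pre \<sigma> t'" "label x = pre_place p (tlabel t')" by auto
  then obtain p' where p': "p' \<in> S" "x = token u p'"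
    using sub by (meson in_marking_iff mset_subset_eqD)
  then have "p' = p"
    using x(2) pre_place_in_slice[OF p] participants_slice[OF p] faithful_label[OF faithful p'(1)]
    by (intro slice_of_place_unique[of "label x"]) simp_all
  then show "label (token u p) = pre_place p (tlabel t')" "t' \<in> place_post \<sigma> (token u p)"
    using x p' t' by (auto simp: place_post_def)
qed

lemma enabled_pre:
  assumes faithful: "faithful u" and en: "enabled \<sigma> (marking (token u)) t'"
  shows "pre \<sigma> t' = image_mset (token u) (mset_set (participants (Tr (tlabel t'))))"
proof -
  let ?P = "participants (Tr (tlabel t'))"
  have t': "t' \<in> transitions \<sigma>" and sub: "pre \<sigma> t' \<subseteq># marking (token u)"
    using en by (simp_all add: enabled_def)
  have "x \<in> token u ` ?P" if x: "x \<in># pre \<sigma> t'" for x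
  proof -
    obtain p where p: "p \<in> S" "x = token u p" using x sub by (meson in_marking_iff mset_subset_eqD)
    have "tlabel t' \<in> place_post G (label x)"
      using x t' label_place_post by (simp add: place_post_def)
    then show ?thesis
      using place_post_participant(1)[OF p(1) faithful_label[OF faithful p(1)]] p by blast
  qed
  moreover have "token u p \<in># pre \<sigma> t'" if "p \<in> ?P" for p
    using enabled_participant(2)[OF faithful en that] by (simp add: place_post_def)
  ultimately have "set_mset (pre \<sigma> t') = token u ` ?P" by blast
  moreover have "inj_on (token u) ?P"
    using inj_on_token[OF faithful] participants_subset by (rule inj_on_subset)
  ultimately show ?thesis using mset_set_pre[OF t'] by (simp add: image_mset_mset_set)
qed

lemma token_fire:
  assumes faithful: "faithful u" and en: "enabled \<sigma> (marking (token u)) t'"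
  shows "fire \<sigma> (marking (token u)) t' = marking (token (u @ [Tr (tlabel t')]))"
    and "p \<in> participants (Tr (tlabel t')) \<Longrightarrow>
      label (token (u @ [Tr (tlabel t')]) p) = post_place p (tlabel t')"
proof -
  let ?t = "tlabel t'" and ?P = "participants (Tr (tlabel t'))"
  have t': "t' \<in> transitions \<sigma>" using en by (simp add: enabled_def)
  have moved: "token (u @ [Tr ?t]) = (\<lambda>p. if p \<in> ?P then produced_token t' p else token u p)"
    by (simp only: token_snoc move_token.simps
        transition_from_eq[OF t' enabled_pre[OF faithful en]])
  then show "p \<in> ?P \<Longrightarrow> label (token (u @ [Tr ?t]) p) = post_place p ?t"
    using label_produced_token[OF t'] by simp
  have "image_mset (token (u @ [Tr ?t])) (mset_set ?P) =
      image_mset (produced_token t') (mset_set ?P)"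
    unfolding moved by (intro image_mset_cong) simp
  then have "post \<sigma> t' = image_mset (token (u @ [Tr ?t])) (mset_set ?P)"
    using post_eq_produced_token[OF t'] by simp
  then show "fire \<sigma> (marking (token u)) t' = marking (token (u @ [Tr ?t]))"
    by (rule marking_fire(2)[OF t' enabled_pre[OF faithful en]]) (simp add: moved)
qed

lemma faithful_no_clash:
  assumes faithful: "faithful u" and "play f u" and "a \<in> clashes"
  shows "\<not> play f (u @ [a])"
proof
  assume clash: "play f (u @ [a])"
  obtain q A t1 t2 where a: "a = Clash q A t1 t2" "q \<in> sys_places G" "A \<subseteq> place_post G q"
      "t1 \<in> A" "t2 \<in> A" "t1 \<noteq> t2" and det
    using \<open>a \<in> clashes\<close> by (elim clashE)
  obtain p where p: "p \<in> S" "q \<in> places p" using slice_of_place sys_places_subset a(2) by blast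
  have part: "p \<in> participants (Tr t)" "pre_place p t = q" "t \<in> transitions G"
    if "t \<in> {t1, t2}" for t
    using place_post_participant[OF p] a that by (auto simp: place_post_def)
  have "\<exists>t'. enabled \<sigma> (marking (token u)) t' \<and> tlabel t' = t" if "t \<in> {t1, t2}" for t
    using enabled_if_ready[OF faithful part(3)[OF that]] clash that
    unfolding a(1) play_Clash_iff[OF \<open>play f u\<close> p] by blast
  then obtain t1' t2' where t1': "enabled \<sigma> (marking (token u)) t1'" "tlabel t1' = t1"
      and t2': "enabled \<sigma> (marking (token u)) t2'" "tlabel t2' = t2"
    by blast
  have "t1' \<in> place_post \<sigma> (token u p)" "t2' \<in> place_post \<sigma> (token u p)" "label (token u p) = q"
    using enabled_participant[OF faithful t1'(1), of p]
      enabled_participant[OF faithful t2'(1), of p]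
      part t1'(2) t2'(2) by auto
  moreover have "token u p \<in># marking (token u)" using p(1) by (rule in_markingI)
  ultimately have "t1' = t2'"
    using deterministic_strategy[OF \<open>det\<close>] faithful_reachable[OF faithful] a(2) t1'(1) t2'(1)
    unfolding deterministic_strategy_def by blast
  then show False using t1'(2) t2'(2) a by simp
qed

lemma faithful_Nil: "faithful []"
  unfolding faithful_def
proof (intro conjI exI[of _ "{}"] ballI)
  show "configuration \<sigma> {}" by (rule configuration_empty)
  show "marking (token []) = mset_set (frontier \<sigma> {})"
    using initial_frontier initial_eq_initial_token by (simp add: marking_def token_def)
  show "card {} = transition_count []" by (simp add: transition_count_def)
  show "located [] p" if "p \<in> S" for p
    using label_initial_token[OF that] initial_place_in_slice[OF that] start_slice_game[OF that]
    by (simp add: located_def token_def)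
qed

lemma faithful_Tr:
  assumes faithful: "faithful u" and play: "play f (u @ [Tr t])"
  shows "faithful (u @ [Tr t])"
proof -
  note run = consistent_runnable[OF play]
  have "t \<in> transitions G" "\<forall>p \<in> participants (Tr t). ready p t (local_state u p)"
    using play play_Tr_iff[OF consistent_snocD[OF play]] by auto
  then obtain t' where t': "enabled \<sigma> (marking (token u)) t'" "tlabel t' = t"
    using enabled_if_ready[OF faithful] by blast
  note fire = token_fire[OF faithful t'(1), unfolded t'(2)]
  obtain F where F: "configuration \<sigma> F" "marking (token u) = mset_set (frontier \<sigma> F)"
      "card F = transition_count u"
    using faithful by (auto simp: faithful_def)
  have pre: "t' \<in> transitions \<sigma>" "set_mset (pre \<sigma> t') \<subseteq> frontier \<sigma> F"
    using t'(1) enabled_frontier_iff[OF F(1)] F(2) by auto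
  have "configuration \<sigma> (insert t' F)" using configuration_insert(2)[OF F(1) pre] .
  moreover have "marking (token (u @ [Tr t])) = mset_set (frontier \<sigma> (insert t' F))"
    using fire_frontier[OF F(1) pre] fire(1) F(2) by simp
  moreover have "card (insert t' F) = transition_count (u @ [Tr t])"
    using configuration_insert(1)[OF F(1) pre] F configuration_finite[OF F(1)]
    by (simp add: transition_count_snoc)
  moreover have "located (u @ [Tr t]) p" if p: "p \<in> S" for p
  proof (cases "p \<in> participants (Tr t)")
    case True
    then have "local_state (u @ [Tr t]) p = Place (post_place p t)"
      using local_state_snoc[OF run True] by (simp add: local_trans_Tr_iff)
    then show ?thesis using fire(2)[OF True] post_place_in_slice[OF True] by (simp add: located_def)
  next
    case False
    then have "token (u @ [Tr t]) p = token u p" "local_state (u @ [Tr t]) p = local_state u p"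
      using token.val_snoc_other local_state_snoc_other[OF run] by auto
    then show ?thesis using faithful p located_cong by (auto simp: faithful_def)
  qed
  ultimately show ?thesis unfolding faithful_def by blast
qed

lemma faithful_Commit:
  assumes faithful: "faithful u" and play: "play replay_controller (u @ [Commit q A])"
    and r: "r \<in> S" "q \<in> places r" "q \<in> sys_places G" "Commit q A \<in> commit_actions G"
  shows "faithful (u @ [Commit q A])"
proof -
  note run = consistent_runnable[OF play]
  have token: "token (u @ [Commit q A]) = token u" by (simp add: token_snoc)
  have "q = label (token u r)" "A = commitment u r"
    using play play_Commit_iff[OF consistent_snocD[OF play] r(1,2)]
      replay_controller_view_iff[OF r(1,2)] by auto
  then have "located (u @ [Commit q A]) r"
    using local_state_snoc[OF run, of r] participants_Commit[OF r(2,1)] r(2,3)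
    by (simp add: located_def commitment_def token_snoc local_trans_Commit_iff)
  moreover have "located (u @ [Commit q A]) p" if "p \<in> S" "p \<noteq> r" for p
    using faithful that located_cong[of u p] token local_state_snoc_other[OF run, of p]
      participants_Commit[OF r(2,1)] by (simp add: faithful_def)
  ultimately show ?thesis
    using faithful by (auto simp: faithful_def token transition_count_snoc(2)[OF r(4)])
qed

lemma play_faithful: "play replay_controller u \<Longrightarrow> faithful u"
proof (induction u rule: rev_induct)
  case (snoc a u)
  have u: "play replay_controller u" using consistent_snocD[OF snoc.prems] .
  note faithful = snoc.IH[OF u]
  from snoc.prems show ?case
  proof (cases rule: play_snoc_cases)
    case (Tr t)
    then show ?thesis using faithful_Tr[OF faithful] snoc.prems by simp
  next
    case (Commit p q A)
    then show ?thesis using faithful_Commit[OF faithful] snoc.prems by simp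
  next
    case Clash
    then show ?thesis using faithful_no_clash[OF faithful u] snoc.prems by blast
  qed
qed (simp add: faithful_Nil)

lemma play_no_clash: "play replay_controller u \<Longrightarrow> a \<in> clashes \<Longrightarrow> \<not> play replay_controller (u @ [a])"
  using faithful_no_clash play_faithful by blast

subsection \<open>Termination\<close>

definition committed_slices :: "('p, 't) action list \<Rightarrow> ('p, 't) net set" where
  "committed_slices u = {p \<in> S. \<exists>q A. local_state u p = Committed q A}"

lemma finite_committed_slices: "finite (committed_slices u)"
  using finite_slices by (simp add: committed_slices_def)

lemma card_committed_slices_le: "card (committed_slices u) \<le> card S"
  using finite_slices by (auto simp: committed_slices_def intro!: card_mono)

lemma committed_slices_Commit:
  assumes play: "play f (u @ [Commit q A])" and r: "r \<in> S" "q \<in> places r"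
  shows "card (committed_slices (u @ [Commit q A])) = Suc (card (committed_slices u))"
proof -
  note run = consistent_runnable[OF play]
  have "(local_state u r, Commit q A, local_state (u @ [Commit q A]) r) \<in> local_trans r"
    using local_state_snoc[OF run, of r] participants_Commit[OF r(2,1)] by simp
  then have step: "local_state u r = Place q" "local_state (u @ [Commit q A]) r = Committed q A"
    by (simp_all add: local_trans_Commit_iff)
  moreover have "local_state (u @ [Commit q A]) p = local_state u p" if "p \<noteq> r" for p
    using local_state_snoc_other[OF run, of p] participants_Commit[OF r(2,1)] that by simp
  ultimately have
    "p \<in> committed_slices (u @ [Commit q A]) \<longleftrightarrow> p \<in> insert r (committed_slices u)" for p
    using r(1) by (cases "p = r") (auto simp: committed_slices_def)
  then have "committed_slices (u @ [Commit q A]) = insert r (committed_slices u)" by blast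
  moreover have "r \<notin> committed_slices u" using step(1) by (simp add: committed_slices_def)
  ultimately show ?thesis using finite_committed_slices by simp
qed

text \<open>A commitment increases the number of committed slices; a transition may reset it to zero, but
  every transition of \<open>\<sigma>\<close> occurs at most once.\<close>

lemma play_length_le:
  "play replay_controller u \<Longrightarrow>
     length u \<le> transition_count u * (card S + 1) + card (committed_slices u)"
proof (induction u rule: rev_induct)
  case (snoc a u)
  have u: "play replay_controller u" using consistent_snocD[OF snoc.prems] .
  note IH = snoc.IH[OF u]
  from snoc.prems show ?case
  proof (cases rule: play_snoc_cases)
    case (Tr t)
    then show ?thesis using IH card_committed_slices_le[of u] by (simp add: transition_count_snoc)
  next
    case (Commit p q A)
    have "card (committed_slices (u @ [a])) = Suc (card (committed_slices u))"
      using committed_slices_Commit[OF _ Commit(2,3)] snoc.prems Commit(1) by simp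
    then show ?thesis using IH Commit(7) by (simp add: transition_count_snoc(2))
  next
    case Clash
    then show ?thesis using play_no_clash[OF u] snoc.prems by blast
  qed
qed (simp add: transition_count_def)

lemma transition_count_le:
  assumes "play replay_controller u"
  shows "transition_count u \<le> card (transitions \<sigma>)"
proof -
  obtain F where "configuration \<sigma> F" "card F = transition_count u"
    using play_faithful[OF assms] by (auto simp: faithful_def)
  moreover have "finite (transitions \<sigma>)"
    using winning_strategy by (simp add: winning_strategy_def finite_net_def)
  ultimately show ?thesis by (metis card_mono configuration_subset)
qed

lemma terminating: "terminating slice_game replay_controller"
proof (rule terminating_if_bounded)
  fix u assume u: "play replay_controller u"
  have "transition_count u * (card S + 1) \<le> card (transitions \<sigma>) * (card S + 1)"
    using transition_count_le[OF u] by (rule mult_le_mono1)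
  then show "length u \<le> card (transitions \<sigma>) * (card S + 1) + card S"
    using play_length_le[OF u] card_committed_slices_le[of u] by simp
qed

subsection \<open>The replaying controller wins and is bisimilar to the strategy\<close>

lemma saturated_committed:
  assumes sat: "saturated slice_game replay_controller u"
    and p: "p \<in> S" and sys: "label (token u p) \<in> sys_places G"
  shows "local_state u p = Committed (label (token u p)) (commitment u p)"
proof (rule ccontr)
  note play = saturated_consistent[OF sat]
  note faithful = play_faithful[OF play]
  let ?c = "Commit (label (token u p)) (commitment u p)"
  assume "local_state u p \<noteq> Committed (label (token u p)) (commitment u p)"
  then have "local_state u p = Place (label (token u p))"
    using faithful_local_state[OF faithful p] by blast
  then have "play replay_controller (u @ [?c])"
    using faithful_label[OF faithful p] p sys commitment_subset
    by (simp add: play_Commit_iff[OF play] replay_controller_view_iff)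
  moreover have "?c \<in> commit_actions G"
    using sys commitment_subset by (auto simp: commit_actions_def)
  ultimately show False using sat by (simp add: saturated_def)
qed

lemma saturated_ready:
  assumes sat: "saturated slice_game replay_controller u"
    and en: "enabled \<sigma> (marking (token u)) t'" and p: "p \<in> participants (Tr (tlabel t'))"
  shows "ready p (tlabel t') (local_state u p)"
proof -
  note faithful = play_faithful[OF saturated_consistent[OF sat]]
  have p_in_S: "p \<in> S" using p by (rule participants_slice)
  note at_pre = enabled_participant[OF faithful en p]
  show ?thesis
  proof (cases "label (token u p) \<in> sys_places G")
    case True
    then show ?thesis
      using saturated_committed[OF sat p_in_S True] at_pre commitment_subset[of u p]
      by (auto simp: ready_def commitment_def)
  next
    case False
    then have "label (token u p) \<in> env_places G"
      using env_place_iff faithful_label[OF faithful p_in_S] slice_places_subset[OF p_in_S] by blast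
    then show ?thesis
      using False faithful_local_state[OF faithful p_in_S] at_pre by (simp add: ready_def)
  qed
qed

lemma enabled_play:
  assumes play: "play replay_controller u" and en: "enabled \<sigma> (marking (token u)) t'"
  shows "\<exists>x. set x \<inter> observable G = {} \<and> play replay_controller (u @ x @ [Tr (tlabel t')]) \<and>
    marking (token (u @ x @ [Tr (tlabel t')])) = fire \<sigma> (marking (token u)) t'"
proof -
  obtain x where x: "set x \<subseteq> commit_actions G"
    and sat: "saturated slice_game replay_controller (u @ x)"
    using saturated_extension[OF terminating play] by auto
  note play' = saturated_consistent[OF sat]
  have token: "token (u @ x) = token u" using token_append_commits[OF x] .
  have en': "enabled \<sigma> (marking (token (u @ x))) t'" using en token by simp
  have "tlabel t' \<in> transitions G" using en tlabel_transition by (simp add: enabled_def)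
  then have "play replay_controller ((u @ x) @ [Tr (tlabel t')])"
    using play_Tr_iff[OF play'] saturated_ready[OF sat en'] by blast
  moreover have "marking (token ((u @ x) @ [Tr (tlabel t')])) = fire \<sigma> (marking (token u)) t'"
    using token_fire(1)[OF play_faithful[OF play'] en'] token by simp
  moreover have "set x \<inter> observable G = {}"
    using x by (auto simp: observable_def commit_actions_def)
  ultimately show ?thesis by auto
qed

lemma play_Tr_enabled:
  assumes "play replay_controller (u @ [Tr t])"
  shows "\<exists>t'. enabled \<sigma> (marking (token u)) t' \<and> tlabel t' = t \<and>
    marking (token (u @ [Tr t])) = fire \<sigma> (marking (token u)) t'"
proof -
  have u: "play replay_controller u" using consistent_snocD[OF assms] .
  then have "t \<in> transitions G" "\<forall>p \<in> participants (Tr t). ready p t (local_state u p)"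
    using assms play_Tr_iff[OF u] by auto
  then obtain t' where t': "enabled \<sigma> (marking (token u)) t'" "tlabel t' = t"
    using enabled_if_ready[OF play_faithful[OF u]] by blast
  then show ?thesis using token_fire(1)[OF play_faithful[OF u] t'(1)] by auto
qed

sublocale play_marking G slice_game \<sigma> replay_controller "\<lambda>u. marking (token u)"
proof
  show "marking (token u) = marking (token v)"
    if "commute_equiv (action_dom (arena slice_game)) u v" for u v
    using token.val_cong that by simp
  show "marking (token []) = initial \<sigma>"
    using initial_eq_initial_token by (simp add: marking_def token_def)
  show "\<exists>t. enabled \<sigma> (marking (token u)) t \<and> a = Tr (tlabel t) \<and>
      marking (token (u @ [a])) = fire \<sigma> (marking (token u)) t"
    if "play replay_controller (u @ [a])" "a \<in> observable G" for u a
    using that play_Tr_enabled by (fastforce simp: observable_def)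
  show "marking (token (u @ [a])) = marking (token u)"
    if "play replay_controller (u @ [a])" "a \<notin> observable G" for u a
    using that(2) consistent_snoc_action[OF that(1)] token_snoc_internal
    by (auto simp: alphabet_def observable_def)
qed (use tlabel_transition enabled_play in auto)

lemma final_play_final_marking:
  assumes "final_play slice_game replay_controller u"
  shows "final_marking \<sigma> (marking (token u))"
  unfolding final_marking_def
proof (intro allI notI)
  fix t' assume "enabled \<sigma> (marking (token u)) t'"
  then obtain x where "play replay_controller (u @ x @ [Tr (tlabel t')])"
    using enabled_play assms by (fastforce simp: final_play_iff)
  moreover obtain b y where "x @ [Tr (tlabel t')] = b # y" by (cases x) auto
  ultimately have "play replay_controller ((u @ [b]) @ y)" by simp
  then have "play replay_controller (u @ [b])" by (rule consistent_appendD)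
  then show False using assms by (simp add: final_play_iff)
qed

theorem winning_replay_controller: "winning_controller slice_game replay_controller"
  unfolding winning_controller_iff
proof (intro conjI allI impI ballI)
  show "controller slice_game replay_controller"
    by (auto simp: controller_def replay_controller_def)
  show "terminating slice_game replay_controller" by (rule terminating)
  fix u p
  assume final: "final_play slice_game replay_controller u" and "p \<in> processes (arena slice_game)"
  then have p: "p \<in> S" and faithful: "faithful u"
    using play_faithful by (auto simp: final_play_iff)
  have "token u p \<in># marking (token u)" using p by (rule in_markingI)
  then have "label (token u p) \<in> win_places G"
    using winning_strategy faithful_reachable[OF faithful] final_play_final_marking[OF final]
    unfolding winning_strategy_def by blast
  then show "local_state u p \<in> win_states slice_game p"
    using faithful_label[OF faithful p] faithful_local_state[OF faithful p] commitment_subset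
    by (auto simp: slice_win_def)
qed

theorem single_commitment_replay_controller: "single_commitment slice_game replay_controller"
  unfolding single_commitment_iff
proof (intro allI ballI impI)
  fix u p a b
  assume "a \<in> sys_actions slice_game" "b \<in> sys_actions slice_game"
    and both: "p \<in> action_dom (arena slice_game) a \<and> p \<in> action_dom (arena slice_game) b \<and>
      play replay_controller (u @ [a]) \<and> play replay_controller (u @ [b])"
  then obtain q A q' A' where commits: "a = Commit q A" "b = Commit q' A'"
    by (auto simp: commit_actions_def)
  have p: "p \<in> S" "q \<in> places p" "q' \<in> places p" using both commits by (auto simp: slice_dom.simps)
  have u: "play replay_controller u" using both by (simp add: consistent_snoc)
  show "a = b"
    using both commits play_Commit_iff[OF u p(1,2)] play_Commit_iff[OF u p(1,3)]
      replay_controller_view_iff[OF p(1,2)] replay_controller_view_iff[OF p(1,3)] by auto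
qed

end

section \<open>From controllers to strategies\<close>

type_synonym ('p, 't) node = "'p \<times> ('p, 't) action list set"
type_synonym ('p, 't) event = "'t \<times> ('p, 't) node set \<times> ('p, 't) action list set"

definition trace_length :: "'a list set \<Rightarrow> nat" where
  "trace_length V = length (SOME w. w \<in> V)"

lemma trace_length_trace: "trace_length (trace A w) = length w"
proof -
  have "w \<in> trace A w" by (simp add: trace_def trace_equiv_def)
  then have "(SOME v. v \<in> trace A w) \<in> trace A w" by (rule someI)
  then show ?thesis
    using commute_equiv_length by (fastforce simp: trace_length_def trace_def trace_equiv_def)
qed

subsection \<open>Nodes and commitments\<close>

locale single_winning_controller = sliced_game G S det
  for G :: "('p, 't) petri_game" and S :: "('p, 't) net set" and det :: bool +
  fixes f :: "(('p, 't) net, ('p, 't) action) controller"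
  assumes winning_controller: "winning_controller slice_game f"
    and single_commitment: "single_commitment slice_game f"
begin

lemma terminating: "terminating slice_game f"
  using winning_controller by (simp add: winning_controller_iff)

lemma no_clash: "a \<in> clashes \<Longrightarrow> \<not> play f (u @ [a])"
  using winning_controller by (rule winning_controller_no_clash)

fun rev_node :: "('p, 't) action list \<Rightarrow> ('p, 't) net \<Rightarrow> ('p, 't) node" where
  "rev_node [] p = (initial_place p, slice_view p [])"
| "rev_node (Tr t # u) p =
     (if p \<in> participants (Tr t) then (post_place p t, slice_view p (rev u @ [Tr t]))
      else rev_node u p)"
| "rev_node (Commit q A # u) p = rev_node u p"
| "rev_node (Clash q A t1 t2 # u) p = rev_node u p"

text \<open>\<open>node u p\<close> is the place of the strategy on which the token of the slice \<open>p\<close> lies after the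
  play \<open>u\<close>: its label together with the view of \<open>p\<close> right after the last transition of \<open>p\<close>, that
  is, without the commitment that \<open>p\<close> may have made since.\<close>

definition node :: "('p, 't) action list \<Rightarrow> ('p, 't) net \<Rightarrow> ('p, 't) node" where
  "node u = rev_node (rev u)"

abbreviation node_place :: "('p, 't) action list \<Rightarrow> ('p, 't) net \<Rightarrow> 'p" where
  "node_place u p \<equiv> fst (node u p)"

abbreviation node_view :: "('p, 't) action list \<Rightarrow> ('p, 't) net \<Rightarrow> ('p, 't) action list set" where
  "node_view u p \<equiv> snd (node u p)"

lemma node_Nil: "node [] p = (initial_place p, slice_view p [])"
  by (simp add: node_def)

lemma node_Tr:
  "p \<in> participants (Tr t) \<Longrightarrow> node (u @ [Tr t]) p = (post_place p t, slice_view p (u @ [Tr t]))"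
  by (simp add: node_def)

lemma node_Tr_other: "p \<notin> participants (Tr t) \<Longrightarrow> node (u @ [Tr t]) p = node u p"
  by (simp add: node_def)

lemma node_Commit: "node (u @ [Commit q A]) = node u"
  by (rule ext) (simp add: node_def)

lemma node_Clash: "node (u @ [Clash q A t1 t2]) = node u"
  by (rule ext) (simp add: node_def)

lemma node_snoc_internal: "a \<notin> range Tr \<Longrightarrow> node (u @ [a]) = node u"
  by (cases a) (simp_all add: node_Commit node_Clash)

lemma node_append_commits: "set x \<subseteq> commit_actions G \<Longrightarrow> node (u @ x) = node u"
  by (rule append_invariant[of "commit_actions G" node])
    (auto intro: node_snoc_internal simp: commit_actions_def)

sublocale node: local_valuation participants node
proof
  fix p a u assume "p \<notin> participants a"
  then show "node (u @ [a]) p = node u p"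
    by (cases a) (simp_all add: node_Tr_other node_Commit node_Clash)
next
  fix p a u v
  assume p: "p \<in> participants a" and eq: "\<And>r. r \<in> participants a \<Longrightarrow> node u r = node v r"
    and past: "commute_equiv participants (past (participants a) u) (past (participants a) v)"
  have "slice_view p (u @ [a]) = slice_view p (v @ [a])"
    using p commute_equiv_append_right[OF past, of "[a]"]
    by (simp add: slice_view_snoc trace_eq_iff)
  then show "node (u @ [a]) p = node (v @ [a]) p"
    using p eq[OF p] by (cases a) (simp_all add: node_Tr node_Commit node_Clash)
qed

lemma node_origin:
  "play f u \<Longrightarrow>
     node u p = node [] p \<or>
     (\<exists>w t. play f (w @ [Tr t]) \<and> p \<in> participants (Tr t) \<and> node u p = node (w @ [Tr t]) p)"
proof (induction u rule: rev_induct)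
  case (snoc a u)
  note IH = snoc.IH[OF consistent_snocD[OF snoc.prems]]
  show ?case
  proof (cases "\<exists>t. a = Tr t \<and> p \<in> participants a")
    case True
    then show ?thesis using snoc.prems by blast
  next
    case False
    then have "node (u @ [a]) p = node u p"
      by (cases a) (simp_all add: node_Tr_other node_Commit node_Clash)
    then show ?thesis using IH by simp
  qed
qed simp

lemma node_place_in_slice: "play f u \<Longrightarrow> p \<in> S \<Longrightarrow> node_place u p \<in> places p"
  using node_origin[of u p] initial_place_in_slice post_place_in_slice
  by (auto simp: node_Nil node_Tr)

definition uncommitted :: "('p, 't) action list \<Rightarrow> ('p, 't) net \<Rightarrow> bool" where
  "uncommitted u p \<longleftrightarrow>
     local_state u p = Place (node_place u p) \<and> slice_view p u = node_view u p"

definition committed :: "'t set \<Rightarrow> ('p, 't) action list \<Rightarrow> ('p, 't) net \<Rightarrow> bool" where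
  "committed A u p \<longleftrightarrow>
     local_state u p = Committed (node_place u p) A \<and>
     (\<exists>v. past {p} u = v @ [Commit (node_place u p) A] \<and> play_trace v = node_view u p) \<and>
     node_place u p \<in> sys_places G \<and> A \<subseteq> place_post G (node_place u p) \<and>
     Commit (node_place u p) A \<in> f p (node_view u p)"

lemma uncommitted_Nil: "p \<in> S \<Longrightarrow> uncommitted [] p"
  by (simp add: uncommitted_def node_Nil start_slice_game)

lemma uncommitted_Tr:
  assumes "play f (u @ [Tr t])" "p \<in> participants (Tr t)"
  shows "uncommitted (u @ [Tr t]) p"
  using local_state_snoc[OF consistent_runnable[OF assms(1)] assms(2)] assms(2)
  by (simp add: uncommitted_def node_Tr local_trans_Tr_iff)

lemma uncommitted_snoc_other:
  "play f (u @ [a]) \<Longrightarrow> p \<notin> participants a \<Longrightarrow> uncommitted (u @ [a]) p \<longleftrightarrow> uncommitted u p"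
  using consistent_runnable[of slice_game f "u @ [a]"] node.val_snoc_other[of p a u]
  by (simp add: uncommitted_def local_state_snoc_other slice_view_snoc_other)

lemma committed_snoc_other:
  "play f (u @ [a]) \<Longrightarrow> p \<notin> participants a \<Longrightarrow> committed A (u @ [a]) p \<longleftrightarrow> committed A u p"
  using consistent_runnable[of slice_game f "u @ [a]"] node.val_snoc_other[of p a u]
  by (simp add: committed_def local_state_snoc_other causal_past_snoc_other)

lemma committed_Commit:
  assumes play: "play f (u @ [Commit q A])" and p: "p \<in> S" "q \<in> places p"
    and "uncommitted u p"
  shows "committed A (u @ [Commit q A]) p"
proof -
  note commit = play[unfolded play_Commit_iff[OF consistent_snocD[OF play] p]]
  have parts: "participants (Commit q A) = {p}" using participants_Commit p by simp
  have "local_state (u @ [Commit q A]) p = Committed q A"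
    using local_state_snoc[OF consistent_runnable[OF play], of p] parts
    by (simp add: local_trans_Commit_iff)
  moreover have "past {p} (u @ [Commit q A]) = past {p} u @ [Commit q A]"
    using causal_past_snoc_participant[of p participants "Commit q A" u] parts by simp
  ultimately show ?thesis
    using commit assms(4)
    by (simp add: committed_def uncommitted_def node_Commit slice_view_eq_past)
qed

lemma commitment_cases: "play f u \<Longrightarrow> p \<in> S \<Longrightarrow> uncommitted u p \<or> (\<exists>A. committed A u p)"
proof (induction u rule: rev_induct)
  case (snoc a u)
  note u = consistent_snocD[OF snoc.prems(1)]
  note IH = snoc.IH[OF u snoc.prems(2)]
  show ?case
  proof (cases "p \<in> participants a")
    case True
    from snoc.prems(1) show ?thesis
    proof (cases rule: play_snoc_cases)
      case (Tr t)
      then show ?thesis using uncommitted_Tr snoc.prems(1) True by blast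
    next
      case (Commit r q A)
      then have r: "r = p" using True by simp
      have "local_state u p = Place q"
        using snoc.prems(1) play_Commit_iff[OF u] Commit r by simp
      then have "uncommitted u p" using IH by (auto simp: committed_def)
      then show ?thesis using committed_Commit snoc.prems(1) Commit r by blast
    next
      case Clash
      then show ?thesis using no_clash snoc.prems(1) by blast
    qed
  next
    case False
    then show ?thesis
      using IH uncommitted_snoc_other[OF snoc.prems(1)] committed_snoc_other[OF snoc.prems(1)]
      by blast
  qed
qed (simp add: uncommitted_Nil)

lemma uncommitted_witness:
  assumes "play f u" "p \<in> S"
  shows "\<exists>w. play f w \<and> node w p = node u p \<and> uncommitted w p"
  using node_origin[OF assms(1), of p] consistent_Nil uncommitted_Nil[OF assms(2)] uncommitted_Tr
  by metis

lemma ready_node_place: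
  "play f u \<Longrightarrow> p \<in> S \<Longrightarrow> ready p t (local_state u p) \<Longrightarrow> node_place u p = pre_place p t"
  using commitment_cases[of u p] by (auto simp: ready_def uncommitted_def committed_def)

lemma play_Commit_if_committed:
  assumes "play f u" "p \<in> S" "uncommitted u p" "committed A w p" "node u p = node w p"
  shows "play f (u @ [Commit (node_place u p) A])"
  using assms play_Commit_iff[OF assms(1,2) node_place_in_slice[OF assms(1,2)]]
  by (simp add: uncommitted_def committed_def)

text \<open>This is where single commitment is used: a node determines the commitment made there.\<close>

lemma committed_unique:
  assumes u: "play f u" "committed A u p" and v: "play f v" "committed B v p"
    and p: "p \<in> S" "node u p = node v p"
  shows "A = B"
proof -
  obtain w where w: "play f w" "node w p = node u p" "uncommitted w p"
    using uncommitted_witness[OF u(1) p(1)] by blast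
  let ?q = "node_place w p"
  have q: "?q \<in> places p" using node_place_in_slice[OF w(1) p(1)] .
  have "play f (w @ [Commit ?q A])" "play f (w @ [Commit ?q B])"
    using play_Commit_if_committed[OF w(1) p(1) w(3) u(2)]
      play_Commit_if_committed[OF w(1) p(1) w(3) v(2)] w(2) p(2) by simp_all
  moreover have "Commit ?q A \<in> commit_actions G" "Commit ?q B \<in> commit_actions G"
    using u(2) v(2) w(2) p(2) by (auto simp: committed_def commit_actions_def)
  moreover have "p \<in> participants (Commit ?q C)" for C using participants_Commit[OF q p(1)] by simp
  ultimately have "Commit ?q A = Commit ?q B"
    using single_commitment unfolding single_commitment_iff slice_game_sel by blast
  then show ?thesis by simp
qed

lemma local_state_eq_if_node_eq:
  assumes u: "play f u" "ready p t (local_state u p)"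
    and v: "play f v" "saturated slice_game f v \<or> ready p t (local_state v p)"
    and p: "p \<in> S" "node u p = node v p"
  shows "local_state v p = local_state u p"
proof -
  have q: "node_place u p = pre_place p t" using ready_node_place[OF u(1) p(1) u(2)] .
  from commitment_cases[OF u(1) p(1)] consider
    (uncommitted) "uncommitted u p" | (committed) A where "committed A u p" by blast
  then show ?thesis
  proof cases
    case uncommitted
    then have "pre_place p t \<notin> sys_places G"
      using u(2) q sys_places_disjoint by (auto simp: uncommitted_def ready_def)
    then have "uncommitted v p"
      using commitment_cases[OF v(1) p(1)] p(2) q by (auto simp: committed_def)
    then show ?thesis using uncommitted p(2) by (simp add: uncommitted_def)
  next
    case (committed A)
    then have sys: "pre_place p t \<in> sys_places G" "A \<subseteq> place_post G (pre_place p t)"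
      using q by (auto simp: committed_def)
    have "\<not> uncommitted v p"
    proof
      assume v_uncommitted: "uncommitted v p"
      then have "play f (v @ [Commit (pre_place p t) A])"
        using play_Commit_if_committed[OF v(1) p(1) _ committed] p(2) q by simp
      moreover have "\<not> ready p t (local_state v p)"
        using v_uncommitted sys(1) sys_places_disjoint by (auto simp: uncommitted_def ready_def)
      ultimately show False using v(2) sys by (auto simp: saturated_def commit_actions_def)
    qed
    then obtain B where B: "committed B v p" using commitment_cases[OF v(1) p(1)] by blast
    have "A = B" using committed_unique[OF u(1) committed v(1) B p] .
    then show ?thesis using committed B p(2) by (simp add: committed_def)
  qed
qed

lemma slice_view_eq_if_node_eq:
  assumes u: "play f u" and v: "play f v" and p: "p \<in> S" "node u p = node v p"
    and state: "local_state u p = local_state v p"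
  shows "slice_view p u = slice_view p v"
proof (cases "uncommitted u p")
  case True
  then have "uncommitted v p"
    using commitment_cases[OF v p(1)] state by (auto simp: uncommitted_def committed_def)
  then show ?thesis using True p(2) by (simp add: uncommitted_def)
next
  case False
  then obtain A where A: "committed A u p" using commitment_cases[OF u p(1)] by blast
  then have "committed A v p"
    using commitment_cases[OF v p(1)] state by (auto simp: uncommitted_def committed_def)
  with A obtain x y where pasts: "past {p} u = x @ [Commit (node_place u p) A]"
      "past {p} v = y @ [Commit (node_place u p) A]" "play_trace x = play_trace y"
    using p(2) by (auto simp: committed_def)
  then have "commute_equiv participants x y" by (simp add: trace_eq_iff)
  then show ?thesis
    unfolding slice_view_eq_past pasts(1,2) by (simp add: trace_eq_iff commute_equiv_append_right)
qed

lemma play_trace_past_eq_if_node_eq: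
  assumes u: "play f u" and v: "play f v" and t: "t \<in> transitions G"
    and eq: "\<And>p. p \<in> participants (Tr t) \<Longrightarrow>
      node u p = node v p \<and> local_state u p = local_state v p"
  shows "play_trace (past (participants (Tr t)) u @ [Tr t]) =
    play_trace (past (participants (Tr t)) v @ [Tr t])"
proof -
  have "commute_equiv participants (past (participants (Tr t)) u) (past (participants (Tr t)) v)"
  proof (rule commute_equiv_causal_past_join)
    show "participants (Tr t) \<noteq> {}" using participants_Tr_nonempty[OF t] .
    show "participants a \<noteq> {}" if "a \<in> set u \<union> set v" for a
      using that play_actions u v by (intro participants_nonempty) blast
    show "commute_equiv participants (past {p} u) (past {p} v)" if "p \<in> participants (Tr t)" for p
      using slice_view_eq_if_node_eq[OF u v participants_slice[OF that]] eq[OF that]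
      by (simp add: slice_view_eq_past trace_eq_iff)
  qed simp
  then show ?thesis by (simp add: trace_eq_iff commute_equiv_append_right)
qed

subsection \<open>Events\<close>

definition event :: "('p, 't) action list \<Rightarrow> 't \<Rightarrow> ('p, 't) event" where
  "event u t =
     (t, node u ` participants (Tr t), play_trace (past (participants (Tr t)) u @ [Tr t]))"

definition nodes :: "('p, 't) node set" where
  "nodes = {node u p | u p. play f u \<and> p \<in> S}"

definition events :: "('p, 't) event set" where
  "events = {event u t | u t. play f (u @ [Tr t])}"

lemma finite_plays_of_controller: "finite {u. play f u}"
  using finite_consistent[OF terminating] finite_alphabet by simp

lemma finite_nodes: "finite nodes"
proof -
  have "nodes = (\<lambda>(u, p). node u p) ` ({u. play f u} \<times> S)" by (auto simp: nodes_def)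
  then show ?thesis using finite_plays_of_controller finite_slices by simp
qed

lemma finite_events: "finite events"
proof -
  have "events \<subseteq> (\<lambda>(u, t). event u t) ` ({u. play f u} \<times> transitions G)"
  proof
    fix x assume "x \<in> events"
    then obtain u t where x: "x = event u t" "play f (u @ [Tr t])" by (auto simp: events_def)
    note u = consistent_snocD[OF x(2)]
    have "t \<in> transitions G" using x(2) play_Tr_iff[OF u] by blast
    then show "x \<in> (\<lambda>(u, t). event u t) ` ({u. play f u} \<times> transitions G)"
      using x(1) u by (intro image_eqI[of _ _ "(u, t)"]) simp_all
  qed
  then show ?thesis
    by (rule finite_subset) (simp add: finite_plays_of_controller finite_game(2))
qed

lemma slice_eq_if_node_eq:
  assumes "play f u" "play f v" "p \<in> S" "r \<in> S" "node u p = node v r"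
  shows "p = r"
  using slice_of_place_unique[of "node_place u p" p r] node_place_in_slice assms by metis

lemma inj_on_node: "play f u \<Longrightarrow> inj_on (node u) S"
  using slice_eq_if_node_eq by (intro inj_onI) blast

lemma trace_length_node_view_le: "trace_length (node_view u p) \<le> length u"
proof (induction u rule: rev_induct)
  case Nil
  then show ?case by (simp add: node_Nil slice_view_eq_past trace_length_trace)
next
  case (snoc a u)
  show ?case
  proof (cases "\<exists>t. a = Tr t \<and> p \<in> participants a")
    case True
    then show ?thesis
      using length_causal_past_le[of participants "{p}" "u @ [a]"]
      by (auto simp: node_Tr slice_view_eq_past trace_length_trace)
  next
    case False
    then have "node (u @ [a]) p = node u p"
      by (cases a) (simp_all add: node_Tr_other node_Commit node_Clash)
    then show ?thesis using snoc by simp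
  qed
qed

lemma trace_length_node_view_less:
  assumes "p \<in> participants (Tr t)"
  shows "trace_length (node_view u p) <
    trace_length (play_trace (past (participants (Tr t)) u @ [Tr t]))"
  using node.val_causal_past[OF assms, of u]
    trace_length_node_view_le[of "past (participants (Tr t)) u" p]
  by (simp add: trace_length_trace)

lemma event_eq_if_node_eq:
  assumes u: "play f (u @ [Tr t])" "p \<in> participants (Tr t)"
    and v: "play f (v @ [Tr t'])" "p' \<in> participants (Tr t')"
    and eq: "node (u @ [Tr t]) p = node (v @ [Tr t']) p'"
  shows "event u t = event v t'"
proof -
  let ?x = "past (participants (Tr t)) u" and ?y = "past (participants (Tr t')) v"
  have p: "p' = p"
    using slice_eq_if_node_eq[OF u(1) v(1)] participants_slice u(2) v(2) eq by blast
  have views: "play_trace (?x @ [Tr t]) = play_trace (?y @ [Tr t'])"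
    using eq u(2) v(2) by (simp add: node_Tr slice_view_snoc)
  then have equiv: "commute_equiv participants (?x @ [Tr t]) (?y @ [Tr t'])"
    by (simp add: trace_eq_iff)
  have t: "t' = t" using commute_equiv_proj[OF equiv, of p] u(2) v(2) p by simp
  have "commute_equiv participants ?x ?y"
  proof (rule commute_equiv_cancel_last)
    show "commute_equiv participants (?x @ [Tr t]) (?y @ [Tr t])" using equiv t by simp
    show "participants a \<noteq> {}" if "a \<in> set (?x @ ?y)" for a
    proof (rule participants_nonempty)
      have "a \<in> set (u @ [Tr t]) \<union> set (v @ [Tr t'])"
        using that set_causal_past_subset[of participants _ u]
          set_causal_past_subset[of participants _ v] by auto
      then show "a \<in> alphabet" using play_actions u(1) v(1) by blast
    qed
  qed
  then have "node ?x = node ?y" by (rule node.val_cong)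
  then have "node u r = node v r" if "r \<in> participants (Tr t)" for r
    using node.val_causal_past[OF that, of u] node.val_causal_past[OF that, of v] t by simp
  then show ?thesis using views t by (auto simp: event_def)
qed

end

subsection \<open>The strategy of a controller\<close>

locale controller_strategy = single_winning_controller G S det f
  for G :: "('p, 't) petri_game" and S :: "('p, 't) net set" and det :: bool
    and f :: "(('p, 't) net, ('p, 't) action) controller" +
  fixes node_name :: "('p, 't) node \<Rightarrow> 'q" and event_name :: "('p, 't) event \<Rightarrow> 'u"
  assumes inj_node_name: "inj_on node_name nodes" and inj_event_name: "inj_on event_name events"
begin

definition token :: "('p, 't) action list \<Rightarrow> ('p, 't) net \<Rightarrow> 'q" where
  "token u p = node_name (node u p)"

definition occurrence :: "('p, 't) action list \<Rightarrow> 't \<Rightarrow> 'u" where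
  "occurrence u t = event_name (event u t)"

definition strategy_net :: "('q, 'u, 'p, 't) labelled_net" where
  "strategy_net =
     \<lparr> places = node_name ` nodes,
       transitions = event_name ` events,
       pre = (\<lambda>x. case inv_into events event_name x of (t, X, V) \<Rightarrow>
         image_mset node_name (mset_set X)),
       post = (\<lambda>x. case inv_into events event_name x of (t, X, V) \<Rightarrow>
         image_mset (\<lambda>p. node_name (post_place p t, V)) (mset_set (participants (Tr t)))),
       initial = marking (token []),
       place_label = (\<lambda>x. fst (inv_into nodes node_name x)),
       trans_label = (\<lambda>x. fst (inv_into events event_name x)) \<rparr>"

lemma node_in_nodes: "play f u \<Longrightarrow> p \<in> S \<Longrightarrow> node u p \<in> nodes"
  by (auto simp: nodes_def)

lemma token_eq_iff:
  "play f u \<Longrightarrow> play f v \<Longrightarrow> p \<in> S \<Longrightarrow> r \<in> S \<Longrightarrow> token u p = token v r \<longleftrightarrow> node u p = node v r"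
  using inj_on_eq_iff[OF inj_node_name node_in_nodes node_in_nodes] by (simp add: token_def)

lemma token_cong: "node u = node v \<Longrightarrow> token u = token v"
  by (simp add: token_def fun_eq_iff)

lemma inj_on_token: "play f u \<Longrightarrow> inj_on (token u) S"
  using inj_on_node[of u] token_eq_iff[of u u] by (simp add: inj_on_def)

lemma node_of_token: "play f u \<Longrightarrow> p \<in> S \<Longrightarrow> inv_into nodes node_name (token u p) = node u p"
  unfolding token_def by (rule inv_into_f_f[OF inj_node_name node_in_nodes])

lemma event_of_occurrence:
  "play f (u @ [Tr t]) \<Longrightarrow> inv_into events event_name (occurrence u t) = event u t"
  unfolding occurrence_def by (rule inv_into_f_f[OF inj_event_name]) (auto simp: events_def)

lemma token_Tr_other: "p \<notin> participants (Tr t) \<Longrightarrow> token (u @ [Tr t]) p = token u p"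
  by (simp add: token_def node_Tr_other)

lemma places_strategy_net_iff:
  "x \<in> places strategy_net \<longleftrightarrow> (\<exists>u p. play f u \<and> p \<in> S \<and> x = token u p)"
proof -
  have "places strategy_net = node_name ` nodes" by (simp add: strategy_net_def)
  then show ?thesis unfolding token_def nodes_def by blast
qed

lemma transitions_strategy_net_iff:
  "x \<in> transitions strategy_net \<longleftrightarrow> (\<exists>u t. play f (u @ [Tr t]) \<and> x = occurrence u t)"
proof -
  have "transitions strategy_net = event_name ` events" by (simp add: strategy_net_def)
  then show ?thesis unfolding occurrence_def events_def by blast
qed

lemma transition_strategy_netE:
  assumes "x \<in> transitions strategy_net"
  obtains u t where "play f (u @ [Tr t])" "x = occurrence u t"
  using assms transitions_strategy_net_iff by blast

lemma token_in_places: "play f u \<Longrightarrow> p \<in> S \<Longrightarrow> token u p \<in> places strategy_net"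
  unfolding places_strategy_net_iff by blast

lemma occurrence_in_transitions: "play f (u @ [Tr t]) \<Longrightarrow> occurrence u t \<in> transitions strategy_net"
  unfolding transitions_strategy_net_iff by blast

lemma initial_strategy_net: "initial strategy_net = marking (token [])"
  by (simp add: strategy_net_def)

lemma place_label_token: "play f u \<Longrightarrow> p \<in> S \<Longrightarrow> place_label strategy_net (token u p) = node_place u p"
  by (simp add: strategy_net_def node_of_token)

lemma finite_strategy_net: "finite_net strategy_net"
  using finite_nodes finite_events by (simp add: finite_net_def strategy_net_def)

lemma
  assumes "play f (u @ [Tr t])"
  shows play_Tr_transition: "t \<in> transitions G"
    and play_Tr_ready: "p \<in> participants (Tr t) \<Longrightarrow> ready p t (local_state u p)"
  using assms play_Tr_iff[OF consistent_snocD[OF assms]] by blast+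

lemma play_Tr_node_place:
  assumes "play f (u @ [Tr t])" "p \<in> participants (Tr t)"
  shows "node_place u p = pre_place p t"
  using ready_node_place[OF consistent_snocD[OF assms(1)] participants_slice[OF assms(2)]]
    play_Tr_ready[OF assms] .

lemma trans_label_occurrence: "play f (u @ [Tr t]) \<Longrightarrow> trans_label strategy_net (occurrence u t) = t"
  by (simp add: strategy_net_def event_of_occurrence event_def)

lemma pre_occurrence:
  assumes "play f (u @ [Tr t])"
  shows "pre strategy_net (occurrence u t) = image_mset (token u) (mset_set (participants (Tr t)))"
proof -
  have "inj_on (node u) (participants (Tr t))"
    using inj_on_node[OF consistent_snocD[OF assms]] participants_subset by (rule inj_on_subset)
  then have "image_mset node_name (mset_set (node u ` participants (Tr t))) =
      image_mset (token u) (mset_set (participants (Tr t)))"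
    by (simp add: image_mset_mset_set[symmetric] multiset.map_comp comp_def token_def[abs_def])
  then show ?thesis by (simp add: strategy_net_def event_of_occurrence[OF assms] event_def)
qed

lemma post_occurrence:
  assumes "play f (u @ [Tr t])"
  shows "post strategy_net (occurrence u t) =
    image_mset (token (u @ [Tr t])) (mset_set (participants (Tr t)))"
proof -
  have "image_mset (token (u @ [Tr t])) (mset_set (participants (Tr t))) =
      image_mset
        (\<lambda>p. node_name (post_place p t, play_trace (past (participants (Tr t)) u @ [Tr t])))
        (mset_set (participants (Tr t)))"
    by (intro image_mset_cong) (simp add: token_def node_Tr slice_view_snoc)
  then show ?thesis by (simp add: strategy_net_def event_of_occurrence[OF assms] event_def)
qed

lemma in_pre_occurrence_iff:
  "play f (u @ [Tr t]) \<Longrightarrow>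
     x \<in># pre strategy_net (occurrence u t) \<longleftrightarrow> (\<exists>p \<in> participants (Tr t). x = token u p)"
  by (auto simp: pre_occurrence)

lemma in_post_occurrence_iff:
  "play f (u @ [Tr t]) \<Longrightarrow>
     x \<in># post strategy_net (occurrence u t) \<longleftrightarrow>
     (\<exists>p \<in> participants (Tr t). x = token (u @ [Tr t]) p)"
  by (auto simp: post_occurrence)

lemma occurrence_fire:
  assumes "play f (u @ [Tr t])"
  shows "enabled strategy_net (marking (token u)) (occurrence u t)"
    and "fire strategy_net (marking (token u)) (occurrence u t) = marking (token (u @ [Tr t]))"
  using marking_fire[OF occurrence_in_transitions[OF assms] pre_occurrence[OF assms]
      post_occurrence[OF assms]]
    token_Tr_other by auto

lemma node_eq_if_token_subset:
  assumes "play f u" "play f v" "token u ` participants a \<subseteq> token v ` S" "p \<in> participants a"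
  shows "node u p = node v p"
proof -
  have p: "p \<in> S" using assms(4) by (rule participants_slice)
  obtain r where r: "r \<in> S" "token u p = token v r" using assms(3,4) by blast
  then have "node u p = node v r" using token_eq_iff assms(1,2) p by simp
  then show ?thesis using slice_eq_if_node_eq[OF assms(1,2) p r(1)] by simp
qed

lemma occurrence_eq_if_node_eq:
  assumes u: "play f (u @ [Tr t])" and v: "play f v"
    and node: "\<And>p. p \<in> participants (Tr t) \<Longrightarrow> node u p = node v p"
    and v_step: "saturated slice_game f v \<or> play f (v @ [Tr t])"
  shows "play f (v @ [Tr t])" and "occurrence u t = occurrence v t"
proof -
  note u' = consistent_snocD[OF u]
  have t: "t \<in> transitions G" using u by (rule play_Tr_transition)
  have state: "local_state v p = local_state u p" if p: "p \<in> participants (Tr t)" for p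
    using local_state_eq_if_node_eq[OF u' play_Tr_ready[OF u p] v _ participants_slice[OF p]
        node[OF p]]
      v_step play_Tr_ready p by blast
  then show "play f (v @ [Tr t])" using play_Tr_iff[OF v] t play_Tr_ready[OF u] by simp
  have "play_trace (past (participants (Tr t)) u @ [Tr t]) =
      play_trace (past (participants (Tr t)) v @ [Tr t])"
    using play_trace_past_eq_if_node_eq[OF u' v t] node state by simp
  moreover have "node u ` participants (Tr t) = node v ` participants (Tr t)"
    using node by (rule image_cong[OF refl])
  ultimately show "occurrence u t = occurrence v t" by (simp only: occurrence_def event_def)
qed

lemma enabled_occurrence:
  assumes sat: "saturated slice_game f u" and en: "enabled strategy_net (marking (token u)) x"
  shows "\<exists>t. x = occurrence u t \<and> play f (u @ [Tr t])"
proof -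
  note u = saturated_consistent[OF sat]
  obtain v t where v: "play f (v @ [Tr t])" "x = occurrence v t"
    using en transition_strategy_netE by (auto simp: enabled_def)
  have "set_mset (pre strategy_net x) \<subseteq> set_mset (marking (token u))"
    using en by (auto simp: enabled_def dest: set_mset_mono)
  then have "token v ` participants (Tr t) \<subseteq> token u ` S"
    using in_pre_occurrence_iff[OF v(1)] in_marking_iff[of _ "token u"] unfolding v(2) by blast
  then have "node v p = node u p" if "p \<in> participants (Tr t)" for p
    using node_eq_if_token_subset[OF consistent_snocD[OF v(1)] u _ that] by blast
  then show ?thesis using occurrence_eq_if_node_eq[OF v(1) u] sat v(2) by blast
qed

lemma saturated_same_token:
  assumes "play f u"
  shows "\<exists>x. set x \<inter> observable G = {} \<and> saturated slice_game f (u @ x) \<and> token (u @ x) = token u"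
proof -
  obtain x where x: "set x \<subseteq> commit_actions G" "saturated slice_game f (u @ x)"
    using saturated_extension[OF terminating assms] by auto
  have "token (u @ x) = token u" using token_cong[OF node_append_commits[OF x(1)]] .
  moreover have "set x \<inter> observable G = {}"
    using x(1) by (auto simp: observable_def commit_actions_def)
  ultimately show ?thesis using x(2) by blast
qed

lemma enabled_play:
  assumes "play f u" and en: "enabled strategy_net (marking (token u)) x"
  shows "\<exists>y. set y \<inter> observable G = {} \<and> play f (u @ y @ [Tr (trans_label strategy_net x)]) \<and>
    marking (token (u @ y @ [Tr (trans_label strategy_net x)])) =
      fire strategy_net (marking (token u)) x"
proof -
  obtain y where y: "set y \<inter> observable G = {}" "saturated slice_game f (u @ y)"
      "token (u @ y) = token u"
    using saturated_same_token[OF assms(1)] by blast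
  then obtain t where t: "x = occurrence (u @ y) t" "play f ((u @ y) @ [Tr t])"
    using enabled_occurrence[OF y(2)] en by auto
  then show ?thesis
    using y(1,3) trans_label_occurrence[OF t(2)] occurrence_fire(2)[OF t(2)]
    by (intro exI[of _ y]) simp
qed

sublocale play_marking G slice_game strategy_net f "\<lambda>u. marking (token u)"
proof
  show "marking (token u) = marking (token v)"
    if "commute_equiv (action_dom (arena slice_game)) u v" for u v
    using that token_cong[OF node.val_cong] by simp
  show "trans_label strategy_net x \<in> transitions G" if "x \<in> transitions strategy_net" for x
    using that play_Tr_transition trans_label_occurrence by (elim transition_strategy_netE) simp
  show "\<exists>x. enabled strategy_net (marking (token u)) x \<and> a = Tr (trans_label strategy_net x) \<and>
      marking (token (u @ [a])) = fire strategy_net (marking (token u)) x"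
    if play: "play f (u @ [a])" and obs: "a \<in> observable G" for u a
  proof -
    obtain t where a: "a = Tr t" using obs by (auto simp: observable_def)
    then show ?thesis
      using occurrence_fire[OF play[unfolded a]] trans_label_occurrence[OF play[unfolded a]]
      by (intro exI[of _ "occurrence u t"]) simp
  qed
  show "marking (token (u @ [a])) = marking (token u)"
    if play: "play f (u @ [a])" and internal: "a \<notin> observable G" for u a
  proof -
    have "a \<notin> range Tr"
      using internal consistent_snoc_action[OF play]
      by (auto simp: observable_def alphabet_def commit_actions_def elim: clashE)
    then show ?thesis by (simp add: token_cong[OF node_snoc_internal])
  qed
qed (use initial_strategy_net enabled_play in auto)

lemma reachable_saturated:
  assumes "reachable strategy_net M"
  shows "\<exists>u. saturated slice_game f u \<and> M = marking (token u)"
  using reachable_marked[OF assms] saturated_same_token by metis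

subsection \<open>The strategy is a branching process\<close>

lemma place_pre_tokenE:
  assumes "play f u" "p \<in> S" "x \<in> place_pre strategy_net (token u p)"
  obtains v t r where "play f (v @ [Tr t])" "x = occurrence v t" "r \<in> participants (Tr t)"
    "node u p = node (v @ [Tr t]) r"
proof -
  obtain v t where v: "play f (v @ [Tr t])" "x = occurrence v t"
    using assms(3) transition_strategy_netE by (auto simp: place_pre_def)
  then obtain r where r: "r \<in> participants (Tr t)" "token u p = token (v @ [Tr t]) r"
    using assms(3) in_post_occurrence_iff by (auto simp: place_pre_def)
  then show thesis
    using that v token_eq_iff[OF assms(1) v(1) assms(2) participants_slice[OF r(1)]] by blast
qed

lemma place_pre_initial_token: "p \<in> S \<Longrightarrow> place_pre strategy_net (token [] p) = {}"
proof (rule equals0I)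
  fix x assume p: "p \<in> S" and x: "x \<in> place_pre strategy_net (token [] p)"
  obtain v t r where r: "r \<in> participants (Tr t)" "node [] p = node (v @ [Tr t]) r"
    using place_pre_tokenE[OF consistent_Nil p x] .
  then have "trace_length (node_view [] p) = Suc (length (past (participants (Tr t)) v))"
    by (simp add: node_Tr slice_view_snoc trace_length_trace)
  then show False using trace_length_node_view_le[of "[]" p] by simp
qed

lemma initial_places: "{x \<in> places strategy_net. place_pre strategy_net x = {}} = token [] ` S"
proof (intro subset_antisym subsetI)
  fix x assume "x \<in> {x \<in> places strategy_net. place_pre strategy_net x = {}}"
  then obtain u p where x: "play f u" "p \<in> S" "x = token u p" "place_pre strategy_net x = {}"
    by (auto simp: places_strategy_net_iff)
  have "occurrence w t \<in> place_pre strategy_net x"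
    if "play f (w @ [Tr t])" "p \<in> participants (Tr t)" "node u p = node (w @ [Tr t]) p" for w t
    using that x(3) occurrence_in_transitions in_post_occurrence_iff
    by (auto simp: place_pre_def token_def)
  then have "node u p = node [] p" using node_origin[OF x(1)] x(4) by blast
  then show "x \<in> token [] ` S" using x by (auto simp: token_def)
next
  fix x assume "x \<in> token [] ` S"
  then show "x \<in> {x \<in> places strategy_net. place_pre strategy_net x = {}}"
    using place_pre_initial_token token_in_places[OF consistent_Nil] by auto
qed

lemma wf_flow_strategy_net: "wf (flow_rel strategy_net)"
proof -
  define age where "age x = (case x of
      Inl q \<Rightarrow> 2 * trace_length (snd (inv_into nodes node_name q)) + 1
    | Inr y \<Rightarrow> 2 * trace_length (snd (snd (inv_into events event_name y))))" for x
  have age_token: "age (Inl (token u p)) = 2 * trace_length (node_view u p) + 1"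
    if "play f u" "p \<in> S" for u p
    using that by (simp add: age_def node_of_token)
  have age_occurrence: "age (Inr (occurrence u t)) =
      2 * trace_length (play_trace (past (participants (Tr t)) u @ [Tr t]))"
    if "play f (u @ [Tr t])" for u t
    using that by (simp add: age_def event_of_occurrence event_def)
  have "age x < age y" if "(x, y) \<in> flow_rel strategy_net" for x y
    using that unfolding flow_rel_def
  proof (elim UnE CollectE exE conjE)
    fix q z assume edge: "(x, y) = (Inl q, Inr z)" and z: "z \<in> transitions strategy_net"
      "q \<in># pre strategy_net z"
    obtain u t where u: "play f (u @ [Tr t])" "z = occurrence u t"
      using z(1) by (rule transition_strategy_netE)
    then obtain p where p: "p \<in> participants (Tr t)" "q = token u p"
      using z(2) in_pre_occurrence_iff by blast
    then show ?thesis
      using edge u age_token[OF consistent_snocD[OF u(1)] participants_slice[OF p(1)]]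
        age_occurrence[OF u(1)] trace_length_node_view_less[OF p(1), of u] by simp
  next
    fix q z assume edge: "(x, y) = (Inr z, Inl q)" and z: "z \<in> transitions strategy_net"
      "q \<in># post strategy_net z"
    obtain u t where u: "play f (u @ [Tr t])" "z = occurrence u t"
      using z(1) by (rule transition_strategy_netE)
    then obtain p where p: "p \<in> participants (Tr t)" "q = token (u @ [Tr t]) p"
      using z(2) in_post_occurrence_iff by blast
    then show ?thesis
      using edge u age_token[OF u(1) participants_slice[OF p(1)]] age_occurrence[OF u(1)]
      by (simp add: node_Tr slice_view_snoc)
  qed
  then have "flow_rel strategy_net \<subseteq> measure age" by auto
  then show ?thesis using wf_measure wf_subset by blast
qed

lemma petri_net_strategy_net: "petri_net strategy_net"
  unfolding petri_net_def
proof (intro conjI ballI)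
  fix x assume "x \<in> transitions strategy_net"
  then obtain u t where u: "play f (u @ [Tr t])" "x = occurrence u t"
    by (rule transition_strategy_netE)
  then show "set_mset (pre strategy_net x) \<subseteq> places strategy_net"
    "set_mset (post strategy_net x) \<subseteq> places strategy_net"
    using token_in_places[OF consistent_snocD[OF u(1)] participants_slice]
      token_in_places[OF u(1) participants_slice]
    by (auto simp: in_pre_occurrence_iff in_post_occurrence_iff)
next
  show "set_mset (initial strategy_net) \<subseteq> places strategy_net"
    using token_in_places[OF consistent_Nil] by (auto simp: initial_strategy_net in_marking_iff)
qed

lemma count_token_le_1:
  assumes "play f u" "X \<subseteq> S"
  shows "count (image_mset (token u) (mset_set X)) x \<le> 1"
  using image_mset_mset_set[OF inj_on_subset[OF inj_on_token[OF assms(1)] assms(2)]]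
  by (simp add: count_mset_set')

sublocale causal_net strategy_net
proof
  fix x assume "x \<in> transitions strategy_net"
  then obtain u t where u: "play f (u @ [Tr t])" "x = occurrence u t"
    by (rule transition_strategy_netE)
  show "count (pre strategy_net x) y \<le> 1" "count (post strategy_net x) y \<le> 1" for y
    using count_token_le_1[OF consistent_snocD[OF u(1)] participants_subset]
      count_token_le_1[OF u(1) participants_subset]
    by (simp_all add: u(2) pre_occurrence[OF u(1)] post_occurrence[OF u(1)])
  show "pre strategy_net x \<noteq> {#}"
    using participants_Tr_nonempty[OF play_Tr_transition[OF u(1)]]
    by (simp add: u(2) pre_occurrence[OF u(1)] mset_set_empty_iff)
next
  show "initial strategy_net = mset_set {x \<in> places strategy_net. place_pre strategy_net x = {}}"
    unfolding initial_places initial_strategy_net marking_def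
    using inj_on_token[OF consistent_Nil] by (rule image_mset_mset_set)
  show "finite {x \<in> places strategy_net. place_pre strategy_net x = {}}"
    unfolding initial_places using finite_slices by simp
next
  fix x y z
  assume "x \<in> places strategy_net" "y \<in> place_pre strategy_net x" "z \<in> place_pre strategy_net x"
  moreover from this obtain u p where u: "play f u" "p \<in> S" "x = token u p"
    by (auto simp: places_strategy_net_iff)
  ultimately show "y = z"
    using event_eq_if_node_eq by (elim place_pre_tokenE[OF u(1,2), folded u(3)])
      (metis occurrence_def)
qed (use petri_net_strategy_net wf_flow_strategy_net in auto)

lemma occurrence_net_strategy_net: "occurrence_net strategy_net"
proof (rule occurrence_net_if_live)
  fix x assume "x \<in> transitions strategy_net"
  then obtain u t where u: "play f (u @ [Tr t])" "x = occurrence u t"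
    by (rule transition_strategy_netE)
  then show "\<exists>M. reachable strategy_net M \<and> enabled strategy_net M x"
    using occurrence_fire(1)[OF u(1)] mark_reachable[OF consistent_snocD[OF u(1)]] by blast
qed

lemma initial_homomorphism_strategy_net: "initial_homomorphism strategy_net G"
  unfolding initial_homomorphism_def
proof (intro conjI ballI)
  show "place_label strategy_net ` places strategy_net \<subseteq> places G"
    using place_label_token node_place_in_slice slice_places_subset
    by (fastforce simp: places_strategy_net_iff)
  show "trans_label strategy_net ` transitions strategy_net \<subseteq> transitions G"
    using trans_label by blast
next
  fix x assume "x \<in> transitions strategy_net"
  then obtain u t where u: "play f (u @ [Tr t])" "x = occurrence u t"
    by (rule transition_strategy_netE)
  note t = play_Tr_transition[OF u(1)]
  have "place_label strategy_net (token u p) = pre_place p t"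
    "place_label strategy_net (token (u @ [Tr t]) p) = post_place p t"
      if "p \<in> participants (Tr t)" for p
    using place_label_token[OF _ participants_slice[OF that]] consistent_snocD[OF u(1)] u(1)
      play_Tr_node_place[OF u(1) that] node_Tr[OF that] by simp_all
  then show
    "image_mset (place_label strategy_net) (pre strategy_net x) =
      pre G (trans_label strategy_net x)"
    "image_mset (place_label strategy_net) (post strategy_net x) =
      post G (trans_label strategy_net x)"
    unfolding u(2) trans_label_occurrence[OF u(1)] pre_occurrence[OF u(1)] post_occurrence[OF u(1)]
      pre_eq_pre_places[OF t] post_eq_post_places[OF t] multiset.map_comp
    by (auto intro!: image_mset_cong)
next
  show "image_mset (place_label strategy_net) (initial strategy_net) = initial G"
    unfolding initial_strategy_net marking_def initial_eq_initial_places multiset.map_comp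
    using place_label_token[OF consistent_Nil] finite_slices
    by (intro image_mset_cong) (simp add: node_Nil)
qed

lemma occurrence_eq_if_pre_eq:
  assumes u: "play f (u @ [Tr t])" and v: "play f (v @ [Tr t])"
    and "pre strategy_net (occurrence u t) = pre strategy_net (occurrence v t)"
  shows "occurrence u t = occurrence v t"
proof (rule occurrence_eq_if_node_eq(2)[OF u consistent_snocD[OF v]])
  have "token u ` participants (Tr t) \<subseteq> token v ` S"
    using in_pre_occurrence_iff[OF u] in_pre_occurrence_iff[OF v] participants_slice
    unfolding assms(3) by blast
  then show "node u p = node v p" if "p \<in> participants (Tr t)" for p
    using node_eq_if_token_subset consistent_snocD[OF u] consistent_snocD[OF v] that by blast
qed (use v in simp)

lemma branching_process_strategy_net: "branching_process G strategy_net"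
  unfolding branching_process_def
proof (intro conjI ballI impI)
  fix x y
  assume "x \<in> transitions strategy_net" "y \<in> transitions strategy_net"
    and same: "pre strategy_net x = pre strategy_net y \<and>
      trans_label strategy_net x = trans_label strategy_net y"
  then obtain u t v t' where u: "play f (u @ [Tr t])" "x = occurrence u t"
      and v: "play f (v @ [Tr t'])" "y = occurrence v t'"
    by (elim transition_strategy_netE)
  have "t' = t" using same u v trans_label_occurrence by simp
  then show "x = y" using occurrence_eq_if_pre_eq u v same by simp
qed (use occurrence_net_strategy_net initial_homomorphism_strategy_net in auto)

subsection \<open>The strategy is justified, winning and deterministic\<close>

lemma ready_if_offered:
  assumes sat: "saturated slice_game f u" and p: "p \<in> participants (Tr t)"
    and "t \<in> trans_label strategy_net ` place_post strategy_net (token u p)"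
  shows "ready p t (local_state u p)"
proof -
  note u = saturated_consistent[OF sat] and pS = participants_slice[OF p]
  obtain v t' where v': "play f (v @ [Tr t'])" "trans_label strategy_net (occurrence v t') = t"
      "token u p \<in># pre strategy_net (occurrence v t')"
    using assms(3) by (auto simp: place_post_def elim!: transition_strategy_netE)
  then have v: "play f (v @ [Tr t])" using trans_label_occurrence by simp
  obtain r where r: "r \<in> participants (Tr t)" "token u p = token v r"
    using v' in_pre_occurrence_iff trans_label_occurrence by metis
  note v_play = consistent_snocD[OF v]
  have node: "node u p = node v r"
    using token_eq_iff[OF u v_play pS participants_slice[OF r(1)]] r(2) by blast
  then have "p = r" using slice_eq_if_node_eq[OF u v_play pS participants_slice[OF r(1)]] by blast
  then have "local_state u p = local_state v p"
    using local_state_eq_if_node_eq[OF v_play play_Tr_ready[OF v p] u] sat pS node by simp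
  then show ?thesis using play_Tr_ready[OF v p] by simp
qed

lemma env_place_ready:
  assumes "play f u" "p \<in> participants (Tr t)" "node_place u p = pre_place p t"
    and "pre_place p t \<notin> sys_places G"
  shows "ready p t (local_state u p)"
proof -
  have "pre_place p t \<in> env_places G"
    using assms(4) env_place_iff pre_place_in_slice[OF assms(2)]
      slice_places_subset[OF participants_slice[OF assms(2)]] by blast
  then show ?thesis
    using commitment_cases[OF assms(1) participants_slice[OF assms(2)]] assms(3,4)
    by (auto simp: uncommitted_def committed_def ready_def)
qed

lemma marked_preset_eq_tokens:
  assumes u: "play f u"
    and t: "t \<in> transitions G" and C: "finite C" "C \<subseteq> set_mset (marking (token u))"
    and label: "image_mset (place_label strategy_net) (mset_set C) = pre G t"
  shows "C = token u ` participants (Tr t)"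
    and "p \<in> participants (Tr t) \<Longrightarrow> node_place u p = pre_place p t"
proof -
  have labels: "place_label strategy_net ` C = set_mset (pre G t)"
    using label C(1) by (metis finite_set_mset_mset_set set_image_mset)
  have token: "\<exists>p \<in> S. x = token u p \<and> place_label strategy_net x = node_place u p" if "x \<in> C" for x
    using C(2) that in_marking_iff[of x "token u"] place_label_token[OF u] by blast
  have member: "token u p \<in> C \<and> node_place u p = pre_place p t"
    if p: "p \<in> participants (Tr t)" for p
  proof -
    have "pre_place p t \<in> place_label strategy_net ` C" using labels in_pre_iff[OF t] p by blast
    then obtain r where r: "r \<in> S" "token u r \<in> C" "node_place u r = pre_place p t"
      using token by fastforce
    then have "r = p"
      using slice_of_place_unique node_place_in_slice[OF u r(1)] pre_place_in_slice[OF p]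
        participants_slice[OF p] by metis
    then show ?thesis using r by simp
  qed
  then show "p \<in> participants (Tr t) \<Longrightarrow> node_place u p = pre_place p t" by blast
  have "x \<in> token u ` participants (Tr t)" if x: "x \<in> C" for x
  proof -
    obtain p where p: "p \<in> S" "x = token u p" "place_label strategy_net x = node_place u p"
      using token[OF x] by blast
    then have "node_place u p \<in># pre G t" using labels x by (metis imageI)
    then have "t \<in> place_post G (node_place u p)" using t by (simp add: place_post_def)
    then show ?thesis
      using place_post_participant(1)[OF p(1) node_place_in_slice[OF u p(1)]] p(2) by blast
  qed
  then show "C = token u ` participants (Tr t)" using member by blast
qed

lemma justified_refusal_strategy_net: "justified_refusal G strategy_net"
  unfolding justified_refusal_def
proof (intro allI ballI impI)
  fix C t
  assume t: "t \<in> transitions G" and C: "finite C \<and> pairwise_concurrent strategy_net C \<and>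
      image_mset (place_label strategy_net) (mset_set C) = pre G t"
  have "finite (transitions strategy_net)" using finite_strategy_net by (simp add: finite_net_def)
  then obtain u where sat: "saturated slice_game f u" and sub: "C \<subseteq> set_mset (marking (token u))"
    using pairwise_concurrent_reachable[OF occurrence_net_strategy_net] C reachable_saturated
    by blast
  note u = saturated_consistent[OF sat]
  note preset = marked_preset_eq_tokens[OF u t _ sub]
  show "(\<exists>x \<in> transitions strategy_net. trans_label strategy_net x = t \<and>
        pre strategy_net x = mset_set C) \<or>
      (\<exists>q \<in> C. place_label strategy_net q \<in> sys_places G \<and>
        t \<notin> trans_label strategy_net ` place_post strategy_net q)"
  proof (cases "\<forall>p \<in> participants (Tr t). ready p t (local_state u p)")
    case True
    then have play: "play f (u @ [Tr t])" using play_Tr_iff[OF u] t by blast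
    have "inj_on (token u) (participants (Tr t))"
      using inj_on_token[OF u] participants_subset by (rule inj_on_subset)
    then have "pre strategy_net (occurrence u t) = mset_set C"
      using preset(1) C pre_occurrence[OF play] by (simp add: image_mset_mset_set)
    then show ?thesis
      using occurrence_in_transitions[OF play] trans_label_occurrence[OF play] by blast
  next
    case False
    then obtain p where p: "p \<in> participants (Tr t)" "\<not> ready p t (local_state u p)" by blast
    have place: "node_place u p = pre_place p t" using preset(2) C p(1) by blast
    then have "pre_place p t \<in> sys_places G" using env_place_ready[OF u p(1)] p(2) by blast
    then have "place_label strategy_net (token u p) \<in> sys_places G"
      using place_label_token[OF u participants_slice[OF p(1)]] place by simp
    moreover have "token u p \<in> C" using preset(1) C p(1) by blast
    ultimately show ?thesis using ready_if_offered[OF sat p(1)] p(2) by blast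
  qed
qed

lemma final_play_if_final_marking:
  assumes sat: "saturated slice_game f u"
    and final: "final_marking strategy_net (marking (token u))"
  shows "final_play slice_game f u"
  unfolding final_play_iff
proof (intro conjI allI notI)
  show "play f u" using saturated_consistent[OF sat] .
  fix a assume play: "play f (u @ [a])"
  then show False
  proof (cases rule: play_snoc_cases)
    case (Tr t)
    then show False using occurrence_fire(1) play final by (auto simp: final_marking_def)
  next
    case (Commit p q A)
    then show False using sat play by (simp add: saturated_def)
  next
    case Clash
    then show False using no_clash play by blast
  qed
qed

theorem winning_strategy_strategy_net: "winning_strategy G strategy_net"
  unfolding winning_strategy_def strategy_def
proof (intro conjI allI impI ballI)
  fix M x assume M: "reachable strategy_net M \<and> final_marking strategy_net M" and x: "x \<in># M"
  obtain u where sat: "saturated slice_game f u" and Mu: "M = marking (token u)"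
    using reachable_saturated M by blast
  note u = saturated_consistent[OF sat]
  obtain p where p: "p \<in> S" "x = token u p" using x Mu in_marking_iff[of x] by blast
  have "final_play slice_game f u" using final_play_if_final_marking[OF sat] M Mu by simp
  then have "local_state u p \<in> slice_win G p"
    using winning_controller p(1) by (simp add: winning_controller_iff)
  then have "node_place u p \<in> win_places G"
    using commitment_cases[OF u p(1)] by (auto simp: slice_win_def uncommitted_def committed_def)
  then show "place_label strategy_net x \<in> win_places G"
    using place_label_token[OF u p(1)] p(2) by simp
qed (use finite_strategy_net branching_process_strategy_net justified_refusal_strategy_net in auto)

text \<open>Two transitions in conflict at a system place are both in the commitment made there, so the
  clash between them can occur.\<close>

lemma system_place_at_most_one_transition:
  assumes det and u: "play f u"
    and t1: "play f (u @ [Tr t1])" and t2: "play f (u @ [Tr t2])"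
    and p: "p \<in> participants (Tr t1)" "p \<in> participants (Tr t2)" "node_place u p \<in> sys_places G"
  shows "t1 = t2"
proof (rule ccontr)
  assume "t1 \<noteq> t2"
  let ?q = "node_place u p"
  have p_in_S: "p \<in> S" using p(1) by (rule participants_slice)
  have "ready p t1 (local_state u p)" "ready p t2 (local_state u p)"
    "?q = pre_place p t1" "?q = pre_place p t2"
    using play_Tr_ready[OF t1 p(1)] play_Tr_ready[OF t2 p(2)]
      play_Tr_node_place[OF t1 p(1)] play_Tr_node_place[OF t2 p(2)] by simp_all
  then obtain A where A: "local_state u p = Committed ?q A" "A \<subseteq> place_post G ?q" "t1 \<in> A" "t2 \<in> A"
    using p(3) sys_places_disjoint by (auto simp: ready_def)
  then have clash: "Clash ?q A t1 t2 \<in> clashes"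
    unfolding clashes_def using \<open>det\<close> \<open>t1 \<noteq> t2\<close> p(3) by (auto simp: clash_actions_def)
  moreover have "\<forall>t \<in> {t1, t2}. \<forall>r \<in> participants (Tr t). ready r t (local_state u r)"
    using play_Tr_ready t1 t2 by blast
  ultimately have "play f (u @ [Clash ?q A t1 t2])"
    using play_Clash_iff[OF u p_in_S node_place_in_slice[OF u p_in_S]] A(1) by blast
  then show False using no_clash[OF clash] by blast
qed

theorem deterministic_strategy_strategy_net:
  assumes det
  shows "deterministic_strategy G strategy_net"
  unfolding deterministic_strategy_def
proof (intro allI impI ballI)
  fix M x y z
  assume M: "reachable strategy_net M \<and> x \<in># M \<and> place_label strategy_net x \<in> sys_places G"
    and post: "y \<in> place_post strategy_net x" "z \<in> place_post strategy_net x"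
    and en: "enabled strategy_net M y \<and> enabled strategy_net M z"
  obtain u where sat: "saturated slice_game f u" and Mu: "M = marking (token u)"
    using reachable_saturated M by blast
  note u = saturated_consistent[OF sat]
  obtain t1 where t1: "y = occurrence u t1" "play f (u @ [Tr t1])"
    using enabled_occurrence[OF sat] en Mu by blast
  obtain t2 where t2: "z = occurrence u t2" "play f (u @ [Tr t2])"
    using enabled_occurrence[OF sat] en Mu by blast
  obtain p where p: "p \<in> participants (Tr t1)" "x = token u p"
    using post(1) t1 in_pre_occurrence_iff by (auto simp: place_post_def)
  obtain r where r: "r \<in> participants (Tr t2)" "x = token u r"
    using post(2) t2 in_pre_occurrence_iff by (auto simp: place_post_def)
  have slices: "p \<in> S" "r \<in> S" using p(1) r(1) participants_slice by blast+
  then have "p = r" using inj_onD[OF inj_on_token[OF u]] p(2) r(2) by blast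
  moreover have "node_place u p \<in> sys_places G"
    using M p(2) place_label_token[OF u slices(1)] by simp
  ultimately have "t1 = t2"
    using system_place_at_most_one_transition[OF \<open>det\<close> u t1(2) t2(2)] p(1) r(1) by blast
  then show "y = z" using t1(1) t2(1) by simp
qed

end

section \<open>Strategy-equivalence of the Petri game and the control games\<close>

theorem (in sliced_game) strategy_equivalent_slice_game:
  "strategy_equivalent G slice_game
     {\<sigma> :: ('q::infinite, 'u::infinite, 'p, 't) labelled_net.
        winning_strategy G \<sigma> \<and> (det \<longrightarrow> deterministic_strategy G \<sigma>)}
     {f. winning_controller slice_game f \<and> single_commitment slice_game f}"
  unfolding strategy_equivalent_def
proof (intro conjI ballI)
  fix \<sigma> :: "('q, 'u, 'p, 't) labelled_net"
  assume "\<sigma> \<in> {\<sigma>. winning_strategy G \<sigma> \<and> (det \<longrightarrow> deterministic_strategy G \<sigma>)}"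
  then interpret strategy_controller G S det \<sigma> by unfold_locales auto
  show "\<exists>f \<in> {f. winning_controller slice_game f \<and> single_commitment slice_game f}.
      bisimilar G slice_game \<sigma> f"
    using winning_replay_controller single_commitment_replay_controller bisimilar by blast
next
  fix f assume "f \<in> {f. winning_controller slice_game f \<and> single_commitment slice_game f}"
  then interpret single_winning_controller G S det f by unfold_locales auto
  obtain node_name :: "('p, 't) node \<Rightarrow> 'q" where "inj_on node_name nodes"
    using arb_inj_on_finite_infinite[OF finite_nodes] by blast
  moreover obtain event_name :: "('p, 't) event \<Rightarrow> 'u" where "inj_on event_name events"
    using arb_inj_on_finite_infinite[OF finite_events] by blast
  ultimately interpret controller_strategy G S det f node_name event_name by unfold_locales
  show "\<exists>\<sigma> \<in> {\<sigma> :: ('q, 'u, 'p, 't) labelled_net.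
      winning_strategy G \<sigma> \<and> (det \<longrightarrow> deterministic_strategy G \<sigma>)}. bisimilar G slice_game \<sigma> f"
    using winning_strategy_strategy_net deterministic_strategy_strategy_net bisimilar by blast
qed

theorem theorem3:
  fixes G :: "('p, 't) petri_game" and S :: "('p, 't) net set"
  assumes "petri_game G" and "slice_distribution G S"
  shows
    "strategy_equivalent G (control_game_of G S)
       {\<sigma> :: ('q::infinite, 'u::infinite, 'p, 't) labelled_net. winning_strategy G \<sigma>}
       {f. winning_controller (control_game_of G S) f \<and> single_commitment (control_game_of G S) f} \<and>
     (\<forall>f. winning_controller (control_game_of G S) f \<longrightarrow>
       (\<exists>f'. restricts (control_game_of G S) f' f \<and>
         winning_controller (control_game_of G S) f' \<and>
         single_commitment (control_game_of G S) f')) \<and>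
     strategy_equivalent G (control_game_det_of G S)
       {\<sigma> :: ('q, 'u, 'p, 't) labelled_net. winning_strategy G \<sigma> \<and> deterministic_strategy G \<sigma>}
       {f. winning_controller (control_game_det_of G S) f \<and>
           single_commitment (control_game_det_of G S) f} \<and>
     (\<forall>f. winning_controller (control_game_det_of G S) f \<longrightarrow>
       (\<exists>f'. restricts (control_game_det_of G S) f' f \<and>
         winning_controller (control_game_det_of G S) f' \<and>
         single_commitment (control_game_det_of G S) f'))"
proof -
  interpret plain: sliced_game G S False using assms by unfold_locales
  interpret hat: sliced_game G S True using assms by unfold_locales
  have "plain.slice_game = control_game_of G S" "hat.slice_game = control_game_det_of G S"
    by (simp_all add: plain.slice_game_def hat.slice_game_def)
  then show ?thesis
    using plain.strategy_equivalent_slice_game hat.strategy_equivalent_slice_game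
      plain.slice_game_single_commitment_restriction hat.slice_game_single_commitment_restriction
    by simp
qed

end
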